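(* Let $\{X_t; t\ge 0\}$ be a (non-explosive) birth-death chain on $\mathbb{N}=\{0,1,2,\dots\}$ with birth rates $\beta_k\ge 0$ and death rates $\delta_k\ge 0$ ($k\ge 0$, $\delta_0=0$), and suppose that infinitely many of the rates $\{\beta_k,\delta_k\}_{k\ge 0}$ are non-zero. Then the chain preserves the class of t-stable probability measures on $\mathbb{N}$ if and only if the birth rates are constant (i.e. $\beta_k=\beta_0$ for all $k\ge 0$) and there are constants $d_1,d_2\in\mathbb{R}$ such that $\delta_k=d_1k+d_2k^2$ for all $k\ge 0$.
   Context: A birth-death chain is a continuous-time Markov process on $\mathbb{N}=\{0,1,2,\dots\}$ with transitions $k\mapsto k+1$ at rate $\beta_k$ and $k\mapsto k-1$ at rate $\delta_k$, with $\delta_0=0$. Only rates for which the process does not blow up in finite time are considered. A polynomial $f\in\mathbb{C}[x]$ is stable if $f(x)\neq 0$ whenever $\operatorname{Im}(x)>0$. A function $f$ on $\mathbb{C}$ is t-stable (transcendental stable) if there are stable polynomials $f_m$ with $f_m\to f$ uniformly on all compact subsets of $\mathbb{C}$. A probability measure $\mu$ on $\mathbb{N}$ is t-stable if its generating function $\sum_{k\ge 0}\mu(k)x^k$ is (the power series of) a t-stable function on $\mathbb{C}$. The chain preserves the class of t-stable measures if, whenever the distribution of $X_0$ is t-stable, the distribution of $X_t$ is t-stable for every $t>0$. *)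

theory Defs
  imports "HOL-Probability.Probability" "HOL-Computational_Algebra.Polynomial"
begin

section \<open>Stability\<close>

definition stable_poly :: "complex poly \<Rightarrow> bool" where
  "stable_poly p \<longleftrightarrow> (\<forall>z. Im z > 0 \<longrightarrow> poly p z \<noteq> 0)"

definition t_stable :: "(complex \<Rightarrow> complex) \<Rightarrow> bool" where
  "t_stable f \<longleftrightarrow>
     (\<exists>p :: nat \<Rightarrow> complex poly. (\<forall>m. stable_poly (p m)) \<and>
        (\<forall>K. compact K \<longrightarrow> uniform_limit K (\<lambda>m. poly (p m)) f sequentially))"

text \<open>
  A t-stable function is entire, so its power series converges on all of the plane; hence
  the generating function is required to converge to it at every complex point.
\<close>

definition t_stable_measure :: "nat measure \<Rightarrow> bool" where
  "t_stable_measure \<mu> \<longleftrightarrow>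
     (\<exists>f. t_stable f \<and> (\<forall>z. (\<lambda>k. complex_of_real (measure \<mu> {k}) * z ^ k) sums f z))"


section \<open>Birth-death chains\<close>

definition bd_rate :: "(nat \<Rightarrow> real) \<Rightarrow> (nat \<Rightarrow> real) \<Rightarrow> nat \<Rightarrow> nat \<Rightarrow> real" where
  "bd_rate \<beta> \<delta> k j =
     (if j = k + 1 then \<beta> k
      else if k = j + 1 then \<delta> k
      else if j = k then - (\<beta> k + \<delta> k)
      else 0)"

text \<open>
  Non-explosion is a property of the paths: a path is a right-continuous step function on
  \<open>[0,\<infinity>)\<close> that stays in the (discrete) state space for all times and jumps only
  finitely often in every bounded time interval.
\<close>

definition non_explosive_path :: "(real \<Rightarrow> nat) \<Rightarrow> bool" where
  "non_explosive_path w \<longleftrightarrow>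
     (\<forall>t\<ge>0. (w \<longlongrightarrow> w t) (at_right t)) \<and>
     (\<forall>T. finite {t. 0 < t \<and> t \<le> T \<and> \<not> isCont w t})"

text \<open>The \<open>\<sigma>\<close>-algebra generated by \<open>X u\<close>, \<open>0 \<le> u \<le> s\<close>.\<close>

definition past :: "'w measure \<Rightarrow> (real \<Rightarrow> 'w \<Rightarrow> nat) \<Rightarrow> real \<Rightarrow> 'w set set" where
  "past \<Omega> X s =
     sigma_sets (space \<Omega>) {X u -` {j} \<inter> space \<Omega> | u j. 0 \<le> u \<and> u \<le> s}"

text \<open>
  A chain is a process \<open>X\<close> on a measurable space \<open>\<Omega>\<close> (only \<open>space\<close> and
  \<open>sets\<close> of \<open>\<Omega>\<close> matter) together with the family of laws \<open>P k\<close> of the process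
  started in state \<open>k\<close>. Only the values of \<open>X\<close> at times \<open>t \<ge> 0\<close> matter.
  The rate condition says that the transition probabilities are
  \<open>p\<^sub>h(k,j) = 1\<^bsub>j=k\<^esub> + h q(k,j) + o(h)\<close> as \<open>h\<close> decreases to 0.
\<close>

locale birth_death_chain =
  fixes \<Omega> :: "'w measure"
    and P :: "nat \<Rightarrow> 'w measure"
    and X :: "real \<Rightarrow> 'w \<Rightarrow> nat"
    and \<beta> \<delta> :: "nat \<Rightarrow> real"
  assumes birth_nonneg: "\<beta> k \<ge> 0"
    and death_nonneg: "\<delta> k \<ge> 0"
    and death_0: "\<delta> 0 = 0"
    and law: "P k \<in> space (prob_algebra \<Omega>)"
    and state_measurable: "t \<ge> 0 \<Longrightarrow> X t \<in> \<Omega> \<rightarrow>\<^sub>M count_space UNIV"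
    and start: "AE \<omega> in P k. X 0 \<omega> = k"
    and non_explosive: "AE \<omega> in P k. non_explosive_path (\<lambda>t. X t \<omega>)"
    and markov: "\<lbrakk>s \<ge> 0; t \<ge> 0; A \<in> past \<Omega> X s\<rbrakk> \<Longrightarrow>
      measure (P k) (A \<inter> {\<omega> \<in> space \<Omega>. X s \<omega> = i \<and> X (s + t) \<omega> = j}) =
      measure (P k) (A \<inter> {\<omega> \<in> space \<Omega>. X s \<omega> = i}) *
      measure (P i) {\<omega> \<in> space \<Omega>. X t \<omega> = j}"
    and rates: "((\<lambda>h. measure (P k) {\<omega> \<in> space \<Omega>. X h \<omega> = j})
      has_real_derivative bd_rate \<beta> \<delta> k j) (at_right 0)"

text \<open>
  The distribution of \<open>X t\<close> when \<open>X 0\<close> has distribution \<open>\<mu>\<close>: the law of the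
  process is then the mixture of the laws \<open>P k\<close> with weights \<open>\<mu>(k)\<close>.
\<close>

definition distribution_at ::
  "(nat \<Rightarrow> 'w measure) \<Rightarrow> (real \<Rightarrow> 'w \<Rightarrow> nat) \<Rightarrow> nat pmf \<Rightarrow> real \<Rightarrow> nat measure" where
  "distribution_at P X \<mu> t = distr (measure_pmf \<mu> \<bind> P) (count_space UNIV) (X t)"

definition preserves_t_stable ::
  "(nat \<Rightarrow> 'w measure) \<Rightarrow> (real \<Rightarrow> 'w \<Rightarrow> nat) \<Rightarrow> bool" where
  "preserves_t_stable P X \<longleftrightarrow>
     (\<forall>\<mu> :: nat pmf. t_stable_measure (measure_pmf \<mu>) \<longrightarrow>
        (\<forall>t>0. t_stable_measure (distribution_at P X \<mu> t)))"

lemma (in birth_death_chain) measure_distribution_at: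
  assumes "t \<ge> 0"
  shows "measure (distribution_at P X \<mu> t) {j} =
    (\<integral>k. measure (P k) {\<omega> \<in> space \<Omega>. X t \<omega> = j} \<partial>measure_pmf \<mu>)"
proof -
  have P: "P \<in> measure_pmf \<mu> \<rightarrow>\<^sub>M prob_algebra \<Omega>"
    using law by (simp add: measurable_def Pi_def)
  hence P': "P \<in> measure_pmf \<mu> \<rightarrow>\<^sub>M subprob_algebra \<Omega>"
    by (rule measurable_prob_algebraD)
  have sets: "sets (measure_pmf \<mu> \<bind> P) = sets \<Omega>"
    using P' by (subst sets_bind[where N=\<Omega>]) (auto simp: measurable_def space_subprob_algebra)
  have sp: "space (measure_pmf \<mu> \<bind> P) = space \<Omega>" by (rule sets_eq_imp_space_eq[OF sets])
  have X: "X t \<in> \<Omega> \<rightarrow>\<^sub>M count_space UNIV" by (rule state_measurable[OF assms])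
  have X': "X t \<in> (measure_pmf \<mu> \<bind> P) \<rightarrow>\<^sub>M count_space UNIV"
    using X measurable_cong_sets[OF sets refl] by blast
  have eq: "X t -` {j} \<inter> space \<Omega> = {\<omega> \<in> space \<Omega>. X t \<omega> = j}" by auto
  have ev: "{\<omega> \<in> space \<Omega>. X t \<omega> = j} \<in> sets \<Omega>"
    using measurable_sets[OF X, of "{j}"] by (simp add: eq)
  have "measure (distribution_at P X \<mu> t) {j} =
      measure (measure_pmf \<mu> \<bind> P) {\<omega> \<in> space \<Omega>. X t \<omega> = j}"
    unfolding distribution_at_def using X' by (subst measure_distr) (auto simp: sp eq)
  also have "\<dots> = (\<integral>k. measure (P k) {\<omega> \<in> space \<Omega>. X t \<omega> = j} \<partial>measure_pmf \<mu>)"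
    by (rule subprob_space.measure_bind[OF _ P' ev])
       (rule prob_space_imp_subprob_space[OF measure_pmf.prob_space_axioms])
  finally show ?thesis .
qed

end

theory Submission
  imports Defs "HOL-Complex_Analysis.Complex_Analysis"
  "HOL-Computational_Algebra.Fundamental_Theorem_Algebra"
begin

text \<open>
  A nonnegative sequence is the coefficient sequence of a t-stable function iff all its Jensen
  polynomials are stable, a condition that survives coefficientwise limits; local uniform
  convergence comes for free, because a polynomial with nonpositive roots is bounded on large discs
  by its values at \<open>1\<close> and \<open>1/2\<close>.

  Sufficiency. For constant \<open>\<beta>\<close> and \<open>\<delta>\<^sub>k = d\<^sub>1 k + d\<^sub>2 k\<^sup>2\<close> split a time step \<open>h\<close> into the Gaussian
  multiplier \<open>exp (- h (\<delta>\<^sub>k + \<beta>))\<close>, the operator \<open>1 + h (d\<^sub>2 x D\<^sup>2 + (d\<^sub>1 + d\<^sub>2) D)\<close> and multiplication by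
  \<open>1 + h \<beta> x\<close>. Each preserves stability for polynomials with nonnegative coefficients, and together
  they form a substochastic kernel with the right derivative at \<open>h = 0\<close>. Its powers dominate those of
  the transition matrix killed above a high level, up to a small error; since the chain does not
  explode, these bounds exhaust the transition probabilities and no mass is left for anything else.

  Necessity. Started from \<open>x\<^sup>i (x + r)\<^sup>3\<close>, the triple root can only survive as real roots if the generator
  applied to this polynomial vanishes at \<open>-r\<close>; this makes the third differences of both rate sequences
  vanish. Started from Poisson distributions, which have equality in Newton's inequality, the time
  derivative of that inequality shows that \<open>k \<beta>\<^bsub>k-1\<^esub>\<close> is concave, so the nonnegative quadratic \<open>\<beta>\<close> is constant.
\<close>

section \<open>Stable polynomials\<close>

text \<open>Nonnegative coefficients are what makes the operators work: they push all roots of a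
  stable real polynomial onto the nonpositive half-line. With a double root at 1, already 1 + h x
  D^2 creates nonreal roots for small h > 0.

  t-stability allows approximants with complex coefficients and unbounded degrees, so it does not
  pass easily to limits in time or in the initial law. Jensen polynomials bound the degree, and at
  bounded degree Hurwitz's theorem needs only coefficientwise convergence. Hence all limits are
  taken for \<open>laguerre_polya\<close>.

  The rates may be unbounded, so no norm estimate compares the kernel with the transition matrix
  globally. The comparison is made on a finite box of states, chosen before the time step.

  In the converse the order of the two tests matters. Differentiating a mixture at time 0 needs
  \<beta> + \<delta> to be integrable against the initial law. Finitely supported laws satisfy this
  for any rates; the quadratic form that they yield then makes Poisson laws admissible.\<close>

abbreviation cpoly :: "real poly \<Rightarrow> complex poly" where
  "cpoly \<equiv> map_poly complex_of_real"

lemma coeff_cpoly [simp]: "coeff (cpoly p) k = complex_of_real (coeff p k)"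
  by (simp add: coeff_map_poly)

lemma cpoly_mult: "cpoly (p * q) = cpoly p * cpoly q"
  by (rule poly_eqI) (simp add: coeff_mult)

lemma cpoly_add: "cpoly (p + q) = cpoly p + cpoly q"
  by (rule poly_eqI) simp

lemma cpoly_smult: "cpoly (smult c p) = smult (complex_of_real c) (cpoly p)"
  by (rule poly_eqI) simp

lemma cpoly_pCons: "cpoly (pCons c p) = pCons (complex_of_real c) (cpoly p)"
  by (rule poly_eqI) (simp add: coeff_pCons split: nat.split)

lemma cpoly_pderiv: "cpoly (pderiv p) = pderiv (cpoly p)"
  by (rule poly_eqI) (simp add: coeff_pderiv)

lemma cpoly_eq_0_iff [simp]: "cpoly p = 0 \<longleftrightarrow> p = 0"
  by (auto simp: poly_eq_iff)

lemma degree_cpoly [simp]: "degree (cpoly p) = degree p"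
  by (rule degree_map_poly) simp

lemma poly_cpoly_of_real: "poly (cpoly p) (complex_of_real x) = complex_of_real (poly p x)"
  by (induction p) (simp_all add: cpoly_pCons)

lemma poly_cpoly_cnj: "poly (cpoly p) (cnj z) = cnj (poly (cpoly p) z)"
  by (induction p) (simp_all add: cpoly_pCons)

lemmas cpoly_simps = cpoly_mult cpoly_add cpoly_smult cpoly_pCons cpoly_pderiv

section \<open>Stable polynomials and induction on their roots\<close>

lemma stable_poly_nonzero: "stable_poly p \<Longrightarrow> p \<noteq> 0"
  unfolding stable_poly_def by (metis imaginary_unit.sel(2) poly_0 zero_less_one)

lemma stable_poly_mult_iff: "stable_poly (p * q) \<longleftrightarrow> stable_poly p \<and> stable_poly q"
  unfolding stable_poly_def by auto

lemma stable_poly_const: "c \<noteq> 0 \<Longrightarrow> stable_poly [:c:]"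
  unfolding stable_poly_def by simp

lemma stable_poly_linear: "stable_poly [:-r, 1:] \<longleftrightarrow> Im r \<le> 0"
  unfolding stable_poly_def by (auto simp: not_less)

text \<open>A stable polynomial splits into linear factors with roots in the closed lower
  half-plane. Peeling them off one by one turns logarithmic derivatives into sums that can be
  estimated term by term.\<close>

lemma stable_poly_induct [consumes 1, case_names const linear]:
  assumes "stable_poly p"
    and const: "\<And>c. c \<noteq> 0 \<Longrightarrow> Q [:c:]"
    and linear: "\<And>q r. stable_poly q \<Longrightarrow> Im r \<le> 0 \<Longrightarrow> Q q \<Longrightarrow> Q ([:-r, 1:] * q)"
  shows "Q p"
  using assms(1)
proof (induction "degree p" arbitrary: p rule: less_induct)
  case (less p)
  note nz = stable_poly_nonzero[OF less.prems]
  show ?case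
  proof (cases "degree p = 0")
    case True
    then show ?thesis using const nz by (auto elim!: degree_eq_zeroE)
  next
    case False
    then obtain x where "poly p x = 0"
      using alg_closed_imp_poly_has_root by blast
    then obtain q where q: "p = [:-x, 1:] * q"
      by (auto simp: poly_eq_0_iff_dvd elim: dvdE)
    have *: "Im x \<le> 0" "stable_poly q"
      using less.prems unfolding q stable_poly_mult_iff stable_poly_linear by auto
    have "degree p = Suc (degree q)"
      unfolding q using stable_poly_nonzero[OF *(2)] by (subst degree_mult_eq) auto
    then show ?thesis using less.hyps[of q] * linear unfolding q by auto
  qed
qed

definition nonneg_stable :: "real poly \<Rightarrow> bool" where
  "nonneg_stable p \<longleftrightarrow> (\<forall>k. 0 \<le> coeff p k) \<and> (p = 0 \<or> stable_poly (cpoly p))"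

lemma nonneg_stable_coeff: "nonneg_stable p \<Longrightarrow> 0 \<le> coeff p k"
  by (simp add: nonneg_stable_def)

lemma nonneg_stable_0 [simp]: "nonneg_stable 0"
  by (simp add: nonneg_stable_def)

lemma nonneg_stable_const [simp]: "nonneg_stable [:c:] \<longleftrightarrow> 0 \<le> c"
proof -
  have "c \<noteq> 0 \<Longrightarrow> stable_poly (cpoly [:c:])"
    by (simp add: cpoly_pCons stable_poly_const)
  moreover have "(\<forall>k. 0 \<le> coeff [:c:] k) \<longleftrightarrow> 0 \<le> c"
    by (auto simp: coeff_pCons split: nat.split)
  ultimately show ?thesis unfolding nonneg_stable_def by (cases "c = 0") auto
qed

lemma coeff_mult_nonneg:
  fixes p q :: "real poly"
  assumes "\<And>k. 0 \<le> coeff p k" "\<And>k. 0 \<le> coeff q k"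
  shows "0 \<le> coeff (p * q) k"
  unfolding coeff_mult by (intro sum_nonneg mult_nonneg_nonneg assms)

lemma nonneg_stable_mult: "nonneg_stable p \<Longrightarrow> nonneg_stable q \<Longrightarrow> nonneg_stable (p * q)"
  unfolding nonneg_stable_def
  by (auto simp: cpoly_mult stable_poly_mult_iff intro: coeff_mult_nonneg)

lemma nonneg_stable_linear:
  assumes "0 \<le> a" "0 \<le> b"
  shows "nonneg_stable [:a, b:]"
proof (cases "b = 0")
  case False
  have "stable_poly (cpoly [:a, b:])"
    unfolding stable_poly_def using False by (auto simp: cpoly_simps complex_eq_iff)
  then show ?thesis
    using assms unfolding nonneg_stable_def by (auto simp: coeff_pCons split: nat.split)
qed (use assms in simp)

lemma poly_nonneg:
  fixes p :: "real poly"
  assumes "\<And>k. 0 \<le> coeff p k" "0 \<le> x"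
  shows "0 \<le> poly p x"
  unfolding poly_altdef by (intro sum_nonneg mult_nonneg_nonneg zero_le_power assms)

lemma poly_pos:
  fixes p :: "real poly"
  assumes "\<And>k. 0 \<le> coeff p k" "p \<noteq> 0" "0 < x"
  shows "0 < poly p x"
proof -
  have "0 < lead_coeff p" using assms(1)[of "degree p"] assms(2) by (simp add: order_less_le)
  then show ?thesis
    unfolding poly_altdef using assms by (intro sum_pos2[of _ "degree p"]) auto
qed

lemma real_stable_factor:
  assumes "stable_poly (cpoly p)" "\<And>x. 0 < x \<Longrightarrow> poly p x \<noteq> 0"
  obtains (const) c where "c \<noteq> 0" "p = [:c:]"
    | (linear) r q where "0 \<le> r" "p = [:r, 1:] * q"
proof (cases "degree p = 0")
  case True
  then show ?thesis
    using stable_poly_nonzero[OF assms(1)] const by (auto elim!: degree_eq_zeroE)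
next
  case False
  then obtain z where z: "poly (cpoly p) z = 0"
    using alg_closed_imp_poly_has_root[of "cpoly p"] by auto
  have "poly (cpoly p) (cnj z) = 0" using z by (simp add: poly_cpoly_cnj)
  with z assms(1) have "\<not> 0 < Im z" "\<not> 0 < Im (cnj z)"
    unfolding stable_poly_def by blast+
  then have "Im z = 0" by simp
  then obtain x where x: "z = complex_of_real x" by (metis complex_is_Real_iff Reals_cases)
  then have 0: "poly p x = 0" using z by (simp add: poly_cpoly_of_real)
  with assms(2)[of x] have "x \<le> 0" by force
  moreover obtain q where "p = [:-x, 1:] * q"
    using 0 by (auto simp: poly_eq_0_iff_dvd elim: dvdE)
  ultimately show ?thesis using linear[of "-x" q] by simp
qed

lemma stable_linear_prefix:
  assumes "0 \<le> r"
  shows "stable_poly (cpoly ([:r, 1:] * q)) \<longleftrightarrow> stable_poly (cpoly q)"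
proof -
  have "stable_poly (cpoly [:r, 1:])"
    by (auto simp: stable_poly_def cpoly_simps complex_eq_iff)
  then show ?thesis by (simp only: cpoly_mult stable_poly_mult_iff) simp
qed

text \<open>The inner induction carries positivity on the positive half-line instead of nonnegative
  coefficients: the former passes to the quotient by x + r at once, and the latter is rebuilt from
  the factors.\<close>

lemma nonneg_stable_induct [consumes 1, case_names zero const linear]:
  assumes "nonneg_stable p"
    and zero: "Q 0"
    and "\<And>c. 0 < c \<Longrightarrow> Q [:c:]"
    and "\<And>q r. nonneg_stable q \<Longrightarrow> q \<noteq> 0 \<Longrightarrow> 0 \<le> r \<Longrightarrow> Q q \<Longrightarrow> Q ([:r, 1:] * q)"
  shows "Q p"
proof -
  have "nonneg_stable p \<and> Q p"
    if "stable_poly (cpoly p)" "\<And>x. 0 < x \<Longrightarrow> poly p x > 0" for p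
    using that
  proof (induction "degree p" arbitrary: p rule: less_induct)
    case (less p)
    have nz: "poly p x \<noteq> 0" if "0 < x" for x using less.prems(2)[OF that] by simp
    consider (const) c where "c \<noteq> 0" "p = [:c:]"
      | (linear) r q where "0 \<le> r" "p = [:r, 1:] * q"
      using real_stable_factor[OF less.prems(1) nz] by metis
    then show ?case
    proof cases
      case (const c)
      then have "0 < c" using less.prems(2)[of 1] by simp
      then show ?thesis unfolding const(2) using assms(3)[of c] by simp
    next
      case (linear r q)
      have sq: "stable_poly (cpoly q)"
        using less.prems(1) linear stable_linear_prefix by blast
      have pq: "poly q x > 0" if "0 < x" for x
      proof -
        have "0 < (r + x) * poly q x" using less.prems(2)[OF that] linear by (simp add: distrib_right)
        moreover have "0 < r + x" using that linear by simp
        ultimately show ?thesis by (simp add: zero_less_mult_iff)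
      qed
      have "q \<noteq> 0" using sq stable_poly_nonzero by fastforce
      then have "degree p = Suc (degree q)"
        unfolding linear by (subst degree_mult_eq) auto
      then have IH: "nonneg_stable q \<and> Q q" using less.hyps[of q] sq pq by simp
      then show ?thesis
        using assms(4)[of q r] linear \<open>q \<noteq> 0\<close> nonneg_stable_mult[OF nonneg_stable_linear[of r 1]]
        by auto
    qed
  qed
  then show ?thesis using assms(1) zero poly_pos unfolding nonneg_stable_def by metis
qed

subsection \<open>Logarithmic derivatives\<close>

lemma logderiv_linear:
  fixes q :: "'a::field poly"
  assumes "poly q z \<noteq> 0" "z + r \<noteq> 0"
  shows "poly (pderiv ([:r, 1:] * q)) z / poly ([:r, 1:] * q) z
     = 1 / (z + r) + poly (pderiv q) z / poly q z"
proof -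
  have "poly (pderiv ([:r, 1:] * q)) z = poly q z + (z + r) * poly (pderiv q) z"
    by (simp only: pderiv_mult pderiv_pCons) (simp add: algebra_simps)
  moreover have "poly ([:r, 1:] * q) z = (z + r) * poly q z" by (simp add: algebra_simps)
  ultimately show ?thesis using assms by (simp add: field_simps)
qed

lemma nonneg_stable_root_free:
  assumes "nonneg_stable q" "q \<noteq> 0" "0 < Im z"
  shows "poly (cpoly q) z \<noteq> 0"
  using assms unfolding nonneg_stable_def stable_poly_def by blast

lemma logderiv_cpoly_linear:
  assumes "nonneg_stable q" "q \<noteq> 0" "0 < Im z"
  shows "poly (pderiv (cpoly ([:r, 1:] * q))) z / poly (cpoly ([:r, 1:] * q)) z
     = 1 / (z + of_real r) + poly (pderiv (cpoly q)) z / poly (cpoly q) z"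
proof -
  have "z + of_real r \<noteq> 0" using assms(3) by (auto simp: complex_eq_iff)
  then show ?thesis
    using logderiv_linear[of "cpoly q" z "of_real r"] nonneg_stable_root_free[OF assms]
    by (simp add: cpoly_mult cpoly_pCons del: mult_pCons_left)
qed

text \<open>Every root -r contributes 1 / (z + r), which lies in the open lower half-plane.\<close>

lemma Im_logderiv:
  assumes "nonneg_stable p" "p \<noteq> 0" "0 < Im z"
  shows "degree p = 0 \<or> Im (poly (pderiv (cpoly p)) z / poly (cpoly p) z) < 0"
  using assms(1,2)
proof (induction rule: nonneg_stable_induct)
  case (linear q r)
  have "Im (1 / (z + of_real r)) < 0"
    using assms(3) by (simp add: Im_divide divide_neg_pos sum_power2_gt_zero_iff)
  moreover have "Im (poly (pderiv (cpoly q)) z / poly (cpoly q) z) \<le> 0"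
    using linear by (auto elim!: degree_eq_zeroE simp: cpoly_pCons pderiv_pCons)
  ultimately show ?case
    using logderiv_cpoly_linear[OF linear(1,2) assms(3), of r] by simp
qed auto

text \<open>The root -r contributes z / (z + r), with imaginary part r Im z / |z + r|^2. All
  contributions vanish only if 0 is the only root.\<close>

lemma Im_mult_logderiv:
  assumes "nonneg_stable p" "p \<noteq> 0" "0 < Im z"
  shows "p = monom (lead_coeff p) (degree p) \<or> Im (z * (poly (pderiv (cpoly p)) z / poly (cpoly p) z)) > 0"
  using assms(1,2)
proof (induction rule: nonneg_stable_induct)
  case (const c)
  then show ?case by (simp add: monom_0)
next
  case (linear q r)
  let ?L = "\<lambda>q. poly (pderiv (cpoly q)) z / poly (cpoly q) z"
  have deg: "degree ([:r, 1:] * q) = Suc (degree q)"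
    using linear by (subst degree_mult_eq) auto
  have nz: "(Re z + r)\<^sup>2 + (Im z)\<^sup>2 > 0"
    using assms(3) by (simp add: sum_power2_gt_zero_iff)
  have Im: "Im (z / (z + of_real r)) = r * Im z / ((Re z + r)\<^sup>2 + (Im z)\<^sup>2)"
    by (simp add: Im_divide algebra_simps)
  have eq: "Im (z * ?L ([:r, 1:] * q)) = Im (z / (z + of_real r)) + Im (z * ?L q)"
    unfolding logderiv_cpoly_linear[OF linear(1,2) assms(3), of r] by (simp add: distrib_left)
  have q0: "Im (z * ?L q) \<ge> 0"
  proof (cases "q = monom (lead_coeff q) (degree q)")
    case True
    define c n where "c = lead_coeff q" and "n = degree q"
    have qm: "q = monom c n" "c \<noteq> 0"
      unfolding c_def n_def by (rule True) (use linear(2) in simp)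
    have "z \<noteq> 0" using assms(3) by auto
    then have "z * ?L q = of_nat n"
      unfolding qm(1) using qm(2)
      by (cases n) (simp_all add: map_poly_monom pderiv_monom poly_monom field_simps)
    then show ?thesis by simp
  next
    case False
    then show ?thesis using linear by simp
  qed
  show ?case
  proof (cases "r = 0 \<and> q = monom (lead_coeff q) (degree q)")
    case True
    then have "[:r, 1:] * q = pCons 0 q" by simp
    also have "\<dots> = monom (lead_coeff q) (Suc (degree q))"
      using True by (subst monom_Suc) (metis (no_types))
    finally have "[:r, 1:] * q = monom (lead_coeff q) (Suc (degree q))" .
    then show ?thesis using deg by (metis lead_coeff_monom)
  next
    case False
    then have "Im (z / (z + of_real r)) > 0 \<or> Im (z * ?L q) > 0"
    proof (cases "r = 0")
      case True
      with False linear(2,4) show ?thesis by blast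
    next
      case r: False
      then have "0 < r * Im z / ((Re z + r)\<^sup>2 + (Im z)\<^sup>2)"
        using linear(3) assms(3) nz by simp
      then show ?thesis unfolding Im by blast
    qed
    moreover have "Im (z / (z + of_real r)) \<ge> 0"
      unfolding Im using linear(3) assms(3) nz by simp
    ultimately show ?thesis using eq q0 by linarith
  qed
qed simp

text \<open>With w = \<open>csqrt z\<close> the root -r contributes w / (w^2 + r) = 1 / (w + r / w),
  and w, r / w and reciprocals all stay in the right half-plane.\<close>

lemma Re_csqrt_mult_logderiv:
  assumes "nonneg_stable p" "p \<noteq> 0" "0 < Im z"
  shows "degree p = 0 \<or> Re (csqrt z * (poly (pderiv (cpoly p)) z / poly (cpoly p) z)) > 0"
  using assms(1,2)
proof (induction rule: nonneg_stable_induct)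
  case (linear q r)
  let ?L = "\<lambda>q. poly (pderiv (cpoly q)) z / poly (cpoly q) z"
  define w where "w = csqrt z"
  have w2: "w\<^sup>2 = z" by (simp add: w_def)
  have "z \<noteq> of_real (Re z)" using assms(3) by (auto simp: complex_eq_iff)
  have "Re w > 0"
  proof -
    have "2 * Re w * Im w = Im z" using w2 by (metis Im_power2)
    then have "Re w \<noteq> 0" using assms(3) by auto
    moreover have "Re w \<ge> 0" unfolding w_def using csqrt_principal[of z] by linarith
    ultimately show ?thesis by simp
  qed
  have wnz: "w \<noteq> 0" using \<open>Re w > 0\<close> by auto
  have "Re (w + of_real r / w) > 0"
    using \<open>Re w > 0\<close> linear(3) wnz
    by (simp add: Re_divide add_pos_nonneg)
  moreover have "w * (1 / (z + of_real r)) = 1 / (w + of_real r / w)"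
    using wnz by (simp add: w2[symmetric] field_simps power2_eq_square)
  ultimately have "Re (w * (1 / (z + of_real r))) > 0"
    by (simp add: Re_divide sum_power2_gt_zero_iff)
  moreover have "Re (w * ?L q) \<ge> 0"
    using linear unfolding w_def by (auto elim!: degree_eq_zeroE simp: cpoly_pCons pderiv_pCons)
  ultimately show ?case
    using logderiv_cpoly_linear[OF linear(1,2) assms(3), of r]
    by (simp only: distrib_left w_def[symmetric]) (simp add: w_def)
qed auto

subsection \<open>Limits\<close>

lemma poly_eq_sum_le:
  fixes p :: "'a::comm_semiring_1 poly"
  assumes "degree p \<le> N"
  shows "poly p z = (\<Sum>k\<le>N. coeff p k * z ^ k)"
  unfolding poly_altdef
  by (rule sum.mono_neutral_left) (use assms in \<open>auto simp: not_le coeff_eq_0\<close>)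

lemma uniform_limit_poly:
  fixes p :: "nat \<Rightarrow> complex poly"
  assumes deg: "\<And>n. degree (p n) \<le> N" "degree q \<le> N"
    and lim: "\<And>k. (\<lambda>n. coeff (p n) k) \<longlonglongrightarrow> coeff q k"
    and "compact K"
  shows "uniform_limit K (\<lambda>n. poly (p n)) (poly q) sequentially"
proof -
  obtain R where R: "\<And>z. z \<in> K \<Longrightarrow> norm z \<le> R"
    using compact_imp_bounded[OF \<open>compact K\<close>] by (auto simp: bounded_iff)
  define e where "e = (\<lambda>n. \<Sum>k\<le>N. norm (coeff (p n) k - coeff q k) * R ^ k)"
  have "(\<lambda>n. \<Sum>k\<le>N. norm (coeff (p n) k - coeff q k) * R ^ k) \<longlonglongrightarrow> (\<Sum>k\<le>N. 0 * R ^ k)"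
    using lim by (intro tendsto_sum tendsto_mult tendsto_const) (simp add: LIM_zero_iff tendsto_norm_zero_iff)
  then have e0: "e \<longlonglongrightarrow> 0" by (simp add: e_def)
  have bound: "norm (poly (p n) z - poly q z) \<le> e n" if "z \<in> K" for n z
  proof -
    have "poly (p n) z - poly q z = (\<Sum>k\<le>N. (coeff (p n) k - coeff q k) * z ^ k)"
      by (simp add: poly_eq_sum_le[OF deg(1)] poly_eq_sum_le[OF deg(2)] sum_subtractf left_diff_distrib)
    also have "norm \<dots> \<le> (\<Sum>k\<le>N. norm ((coeff (p n) k - coeff q k) * z ^ k))"
      by (rule norm_sum)
    also have "\<dots> \<le> e n"
      unfolding e_def by (intro sum_mono) (auto simp: norm_mult norm_power intro!: mult_left_mono power_mono R that)
    finally show ?thesis .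
  qed
  show ?thesis
  proof (rule uniform_limitI)
    fix \<epsilon> :: real assume "0 < \<epsilon>"
    with e0 have "\<forall>\<^sub>F n in sequentially. e n < \<epsilon>" by (rule order_tendstoD(2))
    then show "\<forall>\<^sub>F n in sequentially. \<forall>z\<in>K. dist (poly (p n) z) (poly q z) < \<epsilon>"
      by eventually_elim (auto simp: dist_norm intro: le_less_trans[OF bound])
  qed
qed

lemma stable_poly_limit:
  assumes stable: "\<And>n. stable_poly (p n)"
    and lim: "\<And>K. compact K \<Longrightarrow> uniform_limit K (\<lambda>n. poly (p n)) (poly q) sequentially"
    and "q \<noteq> 0"
  shows "stable_poly q"
\<comment> \<open>Hurwitz's theorem requires a nonconstant limit. A constant limit must be nonzero,
  since a nonzero polynomial has only finitely many roots.\<close>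
proof (cases "poly q constant_on {z. 0 < Im z}")
  case True
  then obtain c where c: "\<And>z. 0 < Im z \<Longrightarrow> poly q z = c" unfolding constant_on_def by blast
  have "c \<noteq> 0"
  proof
    assume "c = 0"
    then have "poly q (of_nat n + \<i>) = 0" for n using c[of "of_nat n + \<i>"] by simp
    then have "range (\<lambda>n. of_nat n + \<i>) \<subseteq> {z. poly q z = 0}" by auto
    moreover have "infinite (range (\<lambda>n::nat. of_nat n + \<i>))"
      by (intro range_inj_infinite injI) simp
    ultimately show False using poly_roots_finite[OF \<open>q \<noteq> 0\<close>] finite_subset by blast
  qed
  then show ?thesis unfolding stable_poly_def using c by auto
next
  case False
  have "poly q z \<noteq> 0" if "0 < Im z" for z
  proof (rule Hurwitz_no_zeros[of "{z. 0 < Im z}" "\<lambda>n. poly (p n)" "poly q" z])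
    show "open {z. 0 < Im z}" by (rule open_halfspace_Im_gt)
    show "connected {z. 0 < Im z}" by (intro convex_connected convex_halfspace_Im_gt)
  qed (use lim stable that False in \<open>auto simp: stable_poly_def intro!: holomorphic_intros\<close>)
  then show ?thesis unfolding stable_poly_def by blast
qed

text \<open>The common degree bound upgrades coefficientwise to locally uniform convergence. If the
  limit has a nonzero coefficient, only finitely many members of the sequence can be zero, and these
  are skipped by a shift.\<close>

lemma stable_poly_limit_coeff:
  assumes stable: "\<And>n. p n = 0 \<or> stable_poly (p n)"
    and deg: "\<And>n. degree (p n) \<le> N"
    and lim: "\<And>k. (\<lambda>n. coeff (p n) k) \<longlonglongrightarrow> coeff q k"
  shows "q = 0 \<or> stable_poly q"
proof (cases "q = 0")
  case False
  then obtain k where k: "coeff q k \<noteq> 0" by (auto simp: poly_eq_iff)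
  have "\<forall>\<^sub>F n in sequentially. coeff (p n) k \<noteq> 0"
    using tendsto_imp_eventually_ne[OF lim k] .
  then obtain n0 where n0: "\<And>n. n \<ge> n0 \<Longrightarrow> p n \<noteq> 0"
    by (auto simp: eventually_sequentially) (metis coeff_0)
  have "degree q \<le> N"
  proof (rule degree_le, intro allI impI)
    fix i assume "N < i"
    then have "coeff (p n) i = 0" for n using deg[of n] by (intro coeff_eq_0) simp
    then show "coeff q i = 0" using lim[of i] by (simp add: LIMSEQ_const_iff)
  qed
  have "stable_poly q"
  proof (rule stable_poly_limit[where p = "\<lambda>n. p (n + n0)"])
    show "stable_poly (p (n + n0))" for n using stable[of "n + n0"] n0[of "n + n0"] by auto
    show "uniform_limit K (\<lambda>n. poly (p (n + n0))) (poly q) sequentially" if "compact K" for K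
    proof (rule uniform_limit_poly[OF _ _ _ that])
      show "(\<lambda>n. coeff (p (n + n0)) k) \<longlonglongrightarrow> coeff q k" for k
        by (rule LIMSEQ_ignore_initial_segment[OF lim])
    qed (use deg \<open>degree q \<le> N\<close> in auto)
  qed fact
  then show ?thesis ..
qed simp

lemma nonneg_stable_limit:
  assumes ns: "\<And>n. nonneg_stable (p n)"
    and deg: "\<And>n. degree (p n) \<le> N"
    and lim: "\<And>k. (\<lambda>n. coeff (p n) k) \<longlonglongrightarrow> coeff q k"
  shows "nonneg_stable q"
proof -
  have "cpoly q = 0 \<or> stable_poly (cpoly q)"
    by (rule stable_poly_limit_coeff[where p = "\<lambda>n. cpoly (p n)" and N = N])
      (use ns deg lim in \<open>auto simp: nonneg_stable_def tendsto_of_real_iff\<close>)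
  moreover have "0 \<le> coeff q i" for i
    using lim[of i] nonneg_stable_coeff[OF ns] by (intro LIMSEQ_le_const) auto
  ultimately show ?thesis by (simp add: nonneg_stable_def)
qed

subsection \<open>Diagonal operators\<close>

definition weighted :: "(nat \<Rightarrow> 'a) \<Rightarrow> 'a poly \<Rightarrow> 'a::comm_semiring_1 poly" where
  "weighted w p = (\<Sum>k\<le>degree p. monom (w k * coeff p k) k)"

lemma coeff_weighted [simp]: "coeff (weighted w p) k = w k * coeff p k"
  by (auto simp: weighted_def coeff_sum coeff_monom coeff_eq_0 sum.delta' not_le)

lemma degree_weighted_le: "degree (weighted w p) \<le> degree p"
  by (rule degree_le) (auto simp: coeff_eq_0)

lemma cpoly_weighted: "cpoly (weighted w p) = weighted (\<lambda>k. of_real (w k)) (cpoly p)"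
  by (rule poly_eqI) simp

lemma weighted_theta_eq:
  "weighted (\<lambda>k. 1 + c * of_nat k) p = p + smult c (pCons 0 (pderiv p))"
  for p :: "'a::idom poly"
  by (rule poly_eqI) (simp add: coeff_pCons coeff_pderiv algebra_simps split: nat.split)

lemma Im_mult_real: "Im (of_real c * z) = c * Im z"
  by simp

text \<open>The multiplier is the operator 1 + c x D, with value p(z) (1 + c z p'(z) / p(z)). By
  \<open>Im_mult_logderiv\<close> the bracket is not real unless c = 0 or p is a monomial, and then
  the operator only rescales p. For negative c the bound on the degree keeps the coefficients
  nonnegative.\<close>

lemma nonneg_stable_theta:
  assumes ns: "nonneg_stable p" and pos: "\<And>k. k \<le> degree p \<Longrightarrow> 0 \<le> 1 + c * real k"
  shows "nonneg_stable (weighted (\<lambda>k. 1 + c * real k) p)"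
proof -
  let ?q = "weighted (\<lambda>k. 1 + c * real k) p"
  have nonneg: "0 \<le> coeff ?q k" for k
    using nonneg_stable_coeff[OF ns, of k] pos[of k] coeff_eq_0[of p k]
    by (cases "k \<le> degree p") auto
  have "stable_poly (cpoly ?q)" if nz: "?q \<noteq> 0"
  proof (cases "c = 0 \<or> p = monom (lead_coeff p) (degree p)")
    case True
    obtain a where a: "?q = smult a p"
    proof (cases "c = 0")
      case True
      then have "?q = smult 1 p" by (intro poly_eqI) simp
      then show ?thesis by (rule that)
    next
      case False
      with True obtain b n where p: "p = monom b n" by blast
      then have "?q = smult (1 + c * real n) p" by (intro poly_eqI) (simp add: coeff_monom)
      then show ?thesis by (rule that)
    qed
    have "stable_poly (cpoly p)" "a \<noteq> 0"
      using ns nz a by (auto simp: nonneg_stable_def)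
    then show ?thesis unfolding a by (simp add: cpoly_smult stable_poly_def)
  next
    case False
    have "p \<noteq> 0" using nz by (metis add.right_neutral coeff_weighted coeff_0 mult_zero_right poly_eq_iff)
    have "poly (cpoly ?q) z \<noteq> 0" if z: "0 < Im z" for z
    proof -
      let ?L = "poly (pderiv (cpoly p)) z / poly (cpoly p) z"
      have P: "poly (cpoly p) z \<noteq> 0" using nonneg_stable_root_free[OF ns \<open>p \<noteq> 0\<close> z] .
      have "poly (cpoly ?q) z = poly (cpoly p) z * (1 + c * (z * ?L))"
        unfolding weighted_theta_eq using P
        by (simp add: cpoly_simps field_simps)
      moreover have "Im (1 + c * (z * ?L)) \<noteq> 0"
        using Im_mult_logderiv[OF ns \<open>p \<noteq> 0\<close> z] False
        unfolding plus_complex.sel Im_mult_real one_complex.sel by auto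
      ultimately show ?thesis using P by (metis mult_eq_0_iff zero_complex.sel(2))
    qed
    then show ?thesis by (simp add: stable_poly_def)
  qed
  then show ?thesis using nonneg by (auto simp: nonneg_stable_def)
qed

lemma weighted_weighted: "weighted v (weighted w p) = weighted (\<lambda>k. v k * w k) p"
  by (rule poly_eqI) (simp add: algebra_simps)

lemma nonneg_stable_weighted_power:
  assumes "\<And>p. nonneg_stable p \<Longrightarrow> degree p \<le> N \<Longrightarrow> nonneg_stable (weighted w p)"
    and "nonneg_stable p" "degree p \<le> N"
  shows "nonneg_stable (weighted (\<lambda>k. w k ^ n) p)"
proof (induction n)
  case 0
  have "weighted (\<lambda>k. w k ^ 0) p = p" by (rule poly_eqI) simp
  then show ?case using assms by simp
next
  case (Suc n)
  have "weighted (\<lambda>k. w k ^ Suc n) p = weighted w (weighted (\<lambda>k. w k ^ n) p)"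
    by (simp add: weighted_weighted)
  then show ?case
    using assms(1)[OF Suc] degree_weighted_le[of "\<lambda>k. w k ^ n" p] assms(3) by simp
qed

text \<open>The multiplier is the limit of (1 - a k^2 / n)^n, and 1 - a k^2 / n = (1 + c k) (1 - c
  k) with c = sqrt (a / n). Starting at \<open>n0\<close> ensures c k \<le> 1 up to the degree, so
  that \<open>nonneg_stable_theta\<close> covers both factors.\<close>

lemma nonneg_stable_gauss:
  assumes "nonneg_stable p" "0 \<le> a"
  shows "nonneg_stable (weighted (\<lambda>k. exp (- a * (real k)\<^sup>2)) p)"
proof -
  define N where "N = degree p"
  obtain n0 :: nat where "a * (real N)\<^sup>2 < real n0" using reals_Archimedean2 by blast
  moreover have "0 \<le> a * (real N)\<^sup>2" using assms(2) by simp
  ultimately have n0: "a * (real N)\<^sup>2 \<le> real n0" "n0 > 0" by linarith+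
  define w where "w = (\<lambda>n k. (1 - a * (real k)\<^sup>2 / real n) ^ n)"
  show ?thesis
  proof (rule nonneg_stable_limit[where p = "\<lambda>n. weighted (w (n + n0)) p" and N = N])
    show "nonneg_stable (weighted (w (n + n0)) p)" for n
      unfolding w_def
    proof (rule nonneg_stable_weighted_power[where N = N])
      fix q :: "real poly" assume q: "nonneg_stable q" "degree q \<le> N"
      define c where "c = sqrt (a / real (n + n0))"
      have c2: "c\<^sup>2 = a / real (n + n0)" using assms(2) by (simp add: c_def)
      have c0: "0 \<le> c" using assms(2) by (simp add: c_def)
      have small: "c * real k \<le> 1" if "k \<le> N" for k
      proof -
        have "(c * real k)\<^sup>2 \<le> a * (real N)\<^sup>2 / real (n + n0)"
          unfolding power_mult_distrib c2 using that assms(2) n0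
          by (auto simp: divide_simps intro!: mult_left_mono power_mono)
        also have "\<dots> \<le> 1" using n0 by simp
        finally show ?thesis using abs_square_le_1[of "c * real k"] abs_le_D1 by blast
      qed
      have eq: "weighted (\<lambda>k. 1 - a * (real k)\<^sup>2 / real (n + n0)) q =
          weighted (\<lambda>k. 1 + c * real k) (weighted (\<lambda>k. 1 + (- c) * real k) q)"
        unfolding weighted_weighted
      proof (rule arg_cong[where f = "\<lambda>w. weighted w q"], rule ext)
        fix k
        have "(1 + c * real k) * (1 + - c * real k) = 1 - c\<^sup>2 * (real k)\<^sup>2"
          by (simp add: algebra_simps power2_eq_square)
        then show "1 - a * (real k)\<^sup>2 / real (n + n0) = (1 + c * real k) * (1 + - c * real k)"
          by (simp add: c2)
      qed
      have "nonneg_stable (weighted (\<lambda>k. 1 + (- c) * real k) q)"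
        using small q by (intro nonneg_stable_theta) force+
      then show "nonneg_stable (weighted (\<lambda>k. 1 - a * (real k)\<^sup>2 / real (n + n0)) q)"
        unfolding eq by (rule nonneg_stable_theta) (use c0 in simp)
    qed (use assms in \<open>auto simp: N_def\<close>)
    show "degree (weighted (w (n + n0)) p) \<le> N" for n
      unfolding N_def by (rule degree_weighted_le)
    show "(\<lambda>n. coeff (weighted (w (n + n0)) p) k)
        \<longlonglongrightarrow> coeff (weighted (\<lambda>k. exp (- a * (real k)\<^sup>2)) p) k" for k
    proof -
      have "(\<lambda>n. w n k) \<longlonglongrightarrow> exp (- a * (real k)\<^sup>2)"
        unfolding w_def using tendsto_exp_limit_sequentially[of "- a * (real k)\<^sup>2"]
        by simp
      then show ?thesis
        unfolding coeff_weighted by (intro tendsto_mult tendsto_const LIMSEQ_ignore_initial_segment)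
    qed
  qed
qed

lemma poly_weighted_power:
  "poly (weighted (\<lambda>k. r ^ k) p) z = poly p (r * z)"
  for p :: "'a::comm_semiring_1 poly"
  using poly_eq_sum_le[OF degree_weighted_le, of "\<lambda>k. r ^ k" p z]
  by (simp add: poly_altdef power_mult_distrib mult_ac)

lemma nonneg_stable_scale:
  assumes "nonneg_stable p" "0 < r"
  shows "nonneg_stable (weighted (\<lambda>k. r ^ k) p)"
proof (cases "p = 0")
  case True
  then have "weighted (\<lambda>k. r ^ k) p = 0" by (intro poly_eqI) simp
  then show ?thesis by simp
next
  case False
  have "stable_poly (cpoly (weighted (\<lambda>k. r ^ k) p))"
    unfolding stable_poly_def cpoly_weighted of_real_power poly_weighted_power
    using assms(2) nonneg_stable_root_free[OF assms(1) False] by simp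
  then show ?thesis
    using nonneg_stable_coeff[OF assms(1)] assms(2) by (simp add: nonneg_stable_def)
qed

text \<open>The linear part of the exponent is the substitution of exp b * x for x. Its sign is
  free, which later permits negative \<open>d1\<close>.\<close>

lemma nonneg_stable_exp_quadratic:
  assumes "nonneg_stable p" "0 \<le> a"
  shows "nonneg_stable (weighted (\<lambda>k. exp (b * real k - a * (real k)\<^sup>2)) p)"
proof -
  have "weighted (\<lambda>k. exp (b * real k - a * (real k)\<^sup>2)) p =
      weighted (\<lambda>k. exp b ^ k) (weighted (\<lambda>k. exp (- a * (real k)\<^sup>2)) p)"
    unfolding weighted_weighted
    by (simp add: exp_add[symmetric] exp_of_nat_mult[symmetric] exp_diff exp_minus divide_inverse mult.commute)
  then show ?thesis using nonneg_stable_gauss[OF assms] nonneg_stable_scale by simp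
qed

subsection \<open>Pure death operators\<close>

lemma nonneg_stable_pderiv:
  assumes ns: "nonneg_stable p"
  shows "nonneg_stable (pderiv p)"
proof (cases "degree p = 0")
  case True
  then show ?thesis by (auto elim!: degree_eq_zeroE simp: pderiv_pCons)
next
  case False
  then have "p \<noteq> 0" by auto
  have "poly (pderiv (cpoly p)) z \<noteq> 0" if z: "0 < Im z" for z
    using Im_logderiv[OF ns \<open>p \<noteq> 0\<close> z] False by auto
  then show ?thesis
    using nonneg_stable_coeff[OF ns]
    by (simp add: nonneg_stable_def stable_poly_def cpoly_pderiv coeff_pderiv)
qed

text \<open>Two arguments in the open interval from -pi/2 to pi/2 never add up to pi, so the product
  cannot be a negative real.\<close>

lemma right_half_plane_mult:
  assumes "0 < Re a" "0 < Re b" "0 \<le> h"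
  shows "1 + of_real h * (a * b) \<noteq> 0"
proof
  assume 0: "1 + of_real h * (a * b) = 0"
  then have "Re (1 + of_real h * (a * b)) = 0" "Im (of_real h * (a * b)) = 0"
    by (simp_all add: complex_eq_iff)
  then have h: "h \<noteq> 0" and re: "1 + h * Re (a * b) = 0" and im: "Im (a * b) = 0"
    by auto
  then have "Im b * Re a = - Im a * Re b" by (simp add: algebra_simps)
  then have "Re a * Re (a * b) = Re b * ((Re a)\<^sup>2 + (Im a)\<^sup>2)"
    by (simp add: power2_eq_square algebra_simps)
  then have "0 \<le> Re a * Re (a * b)" using assms by simp
  then have "0 \<le> h * Re (a * b)" using assms by (simp add: zero_le_mult_iff)
  with re show False by simp
qed

text \<open>
  With \<open>w = csqrt z\<close> the logarithmic derivatives of \<open>p\<close> and of \<open>p'\<close>, multiplied by \<open>w\<close>,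
  lie in the right half-plane, so that \<open>z * p'' / p = w\<^sup>2 * p'' / p\<close> avoids the negative reals.
\<close>

lemma nonneg_stable_death:
  assumes ns: "nonneg_stable p" and "0 \<le> h" "0 \<le> a" "0 \<le> d"
  shows "nonneg_stable (p + smult h (smult d (pCons 0 (pderiv (pderiv p))) + smult a (pderiv p)))"
    (is "nonneg_stable ?q")
proof (cases "degree p = 0")
  case True
  then show ?thesis using ns by (auto elim!: degree_eq_zeroE simp: pderiv_pCons)
next
  case deg: False
  then have "p \<noteq> 0" "pderiv p \<noteq> 0" by (auto simp: pderiv_eq_0_iff)
  note ns' = nonneg_stable_pderiv[OF ns]
  have nonneg: "0 \<le> coeff ?q k" for k
    using nonneg_stable_coeff[OF ns] assms(2-4)
    by (auto simp: coeff_pCons coeff_pderiv split: nat.split intro!: add_nonneg_nonneg mult_nonneg_nonneg)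
  have "poly (cpoly ?q) z \<noteq> 0" if z: "0 < Im z" for z
  proof -
    define w where "w = csqrt z"
    have w2: "z = w * w" by (simp add: w_def flip: power2_eq_square)
    define A where "A = w * (poly (pderiv (cpoly p)) z / poly (cpoly p) z)"
    define B where "B = w * (poly (pderiv (cpoly (pderiv p))) z / poly (cpoly (pderiv p)) z)"
    have nz: "poly (cpoly p) z \<noteq> 0" "poly (cpoly (pderiv p)) z \<noteq> 0"
      using nonneg_stable_root_free ns ns' \<open>p \<noteq> 0\<close> \<open>pderiv p \<noteq> 0\<close> z by blast+
    have A: "0 < Re A"
      using Re_csqrt_mult_logderiv[OF ns \<open>p \<noteq> 0\<close> z] deg by (simp add: A_def w_def)
    \<comment> \<open>Not strict: \<open>pderiv p\<close> may be constant.\<close>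
    have B: "0 \<le> Re B"
      using Re_csqrt_mult_logderiv[OF ns' \<open>pderiv p \<noteq> 0\<close> z]
      by (auto simp: B_def w_def elim!: degree_eq_zeroE simp: cpoly_pCons pderiv_pCons)
    have wnz: "w \<noteq> 0" using z by (auto simp: w_def)
    have Rw: "0 < Re w"
    proof -
      have "2 * Re w * Im w = Im z" unfolding w2 by simp
      then have "Re w \<noteq> 0" using z by auto
      moreover have "Re w \<ge> 0" unfolding w_def using csqrt_principal[of z] by linarith
      ultimately show ?thesis by simp
    qed
    \<comment> \<open>Since z = w^2, the quotient (d z p'' + a p') / p equals A (d B + a / w), a
      product to which \<open>right_half_plane_mult\<close> applies.\<close>
    have eq: "poly (cpoly ?q) z = poly (cpoly p) z * (1 + of_real h * (A * (d * B + a / w)))"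
    proof -
      have "poly (pderiv (pderiv (cpoly p))) z = B / w * poly (pderiv (cpoly p)) z"
        using nz wnz by (simp add: B_def cpoly_pderiv)
      moreover have "poly (pderiv (cpoly p)) z = A / w * poly (cpoly p) z"
        using nz wnz by (simp add: A_def)
      ultimately show ?thesis
        using wnz by (simp add: cpoly_simps w2 field_simps)
    qed
    show ?thesis
    \<comment> \<open>In the first case the second factor has real part 0; but then it is 0 itself,
      and the operator does not change the value at z.\<close>
    proof (cases "a = 0 \<and> (d = 0 \<or> Re B = 0)")
      case True
      have "d = 0 \<or> B = 0"
      proof (cases "degree (pderiv p) = 0")
        case True
        then show ?thesis by (auto simp: B_def elim!: degree_eq_zeroE simp: cpoly_pCons pderiv_pCons)
      next
        case False
        then have "0 < Re B"
          using Re_csqrt_mult_logderiv[OF ns' \<open>pderiv p \<noteq> 0\<close> z] by (simp add: B_def w_def)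
        then show ?thesis using True \<open>a = 0 \<and> (d = 0 \<or> Re B = 0)\<close> by auto
      qed
      then show ?thesis using eq True nz by auto
    next
      case False
      have "0 \<le> Re (of_real a / w)" "a \<noteq> 0 \<Longrightarrow> 0 < Re (of_real a / w)"
        using Rw wnz assms(3) by (simp_all add: Re_divide sum_power2_gt_zero_iff)
      then have "0 < Re (d * B + a / w)"
      proof (cases "a = 0")
        case True
        then have "0 < d * Re B" using False B assms(4) by simp
        then show ?thesis using True by simp
      next
        case a: False
        have "0 \<le> d * Re B" using B assms(4) by simp
        then show ?thesis using \<open>a \<noteq> 0 \<Longrightarrow> 0 < Re (of_real a / w)\<close>[OF a] by simp
      qed
      then show ?thesis using eq right_half_plane_mult[OF A _ assms(2)] nz by simp
    qed
  qed
  then show ?thesis using nonneg by (simp add: nonneg_stable_def stable_poly_def)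
qed

section \<open>Generating functions of t-stable measures\<close>

subsection \<open>Coefficient inequalities\<close>

text \<open>This says that p' / p, a sum of terms 1 / (x + r), is decreasing. Cleared of
  denominators it also holds at the roots, which is where the triple-root argument looks.\<close>

lemma nonneg_stable_laguerre:
  assumes "nonneg_stable p"
  shows "poly p x * poly (pderiv (pderiv p)) x \<le> (poly (pderiv p) x)\<^sup>2"
  using assms
proof (induction rule: nonneg_stable_induct)
  case (linear q r)
  let ?q = "poly q x" and ?q' = "poly (pderiv q) x" and ?q'' = "poly (pderiv (pderiv q)) x"
  have eq: "poly (pderiv ([:r, 1:] * q)) x = ?q + (r + x) * ?q'"
    "poly (pderiv (pderiv ([:r, 1:] * q))) x = 2 * ?q' + (r + x) * ?q''"
    by (simp_all only: pderiv_mult pderiv_pCons pderiv_add) (simp_all add: algebra_simps)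
  have "0 \<le> ?q\<^sup>2 + (r + x)\<^sup>2 * (?q'\<^sup>2 - ?q * ?q'')"
    using linear by (intro add_nonneg_nonneg mult_nonneg_nonneg) auto
  then show ?case unfolding eq by (simp add: algebra_simps power2_eq_square)
qed (simp_all add: pderiv_pCons)

text \<open>Laguerre's inequality at 0 for the k-th derivative.\<close>

lemma nonneg_stable_newton:
  assumes "nonneg_stable p"
  shows "real (k + 2) * (coeff p k * coeff p (k + 2)) \<le> real (k + 1) * (coeff p (k + 1))\<^sup>2"
  using assms
proof (induction k arbitrary: p)
  case 0
  have "poly p 0 * poly (pderiv (pderiv p)) 0 \<le> (poly (pderiv p) 0)\<^sup>2"
    using 0 by (rule nonneg_stable_laguerre)
  then show ?case
    by (simp add: poly_0_coeff_0 coeff_pderiv numeral_2_eq_2)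
next
  case (Suc k)
  have "real (k + 1) * real (k + 2) * (real (Suc k + 2) * (coeff p (Suc k) * coeff p (Suc k + 2)))
      \<le> real (k + 1) * real (k + 2) * (real (Suc k + 1) * (coeff p (Suc k + 1))\<^sup>2)"
    using Suc.IH[OF nonneg_stable_pderiv[OF Suc.prems]]
    by (simp add: coeff_pderiv power2_eq_square algebra_simps del: of_nat_Suc of_nat_add)
  then show ?case by (rule mult_left_le_imp_le) simp
qed

text \<open>Log-concavity stated as 2x2 minors, which remains meaningful when coefficients vanish.
  It is used to propagate one small ratio of neighbouring coefficients to all later ones.\<close>

lemma nonneg_stable_tp2:
  assumes "nonneg_stable p" "i \<le> j"
  shows "coeff p i * coeff p (Suc j) \<le> coeff p (Suc i) * coeff p j"
  using assms
proof (induction arbitrary: i j rule: nonneg_stable_induct)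
  case (linear q r)
  let ?a = "coeff q"
  have a: "0 \<le> ?a k" for k using linear nonneg_stable_coeff by blast
  note IH = linear.IH
  have eq: "coeff ([:r, 1:] * q) (Suc k) = ?a k + r * ?a (Suc k)"
    "coeff ([:r, 1:] * q) 0 = r * ?a 0" for k by simp_all
  show ?case
  proof (cases "i = j")
    case True
    then show ?thesis by simp
  next
    case False
    then obtain j' where j: "j = Suc j'" "i \<le> j'" using linear.prems by (cases j) auto
    have r1: "r * (r * (?a i * ?a (Suc j))) \<le> r * (r * (?a (Suc i) * ?a j))"
      using IH[OF linear.prems] linear(3) by (simp add: mult_left_mono)
    show ?thesis
    proof (cases i)
      case 0
      have "r * (?a i * ?a j) \<le> r * (?a i * ?a j + ?a (Suc i) * ?a j')"
        using linear(3) a by (intro mult_left_mono) simp_all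
      moreover have "0 \<le> ?a 0 * ?a j'" using a by simp
      ultimately show ?thesis using r1 unfolding j 0 eq
        by (simp add: algebra_simps)
    next
      case (Suc i')
      have "?a i' * ?a (Suc j') \<le> ?a i * ?a j'" using IH[of i' j'] j Suc by simp
      moreover have "?a i' * ?a (Suc j) \<le> ?a (Suc i) * ?a j'"
        using IH[of i' j] IH[of i j'] j Suc by simp
      then have "r * (?a i' * ?a (Suc j)) \<le> r * (?a (Suc i) * ?a j')"
        using linear(3) by (rule mult_left_mono)
      ultimately show ?thesis using r1 unfolding j Suc eq
        by (simp add: algebra_simps)
    qed
  qed
qed (auto simp: coeff_pCons split: nat.split)

text \<open>The inequality is multiplicative over the factors x + r, so the bound at 1 + N / 2 does
  not depend on the degree. With s = r + 1 it reduces to one real inequality, proved by induction on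
  N.\<close>

lemma nonneg_stable_growth:
  assumes "nonneg_stable p"
  shows "poly p (1 + real N / 2) * poly p (1/2) ^ N \<le> poly p 1 ^ (N + 1)"
  using assms
proof (induction rule: nonneg_stable_induct)
  case (linear q r)
  have factor: "(s + real N / 2) * (s - 1/2) ^ N \<le> s ^ (N + 1)" if "1 \<le> s" for s :: real
  proof (induction N)
    case (Suc N)
    have "(s + real (Suc N) / 2) * (s - 1/2) \<le> (s + real N / 2) * s"
      by (simp add: algebra_simps)
    moreover have "0 \<le> (s - 1/2) ^ N" using that by simp
    ultimately have "(s + real (Suc N) / 2) * (s - 1/2) * (s - 1/2) ^ N
        \<le> (s + real N / 2) * s * (s - 1/2) ^ N"
      by (rule mult_right_mono)
    also have "\<dots> \<le> s * s ^ (N + 1)"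
      using mult_left_mono[OF Suc, of s] that by (simp add: mult_ac)
    finally show ?case by (simp add: mult_ac)
  qed simp
  have nonneg: "0 \<le> poly q x" if "0 \<le> x" for x
    using linear that by (intro poly_nonneg nonneg_stable_coeff)
  have "(r + (1 + real N / 2)) * (r + 1/2) ^ N * (poly q (1 + real N / 2) * poly q (1/2) ^ N)
      \<le> (r + 1) ^ (N + 1) * poly q 1 ^ (N + 1)"
    using factor[of "r + 1"] linear
    by (intro mult_mono mult_nonneg_nonneg zero_le_power nonneg) (simp_all add: add_ac)
  moreover have "poly ([:r, 1:] * q) x = (r + x) * poly q x" for x
    by (simp add: algebra_simps)
  ultimately show ?case
    by (simp only: power_mult_distrib mult_ac)
qed simp_all

subsection \<open>Jensen polynomials\<close>

text \<open>For 0 < n and k \<le> n this is n! / ((n - k)! n^k). With these weights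
  \<open>jensen n c\<close> is the classical Jensen polynomial of the power series with coefficients
  c, evaluated at x / n.\<close>

definition jensen_weight :: "nat \<Rightarrow> nat \<Rightarrow> real" where
  "jensen_weight n k = (\<Prod>i<k. 1 - real i / real n)"

definition jensen :: "nat \<Rightarrow> (nat \<Rightarrow> real) \<Rightarrow> real poly" where
  "jensen n c = (\<Sum>k\<le>n. monom (jensen_weight n k * c k) k)"

text \<open>n = 0 is left out because division by 0 makes all its weights 1, so that they no longer
  cut off above n.\<close>

definition laguerre_polya :: "(nat \<Rightarrow> real) \<Rightarrow> bool" where
  "laguerre_polya c \<longleftrightarrow> (\<forall>n>0. nonneg_stable (jensen n c))"

lemma jensen_weight_0 [simp]: "jensen_weight n 0 = 1"
  by (simp add: jensen_weight_def)

lemma jensen_weight_Suc: "jensen_weight n (Suc k) = (1 - real k / real n) * jensen_weight n k"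
  by (simp add: jensen_weight_def mult.commute)

lemma jensen_weight_eq_0:
  assumes "0 < n" "n < k"
  shows "jensen_weight n k = 0"
  unfolding jensen_weight_def using assms by (intro prod_zero bexI[of _ n]) auto

lemma jensen_weight_pos: "k \<le> n \<Longrightarrow> 0 < jensen_weight n k"
  unfolding jensen_weight_def by (intro prod_pos) (auto simp: field_simps)

lemma jensen_weight_nonneg: "0 < n \<Longrightarrow> 0 \<le> jensen_weight n k"
  using jensen_weight_pos[of k n] jensen_weight_eq_0[of n k] by (cases "k \<le> n") auto

lemma jensen_weight_le_1:
  assumes "0 < n"
  shows "jensen_weight n k \<le> 1"
proof (cases "k \<le> n")
  case True
  then show ?thesis
    unfolding jensen_weight_def using assms by (intro prod_le_1) (auto simp: field_simps)
qed (use assms jensen_weight_eq_0[of n k] in simp)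

lemma jensen_weight_tendsto: "(\<lambda>n. jensen_weight n k) \<longlonglongrightarrow> 1"
proof -
  have "(\<lambda>n. \<Prod>i<k. 1 - real i / real n) \<longlonglongrightarrow> (\<Prod>i<k. 1 - 0)"
    by (intro tendsto_prod tendsto_diff tendsto_const lim_const_over_n)
  then show ?thesis by (simp add: jensen_weight_def)
qed

lemma coeff_jensen:
  assumes "0 < n"
  shows "coeff (jensen n c) k = jensen_weight n k * c k"
  using jensen_weight_eq_0[OF assms, of k]
  by (auto simp: jensen_def coeff_sum coeff_monom sum.delta' not_le)

lemma degree_jensen_le: "degree (jensen n c) \<le> n"
  unfolding jensen_def by (intro degree_sum_le) (auto intro: order_trans[OF degree_monom_le])

lemma laguerre_polya_nonneg:
  assumes "laguerre_polya c"
  shows "0 \<le> c k"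
proof -
  have "0 \<le> jensen_weight (Suc k) k * c k"
    using assms nonneg_stable_coeff[of "jensen (Suc k) c" k]
    by (simp add: laguerre_polya_def coeff_jensen)
  then show ?thesis using jensen_weight_pos[of k "Suc k"] by (simp add: zero_le_mult_iff)
qed

text \<open>No uniformity is required: each Jensen polynomial sees only finitely many
  coefficients.\<close>

lemma laguerre_polya_limit:
  assumes "\<And>m. laguerre_polya (c m)" "\<And>k. (\<lambda>m. c m k) \<longlonglongrightarrow> d k"
  shows "laguerre_polya d"
  unfolding laguerre_polya_def
proof (intro allI impI)
  fix n :: nat assume n: "0 < n"
  show "nonneg_stable (jensen n d)"
    by (rule nonneg_stable_limit[where p = "\<lambda>m. jensen n (c m)" and N = n])
      (use assms n in \<open>auto simp: laguerre_polya_def coeff_jensen degree_jensen_le intro!: tendsto_intros\<close>)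
qed

text \<open>The expression is the sum of -z r / (z - r) over the roots r. For r \<noteq> 0 the
  reciprocal 1 / z - 1 / r of a term is in the open lower half-plane, hence the term is in the upper
  one; a root at 0 contributes 0.\<close>

lemma Im_reverse_logderiv:
  assumes "stable_poly p" "0 < Im z"
  shows "0 \<le> Im (z * (of_nat (degree p) - z * (poly (pderiv p) z / poly p z))) \<and>
    (p = monom (lead_coeff p) (degree p) \<or>
     0 < Im (z * (of_nat (degree p) - z * (poly (pderiv p) z / poly p z))))"
  using assms(1)
proof (induction rule: stable_poly_induct)
  case (const c)
  then show ?case by (simp add: monom_0)
next
  case (linear q r)
  let ?L = "\<lambda>q. poly (pderiv q) z / poly q z"
  have q0: "q \<noteq> 0" using linear(1) stable_poly_nonzero by blast
  have deg: "degree ([:-r, 1:] * q) = Suc (degree q)"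
    using q0 by (subst degree_mult_eq) auto
  have zr: "z - r \<noteq> 0" using assms(2) linear(2) by (auto simp: complex_eq_iff)
  have L: "?L ([:-r, 1:] * q) = 1 / (z - r) + ?L q"
    using logderiv_linear[of q z "-r"] linear(1) zr assms(2) unfolding stable_poly_def by simp
  have "z * (of_nat (degree ([:-r, 1:] * q)) - z * ?L ([:-r, 1:] * q))
      = - (z * r) / (z - r) + z * (of_nat (degree q) - z * ?L q)"
    unfolding deg L using zr by (simp add: field_simps)
  then have eq: "Im (z * (of_nat (degree ([:-r, 1:] * q)) - z * ?L ([:-r, 1:] * q)))
      = Im (- (z * r) / (z - r)) + Im (z * (of_nat (degree q) - z * ?L q))"
    by simp
  have D: "0 < (Re (z - r))\<^sup>2 + (Im (z - r))\<^sup>2"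
    using zr by (simp add: complex_eq_iff sum_power2_gt_zero_iff)
  have Im: "Im (- (z * r) / (z - r))
      = (((Re r)\<^sup>2 + (Im r)\<^sup>2) * Im z - ((Re z)\<^sup>2 + (Im z)\<^sup>2) * Im r) / ((Re (z - r))\<^sup>2 + (Im (z - r))\<^sup>2)"
    unfolding Im_divide by (rule arg_cong2[where f = "(/)"]) (simp_all add: algebra_simps power2_eq_square)
  have t2: "0 \<le> - (((Re z)\<^sup>2 + (Im z)\<^sup>2) * Im r)"
    using linear(2) by (simp add: mult_nonneg_nonpos)
  have t1: "0 \<le> ((Re r)\<^sup>2 + (Im r)\<^sup>2) * Im z" using assms(2) by simp
  have ge: "0 \<le> Im (- (z * r) / (z - r))"
    unfolding Im using t1 t2 D by (intro divide_nonneg_pos) simp_all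
  show ?case
  proof (cases "r = 0")
    case True
    show ?thesis
    proof (cases "q = monom (lead_coeff q) (degree q)")
      case q: True
      have "[:-r, 1:] * q = pCons 0 q" using True by simp
      also have "\<dots> = monom (lead_coeff q) (Suc (degree q))"
        using q by (subst monom_Suc) (metis (no_types))
      finally have "[:-r, 1:] * q = monom (lead_coeff q) (Suc (degree q))" .
      then have "[:-r, 1:] * q = monom (lead_coeff ([:-r, 1:] * q)) (degree ([:-r, 1:] * q))"
        using deg by (metis lead_coeff_monom)
      then show ?thesis using eq ge linear.IH by linarith
    next
      case False
      then show ?thesis using eq ge linear.IH by linarith
    qed
  next
    case False
    then have "0 < ((Re r)\<^sup>2 + (Im r)\<^sup>2) * Im z"
      using assms(2) by (simp add: complex_eq_iff sum_power2_gt_zero_iff)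
    then have "0 < Im (- (z * r) / (z - r))"
      unfolding Im using t2 D by (intro divide_pos_pos) simp_all
    then show ?thesis using eq linear.IH by linarith
  qed
qed

text \<open>Multiplying by x - r acts on the weighted polynomial f, of degree d \<le> n, as f(z) ->
  f(z) ((n - d) z + z (d - z f'(z) / f(z)) - n r) / n. Each part of the bracket has nonnegative
  imaginary part. They can all be real only if f is a multiple of x^n, where the result is simply -r
  f. Complex roots are covered because the approximants of a t-stable function may be
  complex.\<close>

lemma stable_poly_jensen:
  assumes "stable_poly p" "0 < n"
  shows "weighted (\<lambda>k. of_real (jensen_weight n k)) p = 0 \<or>
    stable_poly (weighted (\<lambda>k. of_real (jensen_weight n k)) p)"
  using assms(1)
proof (induction rule: stable_poly_induct)
  case (const c)
  have "weighted (\<lambda>k. of_real (jensen_weight n k)) [:c:] = [:c:]"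
    by (rule poly_eqI) (simp add: coeff_pCons split: nat.split)
  then show ?case using stable_poly_const[OF const] by simp
next
  case (linear q r)
  define f where "f = weighted (\<lambda>k. complex_of_real (jensen_weight n k)) q"
  let ?g = "weighted (\<lambda>k. of_real (jensen_weight n k)) ([:-r, 1:] * q)"
  have g: "?g = pCons 0 f - smult (1 / of_nat n) (pCons 0 (pCons 0 (pderiv f))) - smult r f"
  proof (rule poly_eqI)
    fix k
    show "coeff ?g k = coeff (pCons 0 f - smult (1 / of_nat n) (pCons 0 (pCons 0 (pderiv f))) - smult r f) k"
    proof (cases k)
      case (Suc j)
      have "coeff (pCons 0 (pCons 0 (pderiv f))) (Suc j) = of_nat j * coeff f j"
        by (cases j) (simp_all add: coeff_pderiv)
      moreover have "of_real (jensen_weight n (Suc j)) * coeff q j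
          = coeff f j - 1 / of_nat n * (of_nat j * coeff f j)"
        by (simp add: f_def jensen_weight_Suc algebra_simps)
      ultimately show ?thesis unfolding Suc coeff_diff coeff_smult
        by (simp add: algebra_simps f_def)
    qed (simp add: f_def)
  qed
  show ?case
  proof (cases "f = 0")
    case True
    then show ?thesis unfolding g by simp
  next
    case False
    then have sf: "stable_poly f" using linear.IH unfolding f_def by blast
    have df: "degree f \<le> n"
      by (rule degree_le) (auto simp: f_def jensen_weight_eq_0[OF assms(2)])
    show ?thesis
    proof (cases "degree f = n \<and> f = monom (lead_coeff f) (degree f)")
      case True
      then obtain a where a: "f = monom a n" by metis
      have "pCons 0 f - smult (1 / of_nat n) (pCons 0 (pCons 0 (pderiv f))) = 0"
        unfolding a using assms(2)
        by (intro poly_eqI)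
          (auto simp: coeff_pCons coeff_pderiv coeff_monom simp del: of_nat_Suc split: nat.split)
      then have "?g = smult (- r) f" unfolding g by simp
      then show ?thesis using sf by (auto simp: stable_poly_def)
    next
      case nm: False
      have "poly ?g z \<noteq> 0" if z: "0 < Im z" for z
      proof -
        let ?L = "poly (pderiv f) z / poly f z" and ?d = "degree f"
        have fz: "poly f z \<noteq> 0" using sf z by (simp add: stable_poly_def)
        have "of_nat n * poly ?g z = poly f z *
            (of_nat (n - ?d) * z + z * (of_nat ?d - z * ?L) - of_nat n * r)"
          unfolding g using fz assms(2) df by (simp add: field_simps of_nat_diff)
        moreover have "0 < Im (of_nat (n - ?d) * z + z * (of_nat ?d - z * ?L) - of_nat n * r)"
        proof -
          have 1: "Im (of_nat (n - ?d) * z) = real (n - ?d) * Im z" by simp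
          have 2: "0 \<le> - (real n * Im r)" using linear(2) by (simp add: mult_nonneg_nonpos)
          have 3: "Im (of_nat n * r) = real n * Im r" by simp
          have "0 < real (n - ?d) * Im z \<or> 0 < Im (z * (of_nat ?d - z * ?L))"
            using Im_reverse_logderiv[OF sf z] nm df z by (cases "?d = n") auto
          moreover have "0 \<le> real (n - ?d) * Im z" using z by simp
          moreover have "0 \<le> Im (z * (of_nat ?d - z * ?L))"
            using Im_reverse_logderiv[OF sf z] by blast
          ultimately show ?thesis unfolding minus_complex.sel plus_complex.sel 1 3 using 2 by linarith
        qed
        ultimately show ?thesis using fz by (metis less_irrefl mult_eq_0_iff zero_complex.sel(2))
      qed
      then show ?thesis by (simp add: stable_poly_def)
    qed
  qed
qed

lemma laguerre_polya_poly:
  assumes "nonneg_stable p"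
  shows "laguerre_polya (coeff p)"
  unfolding laguerre_polya_def
proof (intro allI impI)
  fix n :: nat assume n: "0 < n"
  have eq: "cpoly (jensen n (coeff p)) = weighted (\<lambda>k. of_real (jensen_weight n k)) (cpoly p)"
    using n by (intro poly_eqI) (simp add: coeff_jensen)
  have "cpoly (jensen n (coeff p)) = 0 \<or> stable_poly (cpoly (jensen n (coeff p)))"
  proof (cases "p = 0")
    case True
    then show ?thesis unfolding eq by (simp add: weighted_def)
  next
    case False
    then show ?thesis
      unfolding eq using stable_poly_jensen[OF _ n] assms by (auto simp: nonneg_stable_def)
  qed
  then show "nonneg_stable (jensen n (coeff p))"
    using n nonneg_stable_coeff[OF assms] jensen_weight_nonneg[OF n]
    by (simp add: nonneg_stable_def coeff_jensen)
qed

subsection \<open>Power series of t-stable functions\<close>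

lemma higher_deriv_power_series:
  fixes a :: "nat \<Rightarrow> complex"
  assumes "\<And>z. (\<lambda>k. a k * z ^ k) sums f z"
  shows "(deriv ^^ k) f 0 = fact k * a k"
proof -
  have "conv_radius a = \<infinity>"
    by (rule conv_radius_inftyI'') (use assms in \<open>auto simp: sums_iff\<close>)
  then have r: "0 < fps_conv_radius (Abs_fps a)" by (simp add: fps_conv_radius_def)
  have "eval_fps (Abs_fps a) = f"
    using assms by (auto simp: eval_fps_def sums_iff)
  then show ?thesis using fps_nth_conv_deriv[OF r, of k] by simp
qed

lemma poly_sums: "(\<lambda>k. coeff p k * z ^ k) sums poly p z"
  for p :: "'a::{comm_semiring_1,topological_comm_monoid_add,t2_space} poly"
  unfolding poly_altdef by (rule sums_finite) (auto simp: coeff_eq_0 not_le)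

text \<open>Locally uniform convergence gives convergence of Taylor coefficients; the weights cut
  the unbounded degrees of the approximants down to n before the limit is taken.\<close>

lemma t_stable_measure_imp_laguerre_polya:
  assumes "t_stable_measure \<mu>"
  shows "laguerre_polya (\<lambda>k. measure \<mu> {k})"
  unfolding laguerre_polya_def
proof (intro allI impI)
  fix n :: nat assume n: "0 < n"
  let ?c = "\<lambda>k. measure \<mu> {k}"
  obtain f p where p: "\<And>m. stable_poly (p m)"
    and lim: "\<And>K. compact K \<Longrightarrow> uniform_limit K (\<lambda>m. poly (p m)) f sequentially"
    and f: "\<And>z. (\<lambda>k. complex_of_real (?c k) * z ^ k) sums f z"
    using assms unfolding t_stable_measure_def t_stable_def by blast
  have coeff_lim: "(\<lambda>m. coeff (p m) k) \<longlonglongrightarrow> complex_of_real (?c k)" for k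
  proof -
    have "(\<lambda>m. (deriv ^^ k) (poly (p m)) 0) \<longlonglongrightarrow> (deriv ^^ k) f 0"
    proof (rule higher_deriv_complex_uniform_limit)
      show "uniform_limit (ball 0 1) (\<lambda>m. poly (p m)) f sequentially"
        using lim[of "cball 0 1"] by (rule uniform_limit_on_subset) auto
    qed (auto intro!: always_eventually holomorphic_intros)
    then have "(\<lambda>m. fact k * coeff (p m) k) \<longlonglongrightarrow> fact k * complex_of_real (?c k)"
      by (simp add: higher_deriv_power_series[OF f] higher_deriv_power_series[OF poly_sums])
    from tendsto_divide[OF this tendsto_const, of "fact k"] show ?thesis by simp
  qed
  have "cpoly (jensen n ?c) = 0 \<or> stable_poly (cpoly (jensen n ?c))"
  proof (rule stable_poly_limit_coeff)
    let ?q = "\<lambda>m. weighted (\<lambda>k. of_real (jensen_weight n k)) (p m)"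
    show "?q m = 0 \<or> stable_poly (?q m)" for m using stable_poly_jensen[OF p n] .
    show "degree (?q m) \<le> n" for m
      by (rule degree_le) (auto simp: jensen_weight_eq_0[OF n])
    show "(\<lambda>m. coeff (?q m) k) \<longlonglongrightarrow> coeff (cpoly (jensen n ?c)) k" for k
      using n by (auto simp: coeff_jensen intro!: tendsto_mult coeff_lim)
  qed
  then show "nonneg_stable (jensen n ?c)"
    using n jensen_weight_nonneg[OF n] by (simp add: nonneg_stable_def coeff_jensen)
qed

lemma laguerre_polya_newton:
  assumes "laguerre_polya c"
  shows "real (k + 2) * (c k * c (k + 2)) \<le> real (k + 1) * (c (k + 1))\<^sup>2"
proof (rule LIMSEQ_le)
  let ?w = "\<lambda>n k. jensen_weight (Suc n) k"
  have w: "(\<lambda>n. ?w n k) \<longlonglongrightarrow> 1" for k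
    using LIMSEQ_Suc[OF jensen_weight_tendsto[of k]] .
  show "(\<lambda>n. real (k + 2) * (?w n k * c k * (?w n (k + 2) * c (k + 2)))) \<longlonglongrightarrow> real (k + 2) * (c k * c (k + 2))"
    by (rule tendsto_eq_intros w refl | simp)+
  show "(\<lambda>n. real (k + 1) * (?w n (k + 1) * c (k + 1))\<^sup>2) \<longlonglongrightarrow> real (k + 1) * (c (k + 1))\<^sup>2"
    by (rule tendsto_eq_intros w refl | simp)+
  show "\<exists>N. \<forall>n\<ge>N. real (k + 2) * (?w n k * c k * (?w n (k + 2) * c (k + 2)))
      \<le> real (k + 1) * (?w n (k + 1) * c (k + 1))\<^sup>2"
    using assms nonneg_stable_newton[of "jensen (Suc n) c" k for n]
    unfolding laguerre_polya_def by (simp add: coeff_jensen)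
qed

text \<open>\<open>nonneg_stable_growth\<close> bounds the Jensen polynomials at any radius,
  uniformly in n: their values at 1 are at most the mass, and \<open>c j\<close> keeps their values
  at 1/2 away from 0.\<close>

lemma laguerre_polya_summable:
  assumes lp: "laguerre_polya c" and mass: "\<And>n. (\<Sum>k\<le>n. c k) \<le> 1" and pos: "0 < c j"
    and "0 \<le> x"
  shows "summable (\<lambda>k. c k * x ^ k)"
proof -
  note c = laguerre_polya_nonneg[OF lp]
  \<comment> \<open>For large n the weight at \<open>j\<close> exceeds 1/2, and evaluation at 1/2
    costs another factor 2^j.\<close>
  define \<eta> where "\<eta> = c j / 2 ^ (j + 1)"
  have \<eta>: "0 < \<eta>" using pos by (simp add: \<eta>_def)
  obtain N :: nat where N: "x \<le> 1 + real N / 2"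
    using real_arch_simple[of "2 * x"] by (metis add_increasing le_divide_eq_numeral1(1) mult.commute zero_le_one)
  define R where "R = 1 + real N / 2"
  have R: "0 \<le> R" "x \<le> R" using N by (auto simp: R_def)
  have ev: "\<forall>\<^sub>F n in sequentially. poly (jensen n c) R \<le> 1 / \<eta> ^ N"
  proof -
    have "\<forall>\<^sub>F n in sequentially. 1/2 < jensen_weight n j"
      by (rule order_tendstoD(1)[OF jensen_weight_tendsto]) simp
    then show ?thesis
      using eventually_gt_at_top[of 0] eventually_ge_at_top[of j]
    proof eventually_elim
      case (elim n)
      have ns: "nonneg_stable (jensen n c)" using lp elim by (simp add: laguerre_polya_def)
      have sum: "poly (jensen n c) y = (\<Sum>k\<le>n. jensen_weight n k * c k * y ^ k)" for y
        using elim by (simp add: poly_eq_sum_le[OF degree_jensen_le] coeff_jensen)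
      have "poly (jensen n c) 1 \<le> (\<Sum>k\<le>n. c k)"
        unfolding sum using c jensen_weight_le_1[OF elim(2)]
        by (intro sum_mono) (simp add: mult_left_le_one_le jensen_weight_nonneg[OF elim(2)])
      then have one: "poly (jensen n c) 1 \<le> 1" using mass[of n] by linarith
      have "\<eta> \<le> jensen_weight n j * c j * (1/2) ^ j"
        using elim(1) pos by (simp add: \<eta>_def power_one_over field_simps)
      also have "\<dots> \<le> poly (jensen n c) (1/2)"
        unfolding sum using elim c jensen_weight_nonneg[OF elim(2)]
        by (intro member_le_sum[of j "{..n}" "\<lambda>k. jensen_weight n k * c k * (1/2) ^ k"]) auto
      finally have "\<eta> ^ N \<le> poly (jensen n c) (1/2) ^ N" using \<eta> by (intro power_mono) auto
      moreover have "0 \<le> poly (jensen n c) R"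
        using R ns by (intro poly_nonneg nonneg_stable_coeff)
      ultimately have "poly (jensen n c) R * \<eta> ^ N \<le> poly (jensen n c) R * poly (jensen n c) (1/2) ^ N"
        by (rule mult_left_mono)
      also have "\<dots> \<le> poly (jensen n c) 1 ^ (N + 1)"
        unfolding R_def by (rule nonneg_stable_growth[OF ns])
      also have "\<dots> \<le> 1"
        using one ns by (intro power_le_one poly_nonneg nonneg_stable_coeff) auto
      finally show ?case using \<eta> by (simp add: field_simps)
    qed
  qed
  have "summable (\<lambda>k. c k * R ^ k)"
  proof (rule bounded_imp_summable)
    show "(\<Sum>k\<le>K. c k * R ^ k) \<le> 1 / \<eta> ^ N" for K
    proof (rule tendsto_upperbound)
      have "(\<lambda>n. \<Sum>k\<le>K. jensen_weight n k * c k * R ^ k) \<longlonglongrightarrow> (\<Sum>k\<le>K. 1 * c k * R ^ k)"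
        by (intro tendsto_intros jensen_weight_tendsto)
      then show "(\<lambda>n. \<Sum>k\<le>K. jensen_weight n k * c k * R ^ k) \<longlonglongrightarrow> (\<Sum>k\<le>K. c k * R ^ k)" by simp
      show "\<forall>\<^sub>F n in sequentially. (\<Sum>k\<le>K. jensen_weight n k * c k * R ^ k) \<le> 1 / \<eta> ^ N"
        using ev eventually_gt_at_top[of 0] eventually_ge_at_top[of K]
      proof eventually_elim
        case (elim n)
        have "(\<Sum>k\<le>K. jensen_weight n k * c k * R ^ k) \<le> (\<Sum>k\<le>n. jensen_weight n k * c k * R ^ k)"
          using elim R c jensen_weight_nonneg[OF elim(2)] by (intro sum_mono2) auto
        also have "\<dots> = poly (jensen n c) R"
          using elim by (simp add: poly_eq_sum_le[OF degree_jensen_le] coeff_jensen)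
        finally show ?case using elim by simp
      qed
    qed simp
  qed (use R c in simp)
  then show ?thesis
    by (rule summable_comparison_test'[of _ 0]) (use R c assms(4) in \<open>auto intro!: mult_left_mono power_mono\<close>)
qed

text \<open>The Jensen polynomials themselves are the stable approximants. On the disc of radius R
  the error is at most the sum of (1 - weight) c k R^k, which vanishes by dominated convergence of
  series.\<close>

lemma laguerre_polya_imp_t_stable:
  assumes lp: "laguerre_polya c" and mass: "\<And>n. (\<Sum>k\<le>n. c k) \<le> 1" and pos: "0 < c j"
  shows "\<exists>f. t_stable f \<and> (\<forall>z. (\<lambda>k. complex_of_real (c k) * z ^ k) sums f z)"
proof -
  note c = laguerre_polya_nonneg[OF lp]
  note summ = laguerre_polya_summable[OF assms]
  define f where "f = (\<lambda>z. \<Sum>k. complex_of_real (c k) * z ^ k)"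
  have summz: "summable (\<lambda>k. norm (complex_of_real (c k) * z ^ k))" for z
    using summ[of "norm z"] c by (simp add: norm_mult norm_power)
  have f: "(\<lambda>k. complex_of_real (c k) * z ^ k) sums f z" for z
    unfolding f_def using summable_norm_cancel[OF summz] by (rule summable_sums)
  \<comment> \<open>The shift keeps the coefficient at \<open>j\<close>, hence every approximant,
    nonzero.\<close>
  define p where "p = (\<lambda>n. jensen (n + Suc j) c)"
  have "t_stable f"
    unfolding t_stable_def
  proof (intro exI[of _ "\<lambda>n. cpoly (p n)"] conjI allI impI)
    fix n
    have "coeff (p n) j \<noteq> 0"
      using pos jensen_weight_pos[of j "n + Suc j"] by (simp add: p_def coeff_jensen)
    then have "p n \<noteq> 0" by auto
    then show "stable_poly (cpoly (p n))"
      using lp by (auto simp: p_def laguerre_polya_def nonneg_stable_def)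
  next
    fix K :: "complex set" assume "compact K"
    then obtain R where R: "\<And>z. z \<in> K \<Longrightarrow> norm z \<le> R" and R0: "0 < R"
      by (metis compact_imp_bounded bounded_pos)
    let ?w = "\<lambda>n k. jensen_weight (n + Suc j) k"
    define e where "e = (\<lambda>n. \<Sum>k. (1 - ?w n k) * c k * R ^ k)"
    have w: "0 \<le> 1 - ?w n k" "1 - ?w n k \<le> 1" for n k
      using jensen_weight_le_1[of "n + Suc j" k] jensen_weight_nonneg[of "n + Suc j" k] by auto
    have bd: "norm ((1 - ?w n k) * c k * R ^ k) \<le> c k * R ^ k" for n k
      using w[of n k] c[of k] R0 by (simp add: abs_mult mult.assoc mult_left_le_one_le)
    have e0: "e \<longlonglongrightarrow> 0"
    proof -
      have "(\<lambda>n. \<Sum>k. (1 - ?w n k) * c k * R ^ k) \<longlonglongrightarrow> (\<Sum>k::nat. 0)"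
      proof (rule tannerys_theorem[THEN conjunct2, THEN conjunct2])
        show "(\<lambda>n. (1 - ?w n k) * c k * R ^ k) \<longlonglongrightarrow> 0" for k
          using LIMSEQ_ignore_initial_segment[OF jensen_weight_tendsto[of k], of "Suc j"]
          by (auto intro!: tendsto_eq_intros)
        show "\<forall>\<^sub>F (k, n) in sequentially \<times>\<^sub>F sequentially. norm ((1 - ?w n k) * c k * R ^ k) \<le> c k * R ^ k"
          using bd by (intro always_eventually) auto
        show "summable (\<lambda>k. c k * R ^ k)" using summ[of R] R0 by simp
      qed simp
      then show ?thesis by (simp add: e_def)
    qed
    have bound: "dist (poly (cpoly (p n)) z) (f z) \<le> e n" if "z \<in> K" for n z
    proof -
      have s: "(\<lambda>k. complex_of_real ((?w n k - 1) * c k) * z ^ k) sums (poly (cpoly (p n)) z - f z)"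
        using sums_diff[OF poly_sums[of "cpoly (p n)" z] f[of z]]
        by (simp add: p_def coeff_jensen algebra_simps)
      have le: "norm (complex_of_real ((?w n k - 1) * c k) * z ^ k) \<le> (1 - ?w n k) * c k * R ^ k" for k
      proof -
        have "norm (complex_of_real ((?w n k - 1) * c k) * z ^ k) = (1 - ?w n k) * c k * norm z ^ k"
          using w(1)[of n k] c[of k]
          by (simp add: norm_mult norm_power abs_mult del: of_real_mult of_real_diff)
        also have "\<dots> \<le> (1 - ?w n k) * c k * R ^ k"
          using w(1)[of n k] c[of k] R[OF that] by (intro mult_left_mono power_mono) auto
        finally show ?thesis .
      qed
      have "norm (poly (cpoly (p n)) z - f z) \<le> e n"
        unfolding sums_unique[OF s] e_def
      proof (rule norm_suminf_le[OF le])
        show "summable (\<lambda>k. (1 - ?w n k) * c k * R ^ k)"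
          by (rule summable_comparison_test'[OF summ[OF less_imp_le[OF R0]], of 0]) (rule bd)
      qed
      then show ?thesis by (simp add: dist_norm)
    qed
    show "uniform_limit K (\<lambda>n. poly (cpoly (p n))) f sequentially"
    proof (rule uniform_limitI)
      fix \<epsilon> :: real assume "0 < \<epsilon>"
      with e0 have "\<forall>\<^sub>F n in sequentially. e n < \<epsilon>" by (rule order_tendstoD(2))
      then show "\<forall>\<^sub>F n in sequentially. \<forall>z\<in>K. dist (poly (cpoly (p n)) z) (f z) < \<epsilon>"
        by eventually_elim (use bound le_less_trans in blast)
    qed
  qed
  with f show ?thesis by blast
qed

section \<open>Product formulas for nonnegative kernels\<close>

text \<open>The sum stops at \<open>Suc j\<close> because the kernels in question move down by at
  most one step; so matrix powers need no infinite sums.\<close>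

primrec kernel_power :: "(nat \<Rightarrow> nat \<Rightarrow> real) \<Rightarrow> nat \<Rightarrow> nat \<Rightarrow> nat \<Rightarrow> real" where
  "kernel_power r 0 k j = (if j = k then 1 else 0)"
| "kernel_power r (Suc n) k j = (\<Sum>i\<le>Suc j. kernel_power r n k i * r i j)"

text \<open>Only the states before the last step are confined to {0..M}; the final state
  \<open>j\<close> is free.\<close>

primrec killed_power :: "nat \<Rightarrow> (nat \<Rightarrow> nat \<Rightarrow> real) \<Rightarrow> nat \<Rightarrow> nat \<Rightarrow> nat \<Rightarrow> real" where
  "killed_power M r 0 k j = (if j = k then 1 else 0)"
| "killed_power M r (Suc n) k j = (\<Sum>i\<le>M. killed_power M r n k i * r i j)"

lemma kernel_power_nonneg:
  assumes "\<And>i j. 0 \<le> r i j"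
  shows "0 \<le> kernel_power r n k j"
  by (induction n arbitrary: j) (auto intro!: sum_nonneg mult_nonneg_nonneg assms simp del: sum.atMost_Suc)

lemma killed_power_nonneg:
  assumes "\<And>i j. 0 \<le> r i j"
  shows "0 \<le> killed_power M r n k j"
  by (induction n arbitrary: j) (auto intro!: sum_nonneg mult_nonneg_nonneg assms)

lemma kernel_power_ge_killed_power:
  assumes nonneg: "\<And>i j. 0 \<le> r i j" and band: "\<And>i j. Suc j < i \<Longrightarrow> r i j = 0"
  shows "killed_power M r n k j \<le> kernel_power r n k j"
proof (induction n arbitrary: j)
  case (Suc n)
  have "killed_power M r (Suc n) k j \<le> (\<Sum>i\<le>M. kernel_power r n k i * r i j)"
    using Suc nonneg by (auto intro!: sum_mono mult_right_mono)
  also have "\<dots> = (\<Sum>i\<in>{..M} \<inter> {..Suc j}. kernel_power r n k i * r i j)"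
    by (rule sum.mono_neutral_right) (use band in auto)
  also have "\<dots> \<le> (\<Sum>i\<le>Suc j. kernel_power r n k i * r i j)"
    by (rule sum_mono2) (use nonneg kernel_power_nonneg[of r] in auto)
  finally show ?case by simp
qed simp

lemma kernel_power_mass:
  assumes nonneg: "\<And>i j. 0 \<le> r i j" and band: "\<And>i j. Suc j < i \<Longrightarrow> r i j = 0"
    and mass: "\<And>i J. (\<Sum>j\<le>J. r i j) \<le> 1"
  shows "(\<Sum>j\<le>J. kernel_power r n k j) \<le> 1"
proof (induction n arbitrary: J)
  case (Suc n)
  have "(\<Sum>j\<le>J. kernel_power r (Suc n) k j) \<le> (\<Sum>j\<le>J. \<Sum>i\<le>Suc J. kernel_power r n k i * r i j)"
    unfolding kernel_power.simps
    by (intro sum_mono sum_mono2) (auto intro!: mult_nonneg_nonneg nonneg kernel_power_nonneg)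
  also have "\<dots> = (\<Sum>i\<le>Suc J. kernel_power r n k i * (\<Sum>j\<le>J. r i j))"
    by (subst sum.swap) (simp only: sum_distrib_left)
  also have "\<dots> \<le> (\<Sum>i\<le>Suc J. kernel_power r n k i * 1)"
    by (intro sum_mono mult_left_mono mass kernel_power_nonneg nonneg)
  also have "\<dots> \<le> 1" using Suc[of "Suc J"] by simp
  finally show ?case .
qed simp

lemma killed_power_mass:
  assumes nonneg: "\<And>i j. 0 \<le> r i j" and mass: "\<And>i J. (\<Sum>j\<le>J. r i j) \<le> 1"
  shows "(\<Sum>j\<le>M. killed_power M r n k j) \<le> 1"
proof (induction n)
  case (Suc n)
  have "(\<Sum>j\<le>M. killed_power M r (Suc n) k j) = (\<Sum>i\<le>M. killed_power M r n k i * (\<Sum>j\<le>M. r i j))"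
    unfolding killed_power.simps by (subst sum.swap) (simp only: sum_distrib_left)
  also have "\<dots> \<le> (\<Sum>i\<le>M. killed_power M r n k i * 1)"
    by (intro sum_mono mult_left_mono mass killed_power_nonneg nonneg)
  also have "\<dots> \<le> 1" using Suc by simp
  finally show ?case .
qed simp

text \<open>Split u r - v q as (u - v) r + v (r - q): the row sums of r do not enlarge the old
  error, and since v \<le> 1 each step adds at most the entrywise distance of the kernels.\<close>

lemma killed_power_diff:
  assumes r: "\<And>i j. 0 \<le> r i j" "\<And>i J. (\<Sum>j\<le>J. r i j) \<le> 1"
    and q: "\<And>i j. 0 \<le> q i j" "\<And>i J. (\<Sum>j\<le>J. q i j) \<le> 1"
  shows "(\<Sum>j\<le>M. \<bar>killed_power M r n k j - killed_power M q n k j\<bar>)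
    \<le> real n * (\<Sum>i\<le>M. \<Sum>j\<le>M. \<bar>r i j - q i j\<bar>)"
proof (induction n)
  case (Suc n)
  let ?u = "killed_power M r n k" and ?v = "killed_power M q n k"
  have v1: "?v i \<le> 1" if "i \<le> M" for i
  proof -
    have "?v i \<le> (\<Sum>j\<le>M. ?v j)"
      using that by (intro member_le_sum) (auto intro: killed_power_nonneg q)
    also have "\<dots> \<le> 1" by (rule killed_power_mass[OF q])
    finally show ?thesis .
  qed
  have "(\<Sum>j\<le>M. \<bar>killed_power M r (Suc n) k j - killed_power M q (Suc n) k j\<bar>)
      = (\<Sum>j\<le>M. \<bar>\<Sum>i\<le>M. (?u i - ?v i) * r i j + ?v i * (r i j - q i j)\<bar>)"
    by (simp add: sum_subtractf[symmetric] algebra_simps)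
  also have "\<dots> \<le> (\<Sum>j\<le>M. \<Sum>i\<le>M. \<bar>?u i - ?v i\<bar> * r i j + \<bar>r i j - q i j\<bar>)"
  proof (intro sum_mono order_trans[OF sum_abs])
    fix i j assume "i \<in> {..M}" "j \<in> {..M}"
    then have "\<bar>?v i * (r i j - q i j)\<bar> \<le> \<bar>r i j - q i j\<bar>"
      using v1[of i] killed_power_nonneg[OF q(1), where M=M and n=n and k=k and j=i]
      by (simp add: abs_mult mult_left_le_one_le)
    moreover have "\<bar>(?u i - ?v i) * r i j\<bar> = \<bar>?u i - ?v i\<bar> * r i j"
      using r(1) by (simp add: abs_mult)
    ultimately show "\<bar>(?u i - ?v i) * r i j + ?v i * (r i j - q i j)\<bar>
        \<le> \<bar>?u i - ?v i\<bar> * r i j + \<bar>r i j - q i j\<bar>" by linarith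
  qed
  also have "\<dots> = (\<Sum>i\<le>M. \<bar>?u i - ?v i\<bar> * (\<Sum>j\<le>M. r i j)) + (\<Sum>i\<le>M. \<Sum>j\<le>M. \<bar>r i j - q i j\<bar>)"
    by (subst sum.swap) (simp only: sum.distrib sum_distrib_left)
  also have "(\<Sum>i\<le>M. \<bar>?u i - ?v i\<bar> * (\<Sum>j\<le>M. r i j)) \<le> (\<Sum>i\<le>M. \<bar>?u i - ?v i\<bar> * 1)"
    by (intro sum_mono mult_left_mono r(2)) simp
  finally show ?case using Suc by (simp add: algebra_simps)
qed simp

text \<open>No mass can escape to infinity: lower bounds by a probability vector force convergence.\<close>

lemma tendsto_of_lower_bounds:
  fixes a :: "nat \<Rightarrow> nat \<Rightarrow> real"
  assumes nonneg: "\<And>n j. 0 \<le> a n j" and mass: "\<And>n J. (\<Sum>j\<le>J. a n j) \<le> 1"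
    and p: "p sums 1"
    and lower: "\<And>j \<epsilon>. 0 < \<epsilon> \<Longrightarrow> \<forall>\<^sub>F n in sequentially. p j - \<epsilon> \<le> a n j"
  shows "(\<lambda>n. a n j) \<longlonglongrightarrow> p j"
proof (rule LIMSEQ_I)
  fix e :: real assume "0 < e"
  have "(\<lambda>J. \<Sum>i\<le>J. p i) \<longlonglongrightarrow> 1" using p by (simp add: sums_def_le)
  then have "\<forall>\<^sub>F J in sequentially. 1 - e/3 < (\<Sum>i\<le>J. p i)"
    using \<open>0 < e\<close> by (intro order_tendstoD(1)) auto
  then have "\<forall>\<^sub>F J in sequentially. 1 - e/3 < (\<Sum>i\<le>J. p i) \<and> j \<le> J"
    using eventually_ge_at_top[of j] by (rule eventually_conj)
  then obtain J where J: "1 - e/3 < (\<Sum>i\<le>J. p i)" "j \<le> J"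
    by (auto simp: eventually_sequentially)
  \<comment> \<open>Chosen so that the losses at the J + 1 states below the cut add up to e /
    3.\<close>
  define \<eta> where "\<eta> = e / (3 * real (Suc J))"
  have \<eta>: "0 < \<eta>" "real (Suc J) * \<eta> = e / 3" using \<open>0 < e\<close> by (simp_all add: \<eta>_def field_simps)
  have "\<forall>\<^sub>F n in sequentially. \<forall>i\<in>{..J}. p i - \<eta> \<le> a n i"
    by (rule eventually_ball_finite) (use lower \<eta> in auto)
  then have "\<forall>\<^sub>F n in sequentially. norm (a n j - p j) < e"
  proof eventually_elim
    case (elim n)
    \<comment> \<open>The lower bounds at the other states leave little mass for \<open>j\<close>,
      which yields the upper bound.\<close>
    have "a n j + (\<Sum>i\<in>{..J} - {j}. p i - \<eta>) \<le> a n j + (\<Sum>i\<in>{..J} - {j}. a n i)"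
      using elim by (intro add_left_mono sum_mono) auto
    also have "\<dots> \<le> 1"
      using mass[of n J] J by (simp add: sum.remove[of "{..J}" j])
    finally have "a n j \<le> 1 - (\<Sum>i\<in>{..J} - {j}. p i) + real J * \<eta>"
      using J by (simp add: sum_subtractf)
    also have "(\<Sum>i\<in>{..J} - {j}. p i) = (\<Sum>i\<le>J. p i) - p j"
      using J by (simp add: sum.remove[of "{..J}" j])
    finally have "a n j \<le> p j + e / 3 + real J * \<eta>" using J by simp
    moreover have "real J * \<eta> \<le> e / 3" using \<eta> by (simp add: algebra_simps)
    moreover have "p j - \<eta> \<le> a n j" using elim J by auto
    moreover have "\<eta> \<le> e / 3"
    proof -
      have "1 * \<eta> \<le> real (Suc J) * \<eta>" using \<eta>(1) by (intro mult_right_mono) auto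
      then show ?thesis unfolding \<eta>(2) by simp
    qed
    ultimately show ?case using \<open>0 < e\<close> by (simp add: abs_less_iff)
  qed
  then show "\<exists>no. \<forall>n\<ge>no. norm (a n j - p j) < e" by (simp add: eventually_sequentially)
qed

section \<open>Transition probabilities\<close>

lemma constant_between_discontinuities:
  fixes w :: "real \<Rightarrow> nat"
  assumes "\<And>x. x \<in> {a<..<b} \<Longrightarrow> isCont w x"
  shows "\<exists>m. \<forall>x\<in>{a<..<b}. w x = m"
proof -
  have "(\<lambda>x. real (w x)) constant_on {a<..<b}"
  proof (rule continuous_discrete_range_constant)
    have "isCont real n" for n by (simp add: isCont_def at_discrete)
    then show "continuous_on {a<..<b} (\<lambda>x. real (w x))"
      using assms by (intro continuous_at_imp_continuous_on ballI isCont_o2[of _ w real]) auto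
    show "\<exists>e>0. \<forall>y. y \<in> {a<..<b} \<and> real (w y) \<noteq> real (w x) \<longrightarrow> e \<le> norm (real (w y) - real (w x))"
      if "x \<in> {a<..<b}" for x
      by (rule exI[of _ 1]) auto
  qed auto
  then show ?thesis unfolding constant_on_def by (metis of_nat_eq_iff)
qed

text \<open>Jumps are isolated, so near each time the path takes at most four values: one on either
  side, the one at that time and the one at 0. Compactness of the time interval does the
  rest.\<close>

lemma non_explosive_path_bounded:
  assumes "non_explosive_path w"
  shows "\<exists>M. \<forall>s\<in>{0..t}. w s \<le> M"
proof -
  \<comment> \<open>The horizon t + 1 leaves room for a neighbourhood to the right of t.\<close>
  define D where "D = {s. 0 < s \<and> s \<le> t + 1 \<and> \<not> isCont w s}"
  have fin: "finite D" using assms by (simp add: D_def non_explosive_path_def)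
  have local: "\<exists>U M. open U \<and> s \<in> U \<and> (\<forall>x\<in>U. 0 \<le> x \<longrightarrow> w x \<le> M)" if s: "s \<in> {0..t}" for s
  proof -
    \<comment> \<open>0 is treated like a jump, because nothing is known about the path at negative
      times.\<close>
    from finite_set_avoid[of "insert 0 D" s]
    obtain e where "0 < e" "\<forall>x\<in>insert 0 D. x \<noteq> s \<longrightarrow> e \<le> dist s x" using fin by blast
    then have e: "0 < e" "\<And>x. x \<in> insert 0 D - {s} \<Longrightarrow> e \<le> dist s x" by auto
    define e' where "e' = min e 1"
    have e': "0 < e'" "e' \<le> 1" "e' \<le> e" using e by (auto simp: e'_def)
    have cont: "isCont w x" if "x \<noteq> s" "dist s x < e'" "0 < x" for x
    proof -
      have "x \<notin> D" using e(2)[of x] that e' by auto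
      moreover have "\<bar>s - x\<bar> < 1" using that(2) e' by (simp add: dist_real_def)
      then have "x \<le> t + 1" using s by (auto simp: abs_less_iff)
      ultimately show ?thesis using that(3) by (simp add: D_def)
    qed
    obtain m1 where m1: "\<And>x. x \<in> {s<..<s + e'} \<Longrightarrow> w x = m1"
      using constant_between_discontinuities[of s "s + e'" w] cont s by (auto simp: dist_real_def)
    obtain m2 where m2: "\<And>x. x \<in> {max 0 (s - e')<..<s} \<Longrightarrow> w x = m2"
      using constant_between_discontinuities[of "max 0 (s - e')" s w] cont by (auto simp: dist_real_def)
    have "w x \<le> Max {m1, m2, w s, w 0}" if x: "x \<in> {s - e'<..<s + e'}" "0 \<le> x" for x
    proof -
      consider "x = s" | "x = 0" | "x \<in> {s<..<s + e'}" | "x \<in> {max 0 (s - e')<..<s}"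
        using x by (cases "x = s"; cases "x = 0"; cases "x < s") auto
      then show ?thesis by cases (use m1 m2 in auto)
    qed
    then show ?thesis
      using e' by (intro exI[of _ "{s - e'<..<s + e'}"] exI[of _ "Max {m1, m2, w s, w 0}"]) auto
  qed
  then obtain U M where U: "\<And>s. s \<in> {0..t} \<Longrightarrow> open (U s) \<and> s \<in> U s \<and> (\<forall>x\<in>U s. 0 \<le> x \<longrightarrow> w x \<le> M s)"
    by metis
  obtain F where F: "F \<subseteq> {0..t}" "finite F" "{0..t} \<subseteq> (\<Union>s\<in>F. U s)"
    using compactE_image[of "{0..t}" "{0..t}" U] U by (metis (no_types, lifting) UN_I compact_Icc subsetI)
  have "w x \<le> Max (insert 0 (M ` F))" if x: "x \<in> {0..t}" for x
  proof -
    obtain s where s: "s \<in> F" "x \<in> U s" using F x by blast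
    then have "w x \<le> M s" using U[of s] F x by auto
    also have "\<dots> \<le> Max (insert 0 (M ` F))" using s F by (intro Max_ge) auto
    finally show ?thesis .
  qed
  then show ?thesis by blast
qed

section \<open>Transition probabilities and events on time grids\<close>

context birth_death_chain
begin

definition transition :: "real \<Rightarrow> nat \<Rightarrow> nat \<Rightarrow> real" where
  "transition t k j = measure (P k) {\<omega> \<in> space \<Omega>. X t \<omega> = j}"

lemma sets_P [measurable_cong]: "sets (P k) = sets \<Omega>"
  using law[of k] by (simp add: space_prob_algebra)

lemma space_P: "space (P k) = space \<Omega>"
  by (rule sets_eq_imp_space_eq[OF sets_P])

sublocale P: prob_space "P k" for k
  using law[of k] by (simp add: space_prob_algebra)

lemma event_measurable: "0 \<le> t \<Longrightarrow> {\<omega> \<in> space \<Omega>. X t \<omega> \<in> A} \<in> sets \<Omega>"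
  using measurable_sets[OF state_measurable, of t A] by (simp add: vimage_def Int_def conj_commute)

lemma event_eq_measurable: "0 \<le> t \<Longrightarrow> {\<omega> \<in> space \<Omega>. X t \<omega> = j} \<in> sets \<Omega>"
  using event_measurable[of t "{j}"] by simp

lemma transition_nonneg: "0 \<le> transition t k j"
  by (simp add: transition_def)

lemma transition_sums:
  assumes "0 \<le> t"
  shows "transition t k sums 1"
proof -
  have "(\<lambda>j. measure (P k) {\<omega> \<in> space \<Omega>. X t \<omega> = j}) sums
      measure (P k) (\<Union>j. {\<omega> \<in> space \<Omega>. X t \<omega> = j})"
    by (rule P.finite_measure_UNION)
      (use event_eq_measurable[OF assms] sets_P in \<open>auto simp: disjoint_family_on_def\<close>)
  moreover have "(\<Union>j. {\<omega> \<in> space \<Omega>. X t \<omega> = j}) = space (P k)" by (auto simp: space_P)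
  ultimately show ?thesis by (simp add: transition_def[abs_def] P.prob_space)
qed

lemma transition_mass: "finite F \<Longrightarrow> 0 \<le> t \<Longrightarrow> (\<Sum>j\<in>F. transition t k j) \<le> 1"
  using sum_le_suminf[OF sums_summable[OF transition_sums], of t F] transition_nonneg
    sums_unique[OF transition_sums] by simp

lemma transition_le_1: "0 \<le> t \<Longrightarrow> transition t k j \<le> 1"
  using transition_mass[of "{j}"] by simp

lemma transition_0: "transition 0 k j = (if j = k then 1 else 0)"
proof -
  have m: "{\<omega> \<in> space \<Omega>. X 0 \<omega> = i} \<in> P.events k" for i
    using event_eq_measurable[of 0 i] sets_P by simp
  show ?thesis
  proof (cases "j = k")
    case True
    have "P.prob k {\<omega> \<in> space \<Omega>. X 0 \<omega> = k} = 1"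
      using start[of k] m[of k] P.prob_Collect_eq_1[of k "\<lambda>\<omega>. X 0 \<omega> = k"] by (simp add: space_P)
    then show ?thesis using True by (simp add: transition_def)
  next
    case False
    have "AE \<omega> in P k. \<not> X 0 \<omega> = j" using start[of k] by eventually_elim (use False in auto)
    then have "P.prob k {\<omega> \<in> space \<Omega>. X 0 \<omega> = j} = 0"
      using m[of j] P.prob_Collect_eq_0[of k "\<lambda>\<omega>. X 0 \<omega> = j"] by (simp add: space_P)
    then show ?thesis using False by (simp add: transition_def)
  qed
qed

lemma transition_deriv: "((\<lambda>h. (transition h k j - (if j = k then 1 else 0)) / h) \<longlongrightarrow> bd_rate \<beta> \<delta> k j) (at_right 0)"
proof -
  have "((\<lambda>h. transition h k j) has_real_derivative bd_rate \<beta> \<delta> k j) (at_right 0)"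
    unfolding transition_def by (rule rates)
  then show ?thesis by (simp add: has_field_derivative_iff transition_0)
qed

lemma past_measurable:
  assumes "\<And>i. i \<le> n \<Longrightarrow> 0 \<le> u i \<and> u i \<le> s"
  shows "{\<omega> \<in> space \<Omega>. \<forall>i\<le>(n::nat). X (u i) \<omega> \<le> M} \<in> past \<Omega> X s"
proof -
  let ?G = "{X u -` {j} \<inter> space \<Omega> | u j. 0 \<le> u \<and> u \<le> s}"
  \<comment> \<open>A measure whose measurable sets are exactly the past, so that measurability of
    the coordinates can be used.\<close>
  define N where "N = sigma (space \<Omega>) ?G"
  have G: "?G \<subseteq> Pow (space \<Omega>)" by auto
  have N: "sets N = past \<Omega> X s" "space N = space \<Omega>"
    unfolding N_def past_def using sets_measure_of[OF G] space_measure_of[OF G] by auto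
  have "X (u i) \<in> N \<rightarrow>\<^sub>M count_space UNIV" if "i \<le> n" for i
  proof (rule measurableI)
    fix A :: "nat set"
    have "X (u i) -` {j} \<inter> space N \<in> sets N" for j
      unfolding N past_def using assms[OF that] by (intro sigma_sets.Basic) auto
    then have "(\<Union>j\<in>A. X (u i) -` {j} \<inter> space N) \<in> sets N" by (intro sets.countable_UN') auto
    moreover have "(\<Union>j\<in>A. X (u i) -` {j} \<inter> space N) = X (u i) -` A \<inter> space N" by auto
    ultimately show "X (u i) -` A \<inter> space N \<in> sets N" by simp
  qed simp
  then have "{\<omega> \<in> space N. X (u i) \<omega> \<le> M} \<in> sets N" if "i \<le> n" for i
    using measurable_sets[of "X (u i)" N "count_space UNIV" "{..M}"] that
    by (simp add: vimage_def Int_def conj_commute)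
  then have "(\<Inter>i\<in>{..n}. {\<omega> \<in> space N. X (u i) \<omega> \<le> M}) \<in> sets N"
    by (intro sets.finite_INT) auto
  moreover have "(\<Inter>i\<in>{..n}. {\<omega> \<in> space N. X (u i) \<omega> \<le> M}) = {\<omega> \<in> space \<Omega>. \<forall>i\<le>n. X (u i) \<omega> \<le> M}"
    by (auto simp: N)
  ultimately show ?thesis by (simp add: N)
qed

lemma past_subset: "past \<Omega> X s \<subseteq> sets \<Omega>"
  unfolding past_def
proof (rule sets.sigma_sets_subset, safe)
  fix u :: real and j assume "0 \<le> u"
  then show "X u -` {j} \<inter> space \<Omega> \<in> sets \<Omega>"
    by (intro measurable_sets[OF state_measurable]) auto
qed

text \<open>Iterated Markov property, with "below M at all earlier grid times" as the event of the
  past. The constraint at the last grid time is implied by j \<le> M.\<close>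

lemma grid_probability:
  assumes "0 \<le> h" "k \<le> M" "j \<le> M"
  shows "P.prob k {\<omega> \<in> space \<Omega>. (\<forall>i\<le>n. X (real i * h) \<omega> \<le> M) \<and> X (real n * h) \<omega> = j}
    = killed_power M (transition h) n k j"
  using assms(3)
proof (induction n arbitrary: j)
  case 0
  have "{\<omega> \<in> space \<Omega>. (\<forall>i\<le>0. X (real i * h) \<omega> \<le> M) \<and> X (real 0 * h) \<omega> = j} = {\<omega> \<in> space \<Omega>. X 0 \<omega> = j}"
    using 0 by auto
  then show ?case using transition_0[of k j] by (simp add: transition_def)
next
  case (Suc n)
  define A where "A = {\<omega> \<in> space \<Omega>. \<forall>i\<le>n. X (real i * h) \<omega> \<le> M}"
  have A: "A \<in> past \<Omega> X (real n * h)"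
    unfolding A_def by (rule past_measurable) (use assms(1) in \<open>auto intro: mult_right_mono\<close>)
  define B where "B = (\<lambda>i. A \<inter> {\<omega> \<in> space \<Omega>. X (real n * h) \<omega> = i \<and> X (real n * h + h) \<omega> = j})"
  have B: "B i \<in> P.events k" for i
  proof -
    have "A \<in> sets \<Omega>" using A past_subset by blast
    moreover have "{\<omega> \<in> space \<Omega>. X (real n * h) \<omega> = i} \<inter> {\<omega> \<in> space \<Omega>. X (real n * h + h) \<omega> = j} \<in> sets \<Omega>"
      using assms(1) by (intro sets.Int event_eq_measurable) auto
    moreover have "B i = A \<inter> ({\<omega> \<in> space \<Omega>. X (real n * h) \<omega> = i} \<inter> {\<omega> \<in> space \<Omega>. X (real n * h + h) \<omega> = j})"
      by (auto simp: B_def)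
    ultimately show ?thesis by (simp add: sets_P)
  qed
  have "{\<omega> \<in> space \<Omega>. (\<forall>i\<le>Suc n. X (real i * h) \<omega> \<le> M) \<and> X (real (Suc n) * h) \<omega> = j} = (\<Union>i\<le>M. B i)"
    using Suc.prems unfolding B_def A_def by (auto simp: le_Suc_eq algebra_simps)
  also have "P.prob k \<dots> = (\<Sum>i\<le>M. P.prob k (B i))"
    by (rule P.finite_measure_finite_Union) (use B in \<open>auto simp: disjoint_family_on_def B_def\<close>)
  also have "\<dots> = (\<Sum>i\<le>M. killed_power M (transition h) n k i * transition h i j)"
  proof (rule sum.cong[OF refl])
    fix i assume "i \<in> {..M}"
    have "P.prob k (B i) = P.prob k (A \<inter> {\<omega> \<in> space \<Omega>. X (real n * h) \<omega> = i}) * transition h i j"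
      unfolding B_def transition_def using assms(1) A by (intro markov) auto
    also have "A \<inter> {\<omega> \<in> space \<Omega>. X (real n * h) \<omega> = i}
        = {\<omega> \<in> space \<Omega>. (\<forall>i\<le>n. X (real i * h) \<omega> \<le> M) \<and> X (real n * h) \<omega> = i}"
      by (auto simp: A_def)
    finally show "P.prob k (B i) = killed_power M (transition h) n k i * transition h i j"
      using Suc.IH \<open>i \<in> {..M}\<close> by simp
  qed
  finally show ?case by simp
qed

text \<open>Non-explosion enters here: a path stays below some level on \<open>[0,t]\<close>.\<close>

lemma bounded_paths_exhaust:
  assumes "0 < t" "0 < \<epsilon>"
  shows "\<exists>M\<ge>L. \<forall>n>0. transition t k j - \<epsilon>
    \<le> P.prob k {\<omega> \<in> space \<Omega>. (\<forall>i\<le>n. X (real i * (t / real n)) \<omega> \<le> M) \<and> X (real n * (t / real n)) \<omega> = j}"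
proof -
  \<comment> \<open>All points of all uniform grids of the time interval. The set is countable, so
    staying below M on it is an event, and one level M serves every grid.\<close>
  define D where "D = (\<lambda>(i, n). real i * (t / real n)) ` {(i, n). i \<le> n \<and> 0 < n}"
  have D: "countable D" unfolding D_def by (intro countable_image) auto
  have grid_point: "0 \<le> real i * (t / real n) \<and> real i * (t / real n) \<le> t" if "0 < n" "i \<le> n" for i n
    using that mult_right_mono[of "real i" "real n" t] assms(1) by (simp add: pos_divide_le_eq mult.commute)
  then have Dt: "0 \<le> s \<and> s \<le> t" if "s \<in> D" for s
    using that by (auto simp: D_def)
  define E where "E = (\<lambda>M. {\<omega> \<in> space \<Omega>. X t \<omega> = j} \<inter> (\<Inter>s\<in>D. {\<omega> \<in> space \<Omega>. X s \<omega> \<in> {..M}}))"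
  have "D \<noteq> {}" unfolding D_def by (auto intro: exI[of _ "1::nat"])
  then have "(\<Inter>s\<in>D. {\<omega> \<in> space \<Omega>. X s \<omega> \<in> {..M}}) \<in> sets \<Omega>" for M
    by (rule sets.countable_INT'[OF D]) (use event_measurable Dt in blast)
  then have E: "E M \<in> P.events k" for M
    unfolding E_def sets_P using assms(1) by (intro sets.Int event_eq_measurable) auto
  have "incseq E" by (auto simp: incseq_def E_def intro: order_trans)
  have "(\<lambda>M. P.prob k (E M)) \<longlonglongrightarrow> P.prob k (\<Union>M. E M)"
    by (rule P.finite_Lim_measure_incseq) (use E \<open>incseq E\<close> in auto)
  moreover have "P.prob k (\<Union>M. E M) = transition t k j"
    unfolding transition_def
  proof (rule P.finite_measure_eq_AE)
    have "AE \<omega> in P k. \<omega> \<in> space \<Omega>" using AE_space[of "P k"] by (simp add: space_P)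
    with non_explosive[of k]
    show "AE \<omega> in P k. \<omega> \<in> (\<Union>M. E M) \<longleftrightarrow> \<omega> \<in> {\<omega> \<in> space \<Omega>. X t \<omega> = j}"
    proof eventually_elim
      case (elim \<omega>)
      obtain M where "\<forall>s\<in>{0..t}. X s \<omega> \<le> M"
        using non_explosive_path_bounded[OF elim(1)] by blast
      then have "\<omega> \<in> E M" if "X t \<omega> = j" using that elim(2) Dt by (auto simp: E_def)
      then show ?case by (auto simp: E_def)
    qed
  qed (use E sets_P event_eq_measurable assms(1) in auto)
  ultimately have "(\<lambda>M. P.prob k (E M)) \<longlonglongrightarrow> transition t k j" by simp
  then have "\<forall>\<^sub>F M in sequentially. transition t k j - \<epsilon> < P.prob k (E M)"
    using assms(2) by (intro order_tendstoD(1)) auto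
  with eventually_ge_at_top[of L]
  have "\<forall>\<^sub>F M in sequentially. L \<le> M \<and> transition t k j - \<epsilon> < P.prob k (E M)"
    by (rule eventually_conj)
  then obtain M where M: "L \<le> M" "transition t k j - \<epsilon> < P.prob k (E M)"
    by (auto simp: eventually_sequentially)
  show ?thesis
  proof (intro exI[of _ M] conjI M(1) allI impI)
    fix n :: nat assume n: "0 < n"
    let ?G = "{\<omega> \<in> space \<Omega>. (\<forall>i\<le>n. X (real i * (t / real n)) \<omega> \<le> M) \<and> X (real n * (t / real n)) \<omega> = j}"
    have tn: "real n * (t / real n) = t" using n by simp
    have "E M \<subseteq> ?G"
    proof
      fix \<omega> assume "\<omega> \<in> E M"
      then have "\<omega> \<in> space \<Omega>" "X t \<omega> = j" and le: "\<And>s. s \<in> D \<Longrightarrow> X s \<omega> \<le> M"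
        by (auto simp: E_def)
      moreover have "real i * (t / real n) \<in> D" if "i \<le> n" for i
        unfolding D_def by (rule image_eqI[of _ _ "(i, n)"]) (use that n in auto)
      ultimately show "\<omega> \<in> ?G" unfolding tn by simp
    qed
    moreover have "?G \<in> P.events k"
    proof -
      have "{\<omega> \<in> space \<Omega>. \<forall>i\<le>n. X (real i * (t / real n)) \<omega> \<le> M} \<in> past \<Omega> X t"
        by (rule past_measurable) (rule grid_point[OF n])
      then have "{\<omega> \<in> space \<Omega>. \<forall>i\<le>n. X (real i * (t / real n)) \<omega> \<le> M} \<in> sets \<Omega>"
        by (rule subsetD[OF past_subset])
      then have "{\<omega> \<in> space \<Omega>. \<forall>i\<le>n. X (real i * (t / real n)) \<omega> \<le> M} \<inter> {\<omega> \<in> space \<Omega>. X t \<omega> = j} \<in> sets \<Omega>"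
        by (rule sets.Int[OF _ event_eq_measurable[OF less_imp_le[OF assms(1)]]])
      moreover have "?G = {\<omega> \<in> space \<Omega>. \<forall>i\<le>n. X (real i * (t / real n)) \<omega> \<le> M} \<inter> {\<omega> \<in> space \<Omega>. X t \<omega> = j}"
        unfolding tn by blast
      ultimately show ?thesis by (simp only: sets_P)
    qed
    ultimately show "transition t k j - \<epsilon> \<le> P.prob k ?G"
      using M(2) P.finite_measure_mono[of "E M" ?G k] by linarith
  qed
qed

text \<open>The level M is fixed first, independently of the grid. On the states up to M the kernel
  and the transition matrix have the same derivative at 0, so n steps of length t / n accumulate an
  error n o(1 / n), which vanishes.\<close>

lemma product_formula:
  fixes r :: "real \<Rightarrow> nat \<Rightarrow> nat \<Rightarrow> real"
  assumes nonneg: "\<And>h i j. 0 < h \<Longrightarrow> 0 \<le> r h i j"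
    and band: "\<And>h i j. 0 < h \<Longrightarrow> Suc j < i \<Longrightarrow> r h i j = 0"
    and mass: "\<And>h i J. 0 < h \<Longrightarrow> (\<Sum>j\<le>J. r h i j) \<le> 1"
    and deriv: "\<And>i j. ((\<lambda>h. (r h i j - (if j = i then 1 else 0)) / h) \<longlongrightarrow> bd_rate \<beta> \<delta> i j) (at_right 0)"
    and "0 < t"
  shows "(\<lambda>n. kernel_power (r (t / real (Suc n))) (Suc n) k j) \<longlonglongrightarrow> transition t k j"
proof (rule tendsto_of_lower_bounds[where a = "\<lambda>n. kernel_power (r (t / real (Suc n))) (Suc n) k"])
  define h where "h = (\<lambda>n. t / real (Suc n))"
  have h: "0 < h n" for n using \<open>0 < t\<close> by (simp add: h_def)
  have h_lim: "filterlim h (at_right 0) sequentially"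
  proof -
    have "h \<longlonglongrightarrow> 0" unfolding h_def using LIMSEQ_Suc[OF lim_const_over_n[of t]] by simp
    moreover have "h n \<noteq> 0" for n using h[of n] by simp
    ultimately show ?thesis using h by (auto simp: filterlim_at intro: always_eventually)
  qed
  show "0 \<le> kernel_power (r (t / real (Suc n))) (Suc n) k j" for n j
    using nonneg[OF h[of n]] unfolding h_def by (rule kernel_power_nonneg)
  show "(\<Sum>j\<le>J. kernel_power (r (t / real (Suc n))) (Suc n) k j) \<le> 1" for n J
    using nonneg[OF h[of n]] band[OF h[of n]] mass[OF h[of n]] unfolding h_def by (rule kernel_power_mass)
  show "transition t k sums 1" using \<open>0 < t\<close> by (intro transition_sums) simp
  fix j and \<epsilon> :: real assume "0 < \<epsilon>"
  then obtain M where M: "max k j \<le> M" and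
    lower: "\<And>n. 0 < n \<Longrightarrow> transition t k j - \<epsilon>/2
      \<le> P.prob k {\<omega> \<in> space \<Omega>. (\<forall>i\<le>n. X (real i * (t / real n)) \<omega> \<le> M) \<and> X (real n * (t / real n)) \<omega> = j}"
    using bounded_paths_exhaust[OF \<open>0 < t\<close>, of "\<epsilon>/2" "max k j" k j] by auto
  define d where "d = (\<lambda>n. real (Suc n) * (\<Sum>i\<le>M. \<Sum>j\<le>M. \<bar>r (h n) i j - transition (h n) i j\<bar>))"
  have "d \<longlonglongrightarrow> 0"
  proof -
    have *: "(\<lambda>n. real (Suc n) * \<bar>r (h n) i j - transition (h n) i j\<bar>) \<longlonglongrightarrow> 0" for i j
    proof -
      have "((\<lambda>x. (r x i j - (if j = i then 1 else 0)) / x - (transition x i j - (if j = i then 1 else 0)) / x)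
          \<longlongrightarrow> bd_rate \<beta> \<delta> i j - bd_rate \<beta> \<delta> i j) (at_right 0)"
        by (intro tendsto_diff deriv transition_deriv)
      then have "((\<lambda>x. (r x i j - transition x i j) / x) \<longlongrightarrow> 0) (at_right 0)"
        by (simp add: diff_divide_distrib)
      from filterlim_compose[OF this h_lim]
      have "(\<lambda>n. t * \<bar>(r (h n) i j - transition (h n) i j) / h n\<bar>) \<longlonglongrightarrow> t * \<bar>0\<bar>"
        by (intro tendsto_intros)
      moreover have "t * \<bar>(r (h n) i j - transition (h n) i j) / h n\<bar>
          = real (Suc n) * \<bar>r (h n) i j - transition (h n) i j\<bar>" for n
      proof -
        define y where "y = \<bar>r (h n) i j - transition (h n) i j\<bar>"
        have "t * (y / h n) = real (Suc n) * y" using \<open>0 < t\<close> by (simp add: h_def)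
        then show ?thesis using h[of n] by (simp add: y_def abs_divide)
      qed
      ultimately show ?thesis by simp
    qed
    have "(\<lambda>n. \<Sum>i\<le>M. \<Sum>j\<le>M. real (Suc n) * \<bar>r (h n) i j - transition (h n) i j\<bar>) \<longlonglongrightarrow> (\<Sum>i\<le>M. \<Sum>j\<le>M. 0)"
      by (intro tendsto_sum *)
    then show ?thesis by (simp add: d_def sum_distrib_left)
  qed
  then have "\<forall>\<^sub>F n in sequentially. d n < \<epsilon>/2"
    using \<open>0 < \<epsilon>\<close> by (intro order_tendstoD(2)) auto
  then show "\<forall>\<^sub>F n in sequentially. transition t k j - \<epsilon> \<le> kernel_power (r (t / real (Suc n))) (Suc n) k j"
  proof eventually_elim
    case (elim n)
    let ?a = "killed_power M (r (h n)) (Suc n) k" and ?b = "killed_power M (transition (h n)) (Suc n) k"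
    have "\<bar>?a j - ?b j\<bar> \<le> (\<Sum>j\<le>M. \<bar>?a j - ?b j\<bar>)"
      using M by (intro member_le_sum) auto
    also have "\<dots> \<le> d n"
      unfolding d_def
      by (rule killed_power_diff)
        (use h[of n] nonneg mass transition_nonneg transition_mass in \<open>auto simp: less_imp_le\<close>)
    finally have "?b j - \<epsilon>/2 \<le> ?a j" using elim by linarith
    moreover have "?a j \<le> kernel_power (r (h n)) (Suc n) k j"
      using nonneg[OF h] band[OF h] by (rule kernel_power_ge_killed_power)
    moreover have "transition t k j - \<epsilon>/2 \<le> ?b j"
      using lower[of "Suc n"] grid_probability[of "h n" k M j "Suc n"] h[of n] M by (simp add: h_def)
    ultimately show ?case by (simp add: h_def)
  qed
qed

end

section \<open>Sufficiency\<close>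

lemma linear_nonneg:
  fixes a b :: real
  assumes "\<And>k::nat. 0 < k \<Longrightarrow> 0 \<le> a + b * real k"
  shows "0 \<le> b"
proof (rule ccontr)
  assume "\<not> 0 \<le> b"
  then have b: "0 < - b" by simp
  obtain n :: nat where "\<bar>a\<bar> / (- b) < real n" using reals_Archimedean2 by blast
  then have n: "\<bar>a\<bar> < real n * (- b)" using b pos_divide_less_eq by blast
  then have "0 < n" by (cases n) auto
  from assms[OF this] n show False by (simp add: mult.commute)
qed

lemma quadratic_nonneg:
  fixes a b c :: real
  assumes "\<And>k::nat. 0 \<le> a + b * real k + c * (real k)\<^sup>2"
  shows "0 \<le> c"
proof (rule linear_nonneg)
  fix k :: nat assume "0 < k"
  have "a + b * real k + c * (real k)\<^sup>2 \<le> \<bar>a\<bar> * real k + \<bar>b\<bar> * real k + c * (real k)\<^sup>2"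
  proof -
    have "\<bar>a\<bar> * 1 \<le> \<bar>a\<bar> * real k" using \<open>0 < k\<close> by (intro mult_left_mono) auto
    moreover have "b * real k \<le> \<bar>b\<bar> * real k" by (intro mult_right_mono) auto
    ultimately show ?thesis using abs_ge_self[of a] by linarith
  qed
  also have "\<dots> = (\<bar>a\<bar> + \<bar>b\<bar> + c * real k) * real k"
    by (simp add: algebra_simps power2_eq_square)
  finally have "0 \<le> (\<bar>a\<bar> + \<bar>b\<bar> + c * real k) * real k" using assms[of k] by linarith
  then show "0 \<le> \<bar>a\<bar> + \<bar>b\<bar> + c * real k" using \<open>0 < k\<close> by (simp add: zero_le_mult_iff)
qed

text \<open>For i > 0, row i lists the coefficients of exp (- h (\<delta> i + b)) x^(i-1) (x + h
  \<delta> i) (1 + h b x). The term in h^2 is a death followed by a birth within one time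
  step.\<close>

definition split_kernel :: "real \<Rightarrow> (nat \<Rightarrow> real) \<Rightarrow> real \<Rightarrow> nat \<Rightarrow> nat \<Rightarrow> real" where
  "split_kernel b \<delta> h i j = exp (- h * (\<delta> i + b)) *
     ((if j = i then 1 + h\<^sup>2 * b * \<delta> i else 0) + (if i = Suc j then h * \<delta> i else 0)
      + (if j = Suc i then h * b else 0))"

lemma split_kernel_nonneg:
  assumes "0 \<le> b" "\<And>k. 0 \<le> \<delta> k" "0 < h"
  shows "0 \<le> split_kernel b \<delta> h i j"
  unfolding split_kernel_def using assms by simp

lemma split_kernel_band: "Suc j < i \<Longrightarrow> split_kernel b \<delta> h i j = 0"
  by (simp add: split_kernel_def)

text \<open>The row sum is at most exp (- h (\<delta> i + b)) (1 + h \<delta> i) (1 + h b), and 1 +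
  y \<le> exp y. Exponential damping makes the row substochastic for every h > 0, however large the
  rate.\<close>

lemma split_kernel_mass:
  assumes "0 \<le> b" "\<And>k. 0 \<le> \<delta> k" "0 < h"
  shows "(\<Sum>j\<le>J. split_kernel b \<delta> h i j) \<le> 1"
proof -
  have delta: "(\<Sum>j\<le>J. if j = m then c else 0) \<le> c" if "0 \<le> c" for m :: nat and c :: real
    using that by (simp add: sum.delta')
  have pred: "(\<Sum>j\<le>J. if i = Suc j then h * \<delta> i else 0) \<le> h * \<delta> i"
  proof (cases i)
    case 0
    then show ?thesis using assms by simp
  next
    case (Suc m)
    have "(\<Sum>j\<le>J. if i = Suc j then h * \<delta> i else 0) = (\<Sum>j\<le>J. if j = m then h * \<delta> i else 0)"
      unfolding Suc by (intro sum.cong) auto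
    also have "\<dots> \<le> h * \<delta> i" using assms by (intro delta) auto
    finally show ?thesis .
  qed
  have "(\<Sum>j\<le>J. split_kernel b \<delta> h i j) = exp (- h * (\<delta> i + b)) *
      ((\<Sum>j\<le>J. if j = i then 1 + h\<^sup>2 * b * \<delta> i else 0) + (\<Sum>j\<le>J. if i = Suc j then h * \<delta> i else 0)
      + (\<Sum>j\<le>J. if j = Suc i then h * b else 0))"
    unfolding split_kernel_def by (simp only: sum_distrib_left[symmetric] sum.distrib)
  also have "\<dots> \<le> exp (- h * (\<delta> i + b)) * ((1 + h\<^sup>2 * b * \<delta> i) + h * \<delta> i + h * b)"
    using assms by (intro mult_left_mono add_mono delta pred) auto
  also have "\<dots> = exp (- h * (\<delta> i + b)) * ((1 + h * \<delta> i) * (1 + h * b))"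
    by (simp add: algebra_simps power2_eq_square)
  also have "\<dots> \<le> exp (- h * (\<delta> i + b)) * (exp (h * \<delta> i) * exp (h * b))"
    using assms by (intro mult_left_mono mult_mono exp_ge_add_one_self) auto
  also have "\<dots> = 1" by (simp add: exp_add[symmetric] algebra_simps)
  finally show ?thesis .
qed

lemma split_kernel_deriv:
  assumes "\<delta> 0 = 0"
  shows "((\<lambda>h. (split_kernel b \<delta> h i j - (if j = i then 1 else 0)) / h)
    \<longlongrightarrow> bd_rate (\<lambda>_. b) \<delta> i j) (at_right 0)"
proof -
  have D1: "((\<lambda>h. exp (- h * c) * (1 + h\<^sup>2 * e)) has_real_derivative - c) (at_right 0)" for c e :: real
    by (rule derivative_eq_intros refl | simp)+
  have D2: "((\<lambda>h. exp (- h * c) * (h * e)) has_real_derivative e) (at_right 0)" for c e :: real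
    by (rule derivative_eq_intros refl | simp)+
  consider (eq) "j = i" | (death) "i = Suc j" | (birth) "j = Suc i"
    | (far) "j \<noteq> i" "i \<noteq> Suc j" "j \<noteq> Suc i" by blast
  then have "((\<lambda>h. split_kernel b \<delta> h i j) has_real_derivative bd_rate (\<lambda>_. b) \<delta> i j) (at_right 0)"
  proof cases
    case eq
    then show ?thesis
      using D1[of "\<delta> i + b" "b * \<delta> i"]
      by (simp add: split_kernel_def bd_rate_def mult.assoc minus_diff_commute)
  next
    case death
    then show ?thesis
      using D2[of "\<delta> i + b" "\<delta> i"] by (simp add: split_kernel_def bd_rate_def)
  next
    case birth
    then show ?thesis
      using D2[of "\<delta> i + b" b] by (simp add: split_kernel_def bd_rate_def)
  next
    case far
    then show ?thesis by (simp add: split_kernel_def bd_rate_def)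
  qed
  then have "((\<lambda>h. (split_kernel b \<delta> h i j - split_kernel b \<delta> 0 i j) / (h - 0))
      \<longlongrightarrow> bd_rate (\<lambda>_. b) \<delta> i j) (at_right 0)"
    by (rule has_field_derivative_iff[THEN iffD1])
  moreover have "split_kernel b \<delta> 0 i j = (if j = i then 1 else 0)"
    by (auto simp: split_kernel_def)
  ultimately show ?thesis by (simp only: diff_zero)
qed

text \<open>The coefficients of the death operator come from \<delta> k = d2 k (k - 1) + (d1 + d2)
  k: x D^2 and D send x^k to k (k - 1) x^(k-1) and k x^(k-1). The linear coefficient d1 + d2 is
  \<delta> 1, hence nonnegative for a chain even when d1 is not.\<close>

lemma nonneg_stable_split_step:
  assumes p: "nonneg_stable p" and "0 \<le> b" "0 < h"
    and \<delta>: "\<And>k. \<delta> k = d1 * real k + d2 * (real k)\<^sup>2" "0 \<le> d2" "0 \<le> d1 + d2"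
  shows "\<exists>q. nonneg_stable q \<and> (\<forall>j. coeff q j = (\<Sum>i\<le>Suc j. coeff p i * split_kernel b \<delta> h i j))"
proof -
  define v where "v = weighted (\<lambda>k. exp (- h * (\<delta> k + b))) p"
  define d where "d = v + smult h (smult d2 (pCons 0 (pderiv (pderiv v))) + smult (d1 + d2) (pderiv v))"
  have v: "nonneg_stable v"
  proof -
    have "v = [:exp (- h * b):] * weighted (\<lambda>k. exp (- h * d1 * real k - h * d2 * (real k)\<^sup>2)) p"
    proof (rule poly_eqI)
      fix k
      have "exp (- h * (\<delta> k + b)) = exp (- h * b) * exp (- h * d1 * real k - h * d2 * (real k)\<^sup>2)"
        unfolding exp_add[symmetric] \<delta>(1) by (rule arg_cong[where f = exp]) (simp add: algebra_simps)
      then show "coeff v k = coeff ([:exp (- h * b):]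
          * weighted (\<lambda>k. exp (- h * d1 * real k - h * d2 * (real k)\<^sup>2)) p) k"
        by (simp add: v_def)
    qed
    moreover have "0 \<le> h * d2" using assms(3) \<delta>(2) by simp
    ultimately show ?thesis
      by (simp only: nonneg_stable_mult nonneg_stable_exp_quadratic[OF p] nonneg_stable_const exp_ge_zero)
  qed
  have d: "nonneg_stable d"
    unfolding d_def using v assms(3) \<delta>(2,3) by (intro nonneg_stable_death) auto
  have coeff_d: "coeff d k = coeff v k + h * \<delta> (Suc k) * coeff v (Suc k)" for k
    by (cases k) (simp_all add: d_def \<delta>(1) coeff_pderiv algebra_simps power2_eq_square)
  have "nonneg_stable ([:1, h * b:] * d)"
    using assms(2,3) d by (intro nonneg_stable_mult nonneg_stable_linear) auto
  moreover have "coeff ([:1, h * b:] * d) j = (\<Sum>i\<le>Suc j. coeff p i * split_kernel b \<delta> h i j)" for j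
  proof (cases j)
    case 0
    then show ?thesis
      by (simp add: coeff_d split_kernel_def v_def \<delta>(1) algebra_simps)
  next
    case (Suc m)
    have "(\<Sum>i\<le>Suc j. coeff p i * split_kernel b \<delta> h i j) =
        (\<Sum>i\<in>{m, Suc m, Suc (Suc m)}. coeff p i * split_kernel b \<delta> h i j)"
      by (rule sum.mono_neutral_right) (auto simp: Suc split_kernel_def)
    then show ?thesis
      by (simp add: Suc coeff_d split_kernel_def v_def algebra_simps power2_eq_square)
  qed
  ultimately show ?thesis by blast
qed

lemma nonneg_stable_kernel_power:
  assumes p: "nonneg_stable p" "degree p \<le> m"
    and step: "\<And>p. nonneg_stable p \<Longrightarrow>
      \<exists>q. nonneg_stable q \<and> (\<forall>j. coeff q j = (\<Sum>i\<le>Suc j. coeff p i * r i j))"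
  shows "\<exists>q. nonneg_stable q \<and> (\<forall>j. coeff q j = (\<Sum>k\<le>m. coeff p k * kernel_power r n k j))"
proof (induction n)
  case 0
  have "coeff p j = (\<Sum>k\<le>m. coeff p k * kernel_power r 0 k j)" for j
    using p(2) by (auto simp: if_distrib sum.delta coeff_eq_0 cong: if_cong)
  then show ?case using p(1) by blast
next
  case (Suc n)
  then obtain q where q: "nonneg_stable q" "\<And>j. coeff q j = (\<Sum>k\<le>m. coeff p k * kernel_power r n k j)"
    by blast
  obtain q' where q': "nonneg_stable q'" "\<And>j. coeff q' j = (\<Sum>i\<le>Suc j. coeff q i * r i j)"
    using step[OF q(1)] by blast
  have "coeff q' j = (\<Sum>k\<le>m. coeff p k * kernel_power r (Suc n) k j)" for j
  proof -
    have "coeff q' j = (\<Sum>i\<le>Suc j. \<Sum>k\<le>m. coeff p k * kernel_power r n k i * r i j)"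
      unfolding q' q(2) by (simp only: sum_distrib_right)
    also have "\<dots> = (\<Sum>k\<le>m. \<Sum>i\<le>Suc j. coeff p k * kernel_power r n k i * r i j)" by (rule sum.swap)
    also have "\<dots> = (\<Sum>k\<le>m. coeff p k * kernel_power r (Suc n) k j)"
      by (simp only: kernel_power.simps sum_distrib_left mult.assoc)
    finally show ?thesis .
  qed
  then show ?case using q' by blast
qed

section \<open>Laws at time t and the limit of small time steps\<close>

context birth_death_chain
begin

lemma transition_integrable: "0 \<le> t \<Longrightarrow> integrable (measure_pmf \<mu>) (\<lambda>k. transition t k j)"
  by (rule measure_pmf.integrable_const_bound[where B = 1])
    (auto simp: transition_nonneg transition_le_1)

lemma distribution_at_eq:
  assumes "0 \<le> t"
  shows "measure (distribution_at P X \<mu> t) {j} = (\<integral>k. transition t k j \<partial>measure_pmf \<mu>)"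
  unfolding transition_def by (rule measure_distribution_at[OF assms])

text \<open>For the converse, one state of positive mass is needed to exclude the zero series; it is
  found in a row of the transition matrix started in the support of the initial law.\<close>

lemma t_stable_distribution_at_iff:
  assumes "0 \<le> t"
  shows "t_stable_measure (distribution_at P X \<mu> t) \<longleftrightarrow>
    laguerre_polya (\<lambda>j. \<integral>k. transition t k j \<partial>measure_pmf \<mu>)" (is "_ \<longleftrightarrow> laguerre_polya ?d")
proof
  assume "t_stable_measure (distribution_at P X \<mu> t)"
  from t_stable_measure_imp_laguerre_polya[OF this]
  show "laguerre_polya ?d" by (simp add: distribution_at_eq[OF assms])
next
  assume lp: "laguerre_polya ?d"
  have mass: "(\<Sum>j\<le>n. ?d j) \<le> 1" for n
  proof -
    have "(\<Sum>j\<le>n. ?d j) = (\<integral>k. (\<Sum>j\<le>n. transition t k j) \<partial>measure_pmf \<mu>)"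
      using transition_integrable[OF assms] by (simp add: Bochner_Integration.integral_sum)
    also have "\<dots> \<le> (\<integral>k. 1 \<partial>measure_pmf \<mu>)"
      using transition_integrable[OF assms] transition_mass[OF _ assms] by (intro integral_mono) auto
    finally show ?thesis by simp
  qed
  obtain i where i: "i \<in> set_pmf \<mu>" using set_pmf_not_empty[of \<mu>] by blast
  have "\<exists>j. 0 < transition t i j"
  proof (rule ccontr)
    assume "\<not> ?thesis"
    then have "transition t i = (\<lambda>_. 0)"
      using transition_nonneg[of t i] by (auto simp: fun_eq_iff not_less intro: antisym)
    then show False using transition_sums[OF assms, of i] sums_unique2[OF sums_zero] by fastforce
  qed
  then obtain j where j: "0 < transition t i j" by blast
  have "0 < pmf \<mu> i * transition t i j" using i j by (simp add: pmf_positive)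
  also have "\<dots> = (\<integral>k. transition t i j * indicator {i} k \<partial>measure_pmf \<mu>)"
    by (simp add: measure_pmf_single)
  also have "\<dots> \<le> ?d j"
  proof (rule integral_mono)
    show "integrable (measure_pmf \<mu>) (\<lambda>k. transition t i j * indicator {i} k)"
      by (rule measure_pmf.integrable_const_bound[where B = 1])
        (auto simp: indicator_def transition_nonneg transition_le_1[OF assms])
  qed (auto simp: indicator_def transition_nonneg intro: transition_integrable[OF assms])
  finally have "0 < ?d j" .
  from laguerre_polya_imp_t_stable[OF lp mass this]
  show "t_stable_measure (distribution_at P X \<mu> t)"
    unfolding t_stable_measure_def by (simp add: distribution_at_eq[OF assms])
qed

lemma preserves_if_quadratic:
  assumes \<beta>: "\<And>k. \<beta> k = b" and \<delta>: "\<And>k. \<delta> k = d1 * real k + d2 * (real k)\<^sup>2"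
  shows "preserves_t_stable P X"
  unfolding preserves_t_stable_def
proof (intro allI impI)
  fix \<mu> :: "nat pmf" and t :: real
  assume \<mu>: "t_stable_measure (measure_pmf \<mu>)" and t: "0 < t"
  have d2: "0 \<le> d2"
    by (rule quadratic_nonneg[of 0 d1]) (use death_nonneg in \<open>simp add: \<delta>\<close>)
  have d12: "0 \<le> d1 + d2" using death_nonneg[of 1] by (simp add: \<delta>)
  have b: "0 \<le> b" using birth_nonneg[of 0] by (simp add: \<beta>)
  define r where "r = split_kernel b \<delta>"
  have conv: "(\<lambda>n. kernel_power (r (t / real (Suc n))) (Suc n) k j) \<longlonglongrightarrow> transition t k j" for k j
  proof (rule product_formula)
    have "\<beta> = (\<lambda>_. b)" using \<beta> by auto
    then show "((\<lambda>h. (r h i j - (if j = i then 1 else 0)) / h) \<longlongrightarrow> bd_rate \<beta> \<delta> i j) (at_right 0)" for i j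
      unfolding r_def using split_kernel_deriv[of \<delta>, OF death_0] by simp
  qed (use t b death_nonneg split_kernel_nonneg split_kernel_band split_kernel_mass in \<open>auto simp: r_def\<close>)
  have lp: "laguerre_polya (pmf \<mu>)"
    using t_stable_measure_imp_laguerre_polya[OF \<mu>] by (simp add: measure_pmf_single)
  \<comment> \<open>The initial law is first replaced by its Jensen polynomials: they have finite
    support, so the limit of small time steps involves only finite sums.\<close>
  have "laguerre_polya (\<lambda>j. \<Sum>k\<le>Suc m. coeff (jensen (Suc m) (pmf \<mu>)) k * transition t k j)" for m
  proof (rule laguerre_polya_limit)
    let ?p = "jensen (Suc m) (pmf \<mu>)"
    show "laguerre_polya (\<lambda>j. \<Sum>k\<le>Suc m. coeff ?p k * kernel_power (r (t / real (Suc n))) (Suc n) k j)" for n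
    proof -
      have "\<exists>q. nonneg_stable q \<and>
          (\<forall>j. coeff q j = (\<Sum>k\<le>Suc m. coeff ?p k * kernel_power (r (t / real (Suc n))) (Suc n) k j))"
        by (rule nonneg_stable_kernel_power)
          (use lp degree_jensen_le t b \<delta> d2 d12 nonneg_stable_split_step[of _ b "t / real (Suc n)" \<delta> d1 d2]
            in \<open>auto simp: laguerre_polya_def r_def\<close>)
      then obtain q where q: "nonneg_stable q"
        "coeff q = (\<lambda>j. \<Sum>k\<le>Suc m. coeff ?p k * kernel_power (r (t / real (Suc n))) (Suc n) k j)"
        by auto
      show ?thesis using laguerre_polya_poly[OF q(1)] unfolding q(2) .
    qed
    show "(\<lambda>n. \<Sum>k\<le>Suc m. coeff ?p k * kernel_power (r (t / real (Suc n))) (Suc n) k j)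
        \<longlonglongrightarrow> (\<Sum>k\<le>Suc m. coeff ?p k * transition t k j)" for j
      by (intro tendsto_sum tendsto_mult tendsto_const conv)
  qed
  \<comment> \<open>The second limit restores the initial law; the weights increase no term, so
    dominated convergence applies.\<close>
  moreover have "(\<lambda>m. \<Sum>k\<le>Suc m. coeff (jensen (Suc m) (pmf \<mu>)) k * transition t k j)
      \<longlonglongrightarrow> (\<integral>k. transition t k j \<partial>measure_pmf \<mu>)" for j
  proof -
    have eq: "(\<Sum>k\<le>Suc m. coeff (jensen (Suc m) (pmf \<mu>)) k * transition t k j)
        = (\<integral>k. jensen_weight (Suc m) k * transition t k j \<partial>measure_pmf \<mu>)" for m
    proof -
      have "(\<integral>k. jensen_weight (Suc m) k * transition t k j \<partial>measure_pmf \<mu>)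
          = (\<Sum>k\<le>Suc m. jensen_weight (Suc m) k * transition t k j * pmf \<mu> k)"
      proof (rule integral_measure_pmf_real)
        show "k \<in> {..Suc m}" if "jensen_weight (Suc m) k * transition t k j \<noteq> 0" for k
          using that jensen_weight_eq_0[of "Suc m" k] by (cases "k \<le> Suc m") auto
      qed simp
      then show ?thesis by (simp add: coeff_jensen mult_ac del: sum.atMost_Suc)
    qed
    have "(\<lambda>m. \<integral>k. jensen_weight (Suc m) k * transition t k j \<partial>measure_pmf \<mu>)
        \<longlonglongrightarrow> (\<integral>k. transition t k j \<partial>measure_pmf \<mu>)"
    proof (rule integral_dominated_convergence[where w = "\<lambda>k. transition t k j"])
      show "integrable (measure_pmf \<mu>) (\<lambda>k. transition t k j)" using t by (intro transition_integrable) simp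
      show "AE k in measure_pmf \<mu>. (\<lambda>m. jensen_weight (Suc m) k * transition t k j) \<longlonglongrightarrow> transition t k j"
      proof (rule AE_I2)
        fix k
        have "(\<lambda>m. jensen_weight (Suc m) k * transition t k j) \<longlonglongrightarrow> 1 * transition t k j"
          by (rule tendsto_mult[OF LIMSEQ_Suc[OF jensen_weight_tendsto] tendsto_const])
        then show "(\<lambda>m. jensen_weight (Suc m) k * transition t k j) \<longlonglongrightarrow> transition t k j" by simp
      qed
      show "AE k in measure_pmf \<mu>. norm (jensen_weight (Suc m) k * transition t k j) \<le> transition t k j" for m
        using jensen_weight_nonneg[of "Suc m"] jensen_weight_le_1[of "Suc m"] transition_nonneg
        by (auto simp: abs_mult mult_left_le_one_le)
    qed auto
    then show ?thesis by (simp only: eq)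
  qed
  ultimately have "laguerre_polya (\<lambda>j. \<integral>k. transition t k j \<partial>measure_pmf \<mu>)"
    by (rule laguerre_polya_limit)
  then show "t_stable_measure (distribution_at P X \<mu> t)"
    using t t_stable_distribution_at_iff by simp
qed

end

section \<open>Necessity\<close>

subsection \<open>Perturbation of a triple root\<close>

text \<open>Decay faster than every geometric sequence, uniformly in n. Together with
  coefficientwise convergence it gives convergence of values at moving points; coefficients below J
  are left to the latter.\<close>

definition uniformly_small_tails :: "(nat \<Rightarrow> real poly) \<Rightarrow> bool" where
  "uniformly_small_tails e \<longleftrightarrow>
     (\<forall>\<theta>>0. \<exists>K J. \<forall>\<^sub>F n in sequentially. \<forall>j\<ge>J. \<bar>coeff (e n) j\<bar> \<le> K * \<theta> ^ j)"

lemma uniformly_small_tails_pderiv: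
  assumes "uniformly_small_tails e"
  shows "uniformly_small_tails (\<lambda>n. pderiv (e n))"
  unfolding uniformly_small_tails_def
proof (intro allI impI)
  fix \<theta> :: real assume \<theta>: "0 < \<theta>"
  \<comment> \<open>Halving the ratio pays for the factor j + 1 \<le> 2^(j+1) that differentiation
    produces.\<close>
  then have "0 < \<theta> / 2" by simp
  then obtain K J where ev: "\<forall>\<^sub>F n in sequentially. \<forall>j\<ge>J. \<bar>coeff (e n) j\<bar> \<le> K * (\<theta> / 2) ^ j"
    using assms unfolding uniformly_small_tails_def by blast
  have "\<forall>\<^sub>F n in sequentially. \<forall>j\<ge>J. \<bar>coeff (pderiv (e n)) j\<bar> \<le> (\<bar>K\<bar> * \<theta>) * \<theta> ^ j"
    using ev
  proof eventually_elim
    case (elim n)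
    show ?case
    proof (intro allI impI)
      fix j assume "J \<le> j"
      have pow: "real (Suc j) \<le> 2 ^ Suc j" using of_nat_less_two_power[of "Suc j", where 'a = real] by (rule less_imp_le)
      have "\<bar>coeff (pderiv (e n)) j\<bar> = real (Suc j) * \<bar>coeff (e n) (Suc j)\<bar>"
        by (simp add: coeff_pderiv abs_mult del: of_nat_Suc)
      also have "\<dots> \<le> 2 ^ Suc j * (\<bar>K\<bar> * (\<theta> / 2) ^ Suc j)"
      proof (rule mult_mono[OF pow])
        have "\<bar>coeff (e n) (Suc j)\<bar> \<le> K * (\<theta> / 2) ^ Suc j"
          using elim le_SucI[OF \<open>J \<le> j\<close>] by blast
        also have "\<dots> \<le> \<bar>K\<bar> * (\<theta> / 2) ^ Suc j" using \<theta> by (intro mult_right_mono) auto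
        finally show "\<bar>coeff (e n) (Suc j)\<bar> \<le> \<bar>K\<bar> * (\<theta> / 2) ^ Suc j" .
      qed auto
      also have "\<dots> = (\<bar>K\<bar> * \<theta>) * \<theta> ^ j" by (simp add: power_divide)
      finally show "\<bar>coeff (pderiv (e n)) j\<bar> \<le> (\<bar>K\<bar> * \<theta>) * \<theta> ^ j" .
    qed
  qed
  then show "\<exists>K J. \<forall>\<^sub>F n in sequentially. \<forall>j\<ge>J. \<bar>coeff (pderiv (e n)) j\<bar> \<le> K * \<theta> ^ j" by blast
qed

lemma tendsto_poly_uniformly_small_tails:
  assumes tails: "uniformly_small_tails e"
    and lim: "\<And>j. (\<lambda>n. coeff (e n) j) \<longlonglongrightarrow> coeff q j" and x: "x \<longlonglongrightarrow> y"
  shows "(\<lambda>n. poly (e n) (x n)) \<longlonglongrightarrow> poly q y"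
proof -
  define R where "R = \<bar>y\<bar> + 1"
  have R: "0 < R" by (simp add: R_def)
  have "(\<lambda>n. \<bar>x n\<bar>) \<longlonglongrightarrow> \<bar>y\<bar>" using x by (rule tendsto_rabs)
  then have evx: "\<forall>\<^sub>F n in sequentially. \<bar>x n\<bar> < R"
    by (rule order_tendstoD(2)) (simp add: R_def)
  \<comment> \<open>With this ratio the terms at points of modulus at most R are dominated by
    multiples of 2^(-j).\<close>
  have "0 < 1 / (2 * R)" using R by simp
  then obtain K J where ev: "\<forall>\<^sub>F n in sequentially. \<forall>j\<ge>J. \<bar>coeff (e n) j\<bar> \<le> K * (1 / (2 * R)) ^ j"
    using tails unfolding uniformly_small_tails_def by blast
  have "(\<lambda>n. \<Sum>j. coeff (e n) j * x n ^ j) \<longlonglongrightarrow> (\<Sum>j. coeff q j * y ^ j)"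
  proof (rule tannerys_theorem[THEN conjunct2, THEN conjunct2])
    show "(\<lambda>n. coeff (e n) j * x n ^ j) \<longlonglongrightarrow> coeff q j * y ^ j" for j
      by (intro tendsto_mult lim tendsto_power x)
    show "summable (\<lambda>j. \<bar>K\<bar> * (1 / 2) ^ j :: real)"
      by (intro summable_mult summable_geometric) simp
    have "\<forall>\<^sub>F n in sequentially. \<forall>j\<ge>J. norm (coeff (e n) j * x n ^ j) \<le> \<bar>K\<bar> * (1 / 2) ^ j"
      using ev evx
    proof eventually_elim
      case (elim n)
      show ?case
      proof (intro allI impI)
        fix j assume "J \<le> j"
        have "norm (coeff (e n) j * x n ^ j) = \<bar>coeff (e n) j\<bar> * \<bar>x n\<bar> ^ j"
          by (simp add: abs_mult power_abs)
        also have "\<dots> \<le> (\<bar>K\<bar> * (1 / (2 * R)) ^ j) * R ^ j"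
        proof (rule mult_mono)
          have "\<bar>coeff (e n) j\<bar> \<le> K * (1 / (2 * R)) ^ j" using elim \<open>J \<le> j\<close> by simp
          also have "\<dots> \<le> \<bar>K\<bar> * (1 / (2 * R)) ^ j" using R by (intro mult_right_mono) auto
          finally show "\<bar>coeff (e n) j\<bar> \<le> \<bar>K\<bar> * (1 / (2 * R)) ^ j" .
          show "\<bar>x n\<bar> ^ j \<le> R ^ j" using elim by (intro power_mono) auto
        qed (use R in auto)
        also have "\<dots> = \<bar>K\<bar> * (1 / 2) ^ j" using R by (simp add: power_divide power_mult_distrib)
        finally show "norm (coeff (e n) j * x n ^ j) \<le> \<bar>K\<bar> * (1 / 2) ^ j" .
      qed
    qed
    then show "\<forall>\<^sub>F (j, n) in sequentially \<times>\<^sub>F sequentially.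
        norm (coeff (e n) j * x n ^ j) \<le> \<bar>K\<bar> * (1 / 2) ^ j"
      unfolding eventually_prod_filter
      by (intro exI[of _ "\<lambda>j. J \<le> j"] exI[of _ "\<lambda>n. \<forall>j\<ge>J. norm (coeff (e n) j * x n ^ j) \<le> \<bar>K\<bar> * (1 / 2) ^ j"])
        (auto simp: eventually_ge_at_top)
  qed simp
  then show ?thesis by (simp add: sums_unique[OF poly_sums, symmetric])
qed

text \<open>Let N be the degree of \<psi>. Coefficient N of \<open>p n\<close> stays near the
  leading coefficient, while coefficient N + 1 is O(T n). By \<open>nonneg_stable_tp2\<close> every
  later ratio is then O(T n) too, hence eventually below any given \<theta>.\<close>

lemma difference_quotient_tails:
  assumes ns: "\<And>n. nonneg_stable (p n)" and T: "\<And>n. 0 < T n" "T \<longlonglongrightarrow> 0"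
    and lim: "\<And>j. (\<lambda>n. (coeff (p n) j - coeff \<psi> j) / T n) \<longlonglongrightarrow> l j"
    and lead: "0 < lead_coeff \<psi>"
  shows "uniformly_small_tails (\<lambda>n. smult (1 / T n) (p n - \<psi>))"
  unfolding uniformly_small_tails_def
proof (intro allI impI)
  fix \<theta> :: real assume \<theta>: "0 < \<theta>"
  define N where "N = degree \<psi>"
  define \<kappa> where "\<kappa> = lead_coeff \<psi>"
  define C where "C = \<bar>l (Suc N)\<bar> + 1"
  have \<kappa>: "0 < \<kappa>" and C: "0 < C" using lead by (simp_all add: \<kappa>_def C_def)
  have "(\<lambda>n. coeff \<psi> N + T n * ((coeff (p n) N - coeff \<psi> N) / T n)) \<longlonglongrightarrow> coeff \<psi> N + 0 * l N"
    by (intro tendsto_intros T lim)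
  moreover have "coeff \<psi> N + T n * ((coeff (p n) N - coeff \<psi> N) / T n) = coeff (p n) N" for n
    using T(1)[of n] by simp
  ultimately have "(\<lambda>n. coeff (p n) N) \<longlonglongrightarrow> \<kappa>" by (simp add: N_def \<kappa>_def)
  then have ev1: "\<forall>\<^sub>F n in sequentially. \<kappa> / 2 < coeff (p n) N"
    by (rule order_tendstoD(1)) (use \<kappa> in simp)
  have ev2: "\<forall>\<^sub>F n in sequentially. (coeff (p n) (Suc N) - coeff \<psi> (Suc N)) / T n < C"
    by (rule order_tendstoD(2)[OF lim]) (simp add: C_def)
  have ev3: "\<forall>\<^sub>F n in sequentially. T n < \<kappa> * \<theta> / (2 * C)"
    by (rule order_tendstoD(2)[OF T(2)]) (use \<kappa> C \<theta> in simp)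
  have "\<forall>\<^sub>F n in sequentially. \<forall>j\<ge>Suc N. \<bar>coeff (smult (1 / T n) (p n - \<psi>)) j\<bar> \<le> (C / \<theta> ^ Suc N) * \<theta> ^ j"
    using ev1 ev2 ev3
  proof eventually_elim
    case (elim n)
    have \<psi>0: "coeff \<psi> j = 0" if "Suc N \<le> j" for j
      using that by (intro coeff_eq_0) (simp add: N_def)
    have a: "0 \<le> coeff (p n) j" for j by (rule nonneg_stable_coeff[OF ns])
    have first: "coeff (p n) (Suc N) \<le> C * T n"
      using elim(2) T(1)[of n] by (simp add: \<psi>0 pos_divide_less_eq less_imp_le)
    have step: "coeff (p n) (Suc j) \<le> \<theta> * coeff (p n) j" if "N \<le> j" for j
    proof -
      have "coeff (p n) N * coeff (p n) (Suc j) \<le> coeff (p n) (Suc N) * coeff (p n) j"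
        by (rule nonneg_stable_tp2[OF ns that])
      also have "\<dots> \<le> (C * T n) * coeff (p n) j" using first a by (intro mult_right_mono) auto
      also have "\<dots> \<le> (\<kappa> / 2 * \<theta>) * coeff (p n) j"
        using elim(3) C a by (intro mult_right_mono) (auto simp: field_simps)
      finally have "coeff (p n) N * coeff (p n) (Suc j) \<le> \<kappa> / 2 * (\<theta> * coeff (p n) j)" by (simp add: mult_ac)
      moreover have "\<kappa> / 2 * coeff (p n) (Suc j) \<le> coeff (p n) N * coeff (p n) (Suc j)"
        using elim(1) a by (intro mult_right_mono) auto
      ultimately have "\<kappa> / 2 * coeff (p n) (Suc j) \<le> \<kappa> / 2 * (\<theta> * coeff (p n) j)" by linarith
      then show ?thesis using \<kappa> by (simp add: mult_le_cancel_left_pos)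
    qed
    have "coeff (p n) j \<le> C * T n * \<theta> ^ (j - Suc N)" if "Suc N \<le> j" for j
      using that
    proof (induction j rule: dec_induct)
      case base
      then show ?case using first by simp
    next
      case (step j)
      have "coeff (p n) (Suc j) \<le> \<theta> * coeff (p n) j" using \<open>Suc N \<le> j\<close> by (intro \<open>\<And>j. N \<le> j \<Longrightarrow> _\<close>) simp
      also have "\<dots> \<le> \<theta> * (C * T n * \<theta> ^ (j - Suc N))" using step.IH \<theta> by (intro mult_left_mono) auto
      also have "\<dots> = C * T n * \<theta> ^ Suc (j - Suc N)" by simp
      also have "Suc (j - Suc N) = Suc j - Suc N" using step.hyps by arith
      finally show ?case .
    qed
    moreover have "\<theta> ^ (j - Suc N) = \<theta> ^ j / \<theta> ^ Suc N" if "Suc N \<le> j" for j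
      using \<theta> that by (intro power_diff) auto
    ultimately have bound: "coeff (p n) j / T n \<le> C / \<theta> ^ Suc N * \<theta> ^ j" if "Suc N \<le> j" for j
      using that T(1)[of n] by (simp add: pos_divide_le_eq mult_ac)
    show ?case
    proof (intro allI impI)
      fix j assume j: "Suc N \<le> j"
      have "\<bar>coeff (smult (1 / T n) (p n - \<psi>)) j\<bar> = coeff (p n) j / T n"
        using a[of j] T(1)[of n] by (simp add: \<psi>0[OF j])
      then show "\<bar>coeff (smult (1 / T n) (p n - \<psi>)) j\<bar> \<le> (C / \<theta> ^ Suc N) * \<theta> ^ j"
        using bound[OF j] by simp
    qed
  qed
  then show "\<exists>K J. \<forall>\<^sub>F n in sequentially. \<forall>j\<ge>J. \<bar>coeff (smult (1 / T n) (p n - \<psi>)) j\<bar> \<le> K * \<theta> ^ j"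
    by blast
qed

text \<open>
  At distance \<open>s * t^(1/3)\<close> from the triple root all terms of the Laguerre inequality
  \<open>p * p'' \<le> p'^2\<close> are of order \<open>t^(4/3)\<close>; its limit is an inequality for all real \<open>s\<close>.
\<close>

lemma triple_root_perturbation:
  assumes ns: "\<And>n. nonneg_stable (p n)" and T: "\<And>n. 0 < T n" "T \<longlonglongrightarrow> 0"
    and lim: "\<And>j. (\<lambda>n. (coeff (p n) j - coeff \<psi> j) / T n) \<longlonglongrightarrow> coeff q j"
    and lead: "0 < lead_coeff \<psi>"
    and \<psi>: "\<psi> = g * [:r, 1:] ^ 3" and g: "poly g (- r) \<noteq> 0"
  shows "poly q (- r) = 0"
proof -
  define e where "e = (\<lambda>n. smult (1 / T n) (p n - \<psi>))"
  have tails: "uniformly_small_tails e"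
    unfolding e_def by (rule difference_quotient_tails[OF ns T lim lead])
  have p_eq: "p n = \<psi> + smult (T n) (e n)" for n using T(1)[of n] by (simp add: e_def)
  have e_lim: "(\<lambda>n. coeff (e n) j) \<longlonglongrightarrow> coeff q j" for j using lim[of j] by (simp add: e_def)
  have e_lim': "(\<lambda>n. coeff (pderiv (e n)) j) \<longlonglongrightarrow> coeff (pderiv q) j" for j
    unfolding coeff_pderiv by (intro tendsto_mult tendsto_const e_lim)
  have e_lim'': "(\<lambda>n. coeff (pderiv (pderiv (e n))) j) \<longlonglongrightarrow> coeff (pderiv (pderiv q)) j" for j
    unfolding coeff_pderiv[of "pderiv _"] by (intro tendsto_mult tendsto_const e_lim')
  note tails' = uniformly_small_tails_pderiv[OF tails]
  note tails'' = uniformly_small_tails_pderiv[OF tails']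
  \<comment> \<open>In this scale the cubic term of \<psi> and the perturbation T n * q have the
    same size.\<close>
  define \<tau> where "\<tau> = (\<lambda>n. root 3 (T n))"
  have \<tau>: "0 < \<tau> n" "\<tau> n ^ 3 = T n" for n
    using T(1)[of n] by (simp_all add: \<tau>_def odd_real_root_pow)
  have \<tau>_lim: "\<tau> \<longlonglongrightarrow> 0"
    using tendsto_real_root[OF T(2), of 3] by (simp add: \<tau>_def)
  define G A where "G = poly g (- r)" and "A = poly q (- r)"
  have ineq: "6 * (A * G) * s \<le> 3 * G\<^sup>2 * s ^ 4" for s
  proof -
    define x where "x = (\<lambda>n. - r + s * \<tau> n)"
    have x: "x \<longlonglongrightarrow> - r"
      using tendsto_add[OF tendsto_const tendsto_mult[OF tendsto_const \<tau>_lim], of "- r" s] by (simp add: x_def)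
    have xr: "r + x n = s * \<tau> n" for n by (simp add: x_def)
    have lin: "poly [:r, 1:] (x n) = s * \<tau> n" for n by (simp add: x_def)
    have poly_lim: "(\<lambda>n. poly f (x n)) \<longlonglongrightarrow> poly f (- r)" for f :: "real poly"
      using isCont_tendsto_compose[OF poly_isCont x] .
    have L: "pderiv ([:r, 1:] ^ 3) = smult 3 ([:r, 1:] ^ 2)" "pderiv ([:r, 1:] ^ 2) = smult 2 [:r, 1:]"
      for r :: real
      by (simp_all add: pderiv_power pderiv_pCons numeral_3_eq_3 numeral_2_eq_2)
    have \<psi>0: "poly \<psi> (x n) = poly g (x n) * (s * \<tau> n) ^ 3" for n
      unfolding \<psi> by (simp add: xr)
    have \<psi>1: "poly (pderiv \<psi>) (x n)
        = poly (pderiv g) (x n) * (s * \<tau> n) ^ 3 + 3 * poly g (x n) * (s * \<tau> n)\<^sup>2" for n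
      unfolding \<psi> pderiv_mult L by (simp add: xr)
    have \<psi>2: "poly (pderiv (pderiv \<psi>)) (x n) = poly (pderiv (pderiv g)) (x n) * (s * \<tau> n) ^ 3
        + 6 * poly (pderiv g) (x n) * (s * \<tau> n)\<^sup>2 + 6 * poly g (x n) * (s * \<tau> n)" for n
      unfolding \<psi> pderiv_mult pderiv_add pderiv_smult L poly_add poly_mult poly_smult poly_power lin
      by (simp add: algebra_simps)
    let ?a = "\<lambda>n. poly g (x n) * s ^ 3 + poly (e n) (x n)"
    let ?b = "\<lambda>n. poly (pderiv g) (x n) * s ^ 3 * \<tau> n + 3 * poly g (x n) * s\<^sup>2
      + \<tau> n * poly (pderiv (e n)) (x n)"
    let ?c = "\<lambda>n. poly (pderiv (pderiv g)) (x n) * s ^ 3 * (\<tau> n)\<^sup>2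
      + 6 * poly (pderiv g) (x n) * s\<^sup>2 * \<tau> n + 6 * poly g (x n) * s
      + (\<tau> n)\<^sup>2 * poly (pderiv (pderiv (e n))) (x n)"
    \<comment> \<open>p, p' and p'' carry the factors \<tau>^3, \<tau>^2 and \<tau>, so \<tau>^4
      cancels from both sides of Laguerre's inequality.\<close>
    have le: "?a n * ?c n \<le> (?b n)\<^sup>2" for n
    proof -
      have a: "poly (p n) (x n) = \<tau> n ^ 3 * ?a n"
        unfolding p_eq by (simp add: \<psi>0 \<tau>(2)[symmetric] algebra_simps)
      have b: "poly (pderiv (p n)) (x n) = (\<tau> n)\<^sup>2 * ?b n"
        unfolding p_eq pderiv_add pderiv_smult
        by (simp add: \<psi>1 \<tau>(2)[symmetric] algebra_simps power2_eq_square power3_eq_cube)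
      have c: "poly (pderiv (pderiv (p n))) (x n) = \<tau> n * ?c n"
        unfolding p_eq pderiv_add pderiv_smult
        by (simp add: \<psi>2 \<tau>(2)[symmetric] algebra_simps power2_eq_square power3_eq_cube)
      have "\<tau> n ^ 4 * (?a n * ?c n) = poly (p n) (x n) * poly (pderiv (pderiv (p n))) (x n)"
        unfolding a c by (simp only: power4_eq_xxxx power3_eq_cube mult_ac)
      also have "\<dots> \<le> (poly (pderiv (p n)) (x n))\<^sup>2" by (rule nonneg_stable_laguerre[OF ns])
      also have "\<dots> = \<tau> n ^ 4 * (?b n)\<^sup>2"
        unfolding b by (simp only: power_mult_distrib power_mult[symmetric]) simp
      finally show ?thesis by (rule mult_left_le_imp_le) (use \<tau>(1)[of n] in simp)
    qed
    note lims = poly_lim tendsto_poly_uniformly_small_tails[OF tails e_lim x]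
      tendsto_poly_uniformly_small_tails[OF tails' e_lim' x]
      tendsto_poly_uniformly_small_tails[OF tails'' e_lim'' x] \<tau>_lim
    have a: "?a \<longlonglongrightarrow> G * s ^ 3 + A"
      unfolding G_def A_def by (intro tendsto_intros lims)
    have "?b \<longlonglongrightarrow> poly (pderiv g) (- r) * s ^ 3 * 0 + 3 * G * s\<^sup>2 + 0 * poly (pderiv q) (- r)"
      unfolding G_def by (intro tendsto_intros lims)
    then have b: "?b \<longlonglongrightarrow> 3 * G * s\<^sup>2" by simp
    have "?c \<longlonglongrightarrow> poly (pderiv (pderiv g)) (- r) * s ^ 3 * 0\<^sup>2 + 6 * poly (pderiv g) (- r) * s\<^sup>2 * 0
        + 6 * G * s + 0\<^sup>2 * poly (pderiv (pderiv q)) (- r)"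
      unfolding G_def by (intro tendsto_intros lims)
    then have c: "?c \<longlonglongrightarrow> 6 * G * s" by simp
    have "(G * s ^ 3 + A) * (6 * G * s) \<le> (3 * G * s\<^sup>2)\<^sup>2"
      by (rule LIMSEQ_le[OF tendsto_mult[OF a c] tendsto_power[OF b]]) (use le in blast)
    then show ?thesis
      by (simp add: algebra_simps power2_eq_square power3_eq_cube power4_eq_xxxx)
  qed
  have G: "G \<noteq> 0" using g by (simp add: G_def)
  have "A * G = 0"
  proof (rule ccontr)
    define B where "B = A * G"
    assume "A * G \<noteq> 0"
    then have B: "0 < B\<^sup>2" by (simp add: B_def)
    \<comment> \<open>Near s = 0 the linear term beats s^4, so s = \<epsilon> B, of the sign of B,
      violates the inequality; this \<epsilon> satisfies both \<epsilon> \<le> 1 and G^2 B^2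
      \<epsilon> \<le> 1.\<close>
    define \<epsilon> where "\<epsilon> = 1 / (1 + G\<^sup>2 * B\<^sup>2)"
    have d: "0 < 1 + G\<^sup>2 * B\<^sup>2" using B by (simp add: add_pos_nonneg)
    then have \<epsilon>: "0 < \<epsilon>" "\<epsilon> \<le> 1" by (simp_all add: \<epsilon>_def)
    have "6 * B * (\<epsilon> * B) \<le> 3 * G\<^sup>2 * (\<epsilon> * B) ^ 4" using ineq[of "\<epsilon> * B"] by (simp add: B_def)
    then have "(3 * \<epsilon> * B\<^sup>2) * 2 \<le> (3 * \<epsilon> * B\<^sup>2) * (G\<^sup>2 * B\<^sup>2 * \<epsilon> ^ 3)"
      by (simp add: power2_eq_square power3_eq_cube power4_eq_xxxx mult_ac)
    then have "2 \<le> G\<^sup>2 * B\<^sup>2 * \<epsilon> ^ 3" by (rule mult_left_le_imp_le) (use \<epsilon> B in simp)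
    also have "\<dots> \<le> G\<^sup>2 * B\<^sup>2 * \<epsilon>"
      using \<epsilon> by (intro mult_left_mono) (simp_all add: power_le_one power3_eq_cube mult_left_le_one_le mult_le_one)
    also have "\<dots> \<le> 1" using d by (simp add: \<epsilon>_def)
    finally show False by simp
  qed
  then show ?thesis using G by (simp add: A_def)
qed

lemma third_difference_zero_imp_quadratic:
  fixes f :: "nat \<Rightarrow> real"
  assumes "\<And>i. f (i + 3) = 3 * f (i + 2) - 3 * f (i + 1) + f i"
  shows "\<exists>a b c. \<forall>k. f k = a + b * real k + c * (real k)\<^sup>2"
proof -
  define c where "c = (f 2 - 2 * f 1 + f 0) / 2"
  define b where "b = f 1 - f 0 - c"
  define h where "h = (\<lambda>k. f 0 + b * real k + c * (real k)\<^sup>2)"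
  have "f k = h k \<and> f (k + 1) = h (k + 1) \<and> f (k + 2) = h (k + 2)" for k
  proof (induction k)
    case 0
    show ?case by (simp add: h_def b_def c_def field_simps numeral_2_eq_2[symmetric])
  next
    case (Suc k)
    have "h (k + 3) = 3 * h (k + 2) - 3 * h (k + 1) + h k"
      by (simp add: h_def algebra_simps power2_eq_square)
    then show ?case using Suc assms[of k] by (simp add: numeral_3_eq_3 numeral_2_eq_2)
  qed
  then show ?thesis unfolding h_def by blast
qed

subsection \<open>Short-time asymptotics\<close>

lemma ex_pmf:
  fixes c :: "nat \<Rightarrow> real"
  assumes "\<And>k. 0 \<le> c k" "c sums 1"
  obtains \<mu> where "pmf \<mu> = c"
proof -
  have "(\<integral>\<^sup>+ k. ennreal (c k) \<partial>count_space UNIV) = 1"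
    unfolding nn_integral_count_space_nat
    by (subst suminf_ennreal2) (use assms in \<open>auto simp: sums_iff\<close>)
  then have "pmf (embed_pmf c) k = c k" for k
    using assms(1) by (intro pmf_embed_pmf) auto
  then show ?thesis using that[of "embed_pmf c"] by blast
qed

lemma t_stable_measure_pmf:
  assumes "laguerre_polya (pmf \<mu>)"
  shows "t_stable_measure (measure_pmf \<mu>)"
proof -
  obtain j where "j \<in> set_pmf \<mu>" using set_pmf_not_empty[of \<mu>] by blast
  then have "0 < pmf \<mu> j" by (simp add: pmf_positive)
  moreover have "(\<Sum>k\<le>n. pmf \<mu> k) \<le> 1" for n
    using measure_measure_pmf_finite[of "{..n}" \<mu>] by (metis finite_atMost measure_pmf.prob_le_1)
  ultimately show ?thesis
    unfolding t_stable_measure_def measure_pmf_single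
    by (intro laguerre_polya_imp_t_stable[OF assms])
qed

lemma harmonic_sequence_at_right_0:
  "filterlim (\<lambda>n. 1 / real (Suc n)) (at_right 0) sequentially"
proof -
  have "(\<lambda>n. 1 / real (Suc n)) \<longlonglongrightarrow> 0" by (rule LIMSEQ_Suc[OF lim_const_over_n])
  then show ?thesis by (auto simp: filterlim_at intro: always_eventually simp del: of_nat_Suc)
qed

context birth_death_chain
begin

text \<open>By the Markov property the return probability at time t is at least its n-th power at
  time t / n. Bernoulli's inequality and n -> infinity turn the rate at 0 into a bound valid for all
  t.\<close>

lemma transition_diagonal_lower:
  assumes t: "0 < t"
  shows "1 - transition t k k \<le> t * (\<beta> k + \<delta> k)"
proof -
  have super: "transition s k k * transition u k k \<le> transition (s + u) k k" if "0 \<le> s" "0 \<le> u" for s u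
  proof -
    have "space \<Omega> \<in> past \<Omega> X s" unfolding past_def by (rule sigma_sets_top)
    from markov[OF that this, of k k k]
    have "transition s k k * transition u k k
        = P.prob k (space \<Omega> \<inter> {\<omega> \<in> space \<Omega>. X s \<omega> = k \<and> X (s + u) \<omega> = k})"
      by (simp add: transition_def Int_absorb1 Collect_restrict)
    also have "\<dots> \<le> transition (s + u) k k"
      unfolding transition_def using event_eq_measurable[of "s + u" k] that
      by (intro P.finite_measure_mono) (auto simp: sets_P)
    finally show ?thesis .
  qed
  have power: "transition h k k ^ n \<le> transition (real n * h) k k" if "0 \<le> h" for h n
  proof (induction n)
    case (Suc n)
    have "transition h k k * transition h k k ^ n \<le> transition h k k * transition (real n * h) k k"
      using Suc transition_nonneg by (intro mult_left_mono)
    also have "\<dots> \<le> transition (h + real n * h) k k" using that by (intro super) auto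
    finally show ?case by (simp add: algebra_simps)
  qed (simp add: transition_0)
  have "1 - transition t k k \<le> t * ((1 - transition (t / real (Suc n)) k k) / (t / real (Suc n)))" for n
  proof -
    let ?h = "t / real (Suc n)"
    have "1 + real (Suc n) * (transition ?h k k - 1) \<le> (1 + (transition ?h k k - 1)) ^ Suc n"
      using transition_nonneg[of ?h k k] by (intro Bernoulli_inequality) simp
    also have "\<dots> \<le> transition t k k" using power[of ?h "Suc n"] t by simp
    finally have "1 - transition t k k \<le> real (Suc n) * (1 - transition ?h k k)"
      by (simp add: algebra_simps)
    then show ?thesis using t by (simp add: mult.commute)
  qed
  moreover have "(\<lambda>n. t * ((1 - transition (t / real (Suc n)) k k) / (t / real (Suc n)))) \<longlonglongrightarrow> t * (\<beta> k + \<delta> k)"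
  proof -
    have "(\<lambda>n. t / real (Suc n)) \<longlonglongrightarrow> 0" by (rule LIMSEQ_Suc[OF lim_const_over_n])
    then have "filterlim (\<lambda>n. t / real (Suc n)) (at_right 0) sequentially"
      using t by (auto simp: filterlim_at intro: always_eventually simp del: of_nat_Suc)
    from filterlim_compose[OF transition_deriv[of k k] this]
    have "(\<lambda>n. (transition (t / real (Suc n)) k k - 1) / (t / real (Suc n))) \<longlonglongrightarrow> - (\<beta> k + \<delta> k)"
      by (simp add: bd_rate_def)
    from tendsto_mult[OF tendsto_const[of "- t"] this] show ?thesis
      by (simp add: minus_divide_left[symmetric] diff_divide_distrib algebra_simps del: of_nat_Suc)
  qed
  ultimately show ?thesis by (intro LIMSEQ_le_const) auto
qed

text \<open>All off-diagonal entries fit into the mass lost on the diagonal. This is the dominating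
  function for differentiating mixtures in time.\<close>

lemma transition_increment_bound:
  assumes "0 < t"
  shows "\<bar>(transition t k j - (if j = k then 1 else 0)) / t\<bar> \<le> \<beta> k + \<delta> k"
proof -
  have "\<bar>transition t k j - (if j = k then 1 else 0)\<bar> \<le> 1 - transition t k k"
  proof (cases "j = k")
    case True
    then show ?thesis using transition_le_1[of t k k] assms by simp
  next
    case False
    then have "transition t k j + transition t k k \<le> 1"
      using transition_mass[of "{j, k}" t k] assms by simp
    then show ?thesis using False transition_nonneg[of t k j] by simp
  qed
  then show ?thesis
    using transition_diagonal_lower[OF assms, of k] assms
    by (simp add: abs_divide pos_divide_le_eq mult.commute)
qed

lemma mixture_deriv:
  fixes \<mu> :: "nat pmf"
  assumes int: "integrable (measure_pmf \<mu>) (\<lambda>k. \<beta> k + \<delta> k)"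
  shows "(\<lambda>n. ((\<integral>k. transition (1 / real (Suc n)) k j \<partial>measure_pmf \<mu>) - pmf \<mu> j) / (1 / real (Suc n)))
    \<longlonglongrightarrow> (\<integral>k. bd_rate \<beta> \<delta> k j \<partial>measure_pmf \<mu>)"
proof -
  let ?t = "\<lambda>n. 1 / real (Suc n)"
  have "(\<lambda>n. \<integral>k. (transition (?t n) k j - (if j = k then 1 else 0)) / ?t n \<partial>measure_pmf \<mu>)
      \<longlonglongrightarrow> (\<integral>k. bd_rate \<beta> \<delta> k j \<partial>measure_pmf \<mu>)"
  proof (rule integral_dominated_convergence[OF _ _ int])
    show "AE k in measure_pmf \<mu>. (\<lambda>n. (transition (?t n) k j - (if j = k then 1 else 0)) / ?t n)
        \<longlonglongrightarrow> bd_rate \<beta> \<delta> k j"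
      by (intro AE_I2 filterlim_compose[OF transition_deriv harmonic_sequence_at_right_0])
    show "AE k in measure_pmf \<mu>. norm ((transition (?t n) k j - (if j = k then 1 else 0)) / ?t n) \<le> \<beta> k + \<delta> k" for n
      by (intro AE_I2, unfold real_norm_def, rule transition_increment_bound) simp
  qed auto
  moreover have "(\<integral>k. (transition (?t n) k j - (if j = k then 1 else 0)) / ?t n \<partial>measure_pmf \<mu>)
      = ((\<integral>k. transition (?t n) k j \<partial>measure_pmf \<mu>) - pmf \<mu> j) / ?t n" for n
  proof -
    have ind: "(\<integral>k. (if j = k then 1 else 0 :: real) \<partial>measure_pmf \<mu>) = pmf \<mu> j"
      by (subst integral_measure_pmf_real[where A = "{j}"]) (auto split: if_splits)
    have "integrable (measure_pmf \<mu>) (\<lambda>k. if j = k then 1 else 0 :: real)"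
      by (rule measure_pmf.integrable_const_bound[where B = 1]) auto
    then show ?thesis
      using transition_integrable[of "?t n" \<mu> j]
      by (subst integral_divide_zero, subst Bochner_Integration.integral_diff) (auto simp: ind)
  qed
  ultimately show ?thesis by simp
qed

lemma mixture_laguerre_polya:
  assumes "preserves_t_stable P X" "laguerre_polya (pmf \<mu>)" "0 < t"
  shows "laguerre_polya (\<lambda>j. \<integral>k. transition t k j \<partial>measure_pmf \<mu>)"
  using assms t_stable_measure_pmf t_stable_distribution_at_iff[of t \<mu>]
  unfolding preserves_t_stable_def by auto

end

subsection \<open>The rates are quadratic\<close>

lemma nonneg_stable_power: "nonneg_stable p \<Longrightarrow> nonneg_stable (p ^ n)"
  by (induction n) (simp_all add: nonneg_stable_mult one_pCons)

lemma nonneg_stable_monom: "0 \<le> c \<Longrightarrow> nonneg_stable (monom c n)"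
  unfolding monom_altdef
  using nonneg_stable_mult[of "[:c:]"] nonneg_stable_power[OF nonneg_stable_linear[of 0 1]] by simp

context birth_death_chain
begin

text \<open>The generator applied to x^k. For k = 0 the truncated exponent k - 1 does no harm, since
  \<delta> 0 = 0.\<close>

definition generator_poly :: "nat \<Rightarrow> real poly" where
  "generator_poly k = monom (\<beta> k) (Suc k) + monom (\<delta> k) (k - 1) - monom (\<beta> k + \<delta> k) k"

lemma coeff_generator_poly: "coeff (generator_poly k) j = bd_rate \<beta> \<delta> k j"
proof (cases k)
  case 0
  then show ?thesis using death_0 by (auto simp: generator_poly_def bd_rate_def coeff_monom)
next
  case (Suc m)
  then show ?thesis by (auto simp: generator_poly_def bd_rate_def coeff_monom)
qed

text \<open>The factor x clears x^(k-1). At x = -r the combination \<delta> k + r \<beta> k appears,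
  which is why that sequence is studied next.\<close>

lemma poly_generator_poly:
  "x * poly (generator_poly k) x = (1 - x) * (\<delta> k - x * \<beta> k) * x ^ k"
  using death_0 by (cases k) (auto simp: generator_poly_def poly_monom algebra_simps)

text \<open>At positive times the law may have infinite support, but the perturbation argument needs
  polynomials. The laws are therefore replaced by Jensen polynomials of rapidly growing
  order.\<close>

lemma generator_vanishes_at_triple_root:
  assumes pres: "preserves_t_stable P X"
    and \<psi>: "\<psi> = g * [:r, 1:] ^ 3" "poly g (- r) \<noteq> 0"
    and ns: "nonneg_stable \<psi>" and mass: "poly \<psi> 1 = 1"
  shows "poly (\<Sum>k\<le>degree \<psi>. smult (coeff \<psi> k) (generator_poly k)) (- r) = 0"
proof -
  let ?N = "degree \<psi>" and ?T = "\<lambda>n. 1 / real (Suc n)"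
  have "(\<lambda>k. coeff \<psi> k) sums 1" using poly_sums[of \<psi> 1] mass by simp
  then obtain \<mu> where \<mu>: "pmf \<mu> = coeff \<psi>"
    using ex_pmf[of "coeff \<psi>"] nonneg_stable_coeff[OF ns] by blast
  have supp: "k \<in> {..?N}" if "k \<in> set_pmf \<mu>" for k
  proof -
    have "coeff \<psi> k \<noteq> 0" using that by (simp add: set_pmf_iff \<mu>)
    then show ?thesis using le_degree by auto
  qed
  then have "finite (set_pmf \<mu>)" by (meson finite_atMost finite_subset subsetI)
  then have int: "integrable (measure_pmf \<mu>) (\<lambda>k. \<beta> k + \<delta> k)"
    by (rule integrable_measure_pmf_finite)
  define c where "c = (\<lambda>n j. \<integral>k. transition (?T n) k j \<partial>measure_pmf \<mu>)"
  have lp: "laguerre_polya (c n)" for n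
    unfolding c_def using mixture_laguerre_polya[OF pres, of \<mu> "?T n"] laguerre_polya_poly[OF ns]
    by (simp add: \<mu>)
  \<comment> \<open>The truncation error is made smaller than the square of the time step, so that
    it disappears in the difference quotient.\<close>
  have "\<exists>m. n < m \<and> (\<forall>j\<in>{..?N}. coeff \<psi> j * (1 - jensen_weight m j) < (?T n)\<^sup>2)" for n
  proof -
    have "\<forall>\<^sub>F m in sequentially. \<forall>j\<in>{..?N}. coeff \<psi> j * (1 - jensen_weight m j) < (?T n)\<^sup>2"
    proof (intro eventually_ball_finite ballI)
      fix j
      have "(\<lambda>m. coeff \<psi> j * (1 - jensen_weight m j)) \<longlonglongrightarrow> coeff \<psi> j * (1 - 1)"
        by (intro tendsto_intros jensen_weight_tendsto)
      then show "\<forall>\<^sub>F m in sequentially. coeff \<psi> j * (1 - jensen_weight m j) < (?T n)\<^sup>2"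
        by (rule order_tendstoD(2)) simp
    qed simp
    with eventually_gt_at_top[of n]
    have "\<forall>\<^sub>F m in sequentially. n < m \<and> (\<forall>j\<in>{..?N}. coeff \<psi> j * (1 - jensen_weight m j) < (?T n)\<^sup>2)"
      by (rule eventually_conj)
    then show ?thesis by (rule eventually_happens'[OF sequentially_bot])
  qed
  then obtain m where m: "\<And>n. n < m n"
    and close: "\<And>n j. j \<le> ?N \<Longrightarrow> coeff \<psi> j * (1 - jensen_weight (m n) j) < (?T n)\<^sup>2"
    by (metis atMost_iff)
  have m0: "0 < m n" for n using m[of n] by simp
  have m_lim: "filterlim m at_top sequentially"
    by (rule filterlim_at_top_mono[OF filterlim_ident]) (intro always_eventually allI less_imp_le m)
  show ?thesis
  proof (rule triple_root_perturbation[where p = "\<lambda>n. jensen (m n) (c n)" and T = ?T])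
    show "nonneg_stable (jensen (m n) (c n))" for n using lp m0 by (simp add: laguerre_polya_def)
    show "?T \<longlonglongrightarrow> 0" by (rule LIMSEQ_Suc[OF lim_const_over_n])
    show "(\<lambda>n. (coeff (jensen (m n) (c n)) j - coeff \<psi> j) / ?T n)
        \<longlonglongrightarrow> coeff (\<Sum>k\<le>?N. smult (coeff \<psi> k) (generator_poly k)) j" for j
    proof -
      have q: "coeff (\<Sum>k\<le>?N. smult (coeff \<psi> k) (generator_poly k)) j = (\<integral>k. bd_rate \<beta> \<delta> k j \<partial>measure_pmf \<mu>)"
        by (subst integral_measure_pmf_real[where A = "{..?N}"])
          (use supp in \<open>auto simp: coeff_sum coeff_generator_poly \<mu> mult.commute\<close>)
      have w: "(\<lambda>n. jensen_weight (m n) j) \<longlonglongrightarrow> 1"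
        by (rule filterlim_compose[OF jensen_weight_tendsto m_lim])
      have 1: "(\<lambda>n. jensen_weight (m n) j * ((c n j - coeff \<psi> j) / ?T n))
          \<longlonglongrightarrow> 1 * (\<integral>k. bd_rate \<beta> \<delta> k j \<partial>measure_pmf \<mu>)"
        using mixture_deriv[OF int, of j] unfolding c_def \<mu> by (intro tendsto_mult w)
      have 2: "(\<lambda>n. coeff \<psi> j * (1 - jensen_weight (m n) j) / ?T n) \<longlonglongrightarrow> 0"
      proof (rule Lim_null_comparison[OF always_eventually])
        show "\<forall>n. norm (coeff \<psi> j * (1 - jensen_weight (m n) j) / ?T n) \<le> ?T n"
        proof
          fix n
          let ?e = "coeff \<psi> j * (1 - jensen_weight (m n) j)"
          have "0 \<le> ?e" using nonneg_stable_coeff[OF ns] jensen_weight_le_1[OF m0] by simp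
          moreover have "?e \<le> (?T n)\<^sup>2"
            using close[of j n] by (cases "j \<le> ?N") (auto simp: coeff_eq_0 less_imp_le)
          ultimately have "\<bar>?e\<bar> * real (Suc n) \<le> (?T n)\<^sup>2 * real (Suc n)"
            by (intro mult_right_mono) auto
          also have "\<dots> = ?T n" by (simp add: power2_eq_square)
          finally show "norm (?e / ?T n) \<le> ?T n" by (simp add: abs_mult)
        qed
        show "?T \<longlonglongrightarrow> 0" by (rule LIMSEQ_Suc[OF lim_const_over_n])
      qed
      have eq: "(coeff (jensen (m n) (c n)) j - coeff \<psi> j) / ?T n
          = jensen_weight (m n) j * ((c n j - coeff \<psi> j) / ?T n)
            - coeff \<psi> j * (1 - jensen_weight (m n) j) / ?T n" for n
        using m0[of n] by (simp add: coeff_jensen algebra_simps)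
      show ?thesis unfolding eq q using tendsto_diff[OF 1 2] by simp
    qed
    have "\<psi> \<noteq> 0" using mass by auto
    then show "0 < lead_coeff \<psi>"
      using nonneg_stable_coeff[OF ns, of "degree \<psi>"] by (simp add: order_less_le)
  qed (use \<psi> in auto)
qed

text \<open>At -r the coefficients of (x + r)^3 become r^3 times the alternating binomials 1, -3, 3,
  -1, so vanishing there is a vanishing third difference. The factor 1 / (r + 1)^3 makes the total
  mass 1.\<close>

lemma third_difference_rates:
  assumes pres: "preserves_t_stable P X" and r: "0 < r" and u: "u = (\<lambda>k. \<delta> k + r * \<beta> k)"
  shows "u (i + 3) = 3 * u (i + 2) - 3 * u (i + 1) + u i"
proof -
  define g where "g = monom (1 / (r + 1) ^ 3) i"
  define \<psi> where "\<psi> = g * [:r, 1:] ^ 3"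
  have ns: "nonneg_stable \<psi>"
    unfolding \<psi>_def g_def using r
    by (intro nonneg_stable_mult nonneg_stable_power nonneg_stable_linear nonneg_stable_monom) auto
  have cube: "[:r, 1:] ^ 3 = [:r ^ 3, 3 * r\<^sup>2, 3 * r, 1:]"
    by (simp add: power3_eq_cube power2_eq_square)
  have deg: "degree \<psi> = i + 3"
  proof -
    have "degree \<psi> = degree g + degree ([:r, 1:] ^ 3)"
      unfolding \<psi>_def using r by (intro degree_mult_eq) (auto simp: g_def)
    then show ?thesis using r by (simp add: g_def degree_monom_eq cube)
  qed
  define z where "z = 1 / (r + 1) ^ 3"
  have z: "z \<noteq> 0" using r by (simp add: z_def)
  have coeff: "coeff \<psi> (i + l) = z * coeff [:r ^ 3, 3 * r\<^sup>2, 3 * r, 1:] l" for l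
    unfolding \<psi>_def g_def cube z_def by (simp only: coeff_monom_mult) simp
  have coeff0: "coeff \<psi> k = 0" if "k < i" for k
    using that unfolding \<psi>_def g_def by (simp add: coeff_monom_mult)
  have 0: "poly (\<Sum>k\<le>degree \<psi>. smult (coeff \<psi> k) (generator_poly k)) (- r) = 0"
  proof (rule generator_vanishes_at_triple_root[OF pres \<psi>_def _ ns])
    show "poly g (- r) \<noteq> 0" using r by (simp add: g_def poly_monom)
    show "poly \<psi> 1 = 1" using r by (simp add: \<psi>_def g_def poly_monom)
  qed
  have "0 = - r * poly (\<Sum>k\<le>degree \<psi>. smult (coeff \<psi> k) (generator_poly k)) (- r)" by (simp only: 0)
  also have "\<dots> = (\<Sum>k\<le>i + 3. coeff \<psi> k * (- r * poly (generator_poly k) (- r)))"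
    unfolding deg by (simp add: poly_sum sum_distrib_left mult_ac sum_negf)
  also have "\<dots> = (\<Sum>k\<le>i + 3. coeff \<psi> k * ((1 + r) * u k * (- r) ^ k))"
    unfolding poly_generator_poly u by simp
  also have "\<dots> = (\<Sum>k\<in>{i, i + 1, i + 2, i + 3}. coeff \<psi> k * ((1 + r) * u k * (- r) ^ k))"
  proof (rule sum.mono_neutral_right)
    show "\<forall>k\<in>{..i + 3} - {i, i + 1, i + 2, i + 3}. coeff \<psi> k * ((1 + r) * u k * (- r) ^ k) = 0"
    proof
      fix k assume "k \<in> {..i + 3} - {i, i + 1, i + 2, i + 3}"
      then have "k < i" by auto
      then show "coeff \<psi> k * ((1 + r) * u k * (- r) ^ k) = 0" by (simp add: coeff0)
    qed
  qed auto
  also have "\<dots> = coeff \<psi> (i + 0) * ((1 + r) * u i * (- r) ^ i) + coeff \<psi> (i + 1) * ((1 + r) * u (i + 1) * (- r) ^ (i + 1))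
      + coeff \<psi> (i + 2) * ((1 + r) * u (i + 2) * (- r) ^ (i + 2)) + coeff \<psi> (i + 3) * ((1 + r) * u (i + 3) * (- r) ^ (i + 3))"
    by simp
  also have "\<dots> = (1 + r) * (- r) ^ i * r ^ 3 * z * (u i - 3 * u (i + 1) + 3 * u (i + 2) - u (i + 3))"
    unfolding coeff power_add by (simp add: numeral_3_eq_3 numeral_2_eq_2 algebra_simps)
  finally have "(1 + r) * (- r) ^ i * r ^ 3 * z * (u i - 3 * u (i + 1) + 3 * u (i + 2) - u (i + 3)) = 0"
    by simp
  then have "u i - 3 * u (i + 1) + 3 * u (i + 2) - u (i + 3) = 0" using r z by simp
  then show ?thesis by simp
qed

lemma preserves_imp_quadratic_rates:
  assumes "preserves_t_stable P X"
  shows "\<exists>a b c. \<forall>k. \<beta> k = a + b * real k + c * (real k)\<^sup>2"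
    and "\<exists>d1 d2. \<forall>k. \<delta> k = d1 * real k + d2 * (real k)\<^sup>2"
proof -
  \<comment> \<open>Two values of r separate \<delta> from \<beta>.\<close>
  have d: "\<delta> (i + 3) = 3 * \<delta> (i + 2) - 3 * \<delta> (i + 1) + \<delta> i \<and>
      \<beta> (i + 3) = 3 * \<beta> (i + 2) - 3 * \<beta> (i + 1) + \<beta> i" for i
    using third_difference_rates[OF assms _ refl, where r = 1 and i = i]
      third_difference_rates[OF assms _ refl, where r = 2 and i = i] by simp
  then show "\<exists>a b c. \<forall>k. \<beta> k = a + b * real k + c * (real k)\<^sup>2"
    by (intro third_difference_zero_imp_quadratic) blast
  obtain a b c where abc: "\<And>k. \<delta> k = a + b * real k + c * (real k)\<^sup>2"
    using third_difference_zero_imp_quadratic[of \<delta>] d by blast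
  have "a = 0" using abc[of 0] death_0 by simp
  then show "\<exists>d1 d2. \<forall>k. \<delta> k = d1 * real k + d2 * (real k)\<^sup>2" using abc by auto
qed

end

subsection \<open>The birth rates are constant\<close>

text \<open>The Jensen polynomials are exp (- \<nu>) (1 + \<nu> x / n)^n.\<close>

lemma laguerre_polya_poisson:
  assumes "0 < \<nu>"
  shows "laguerre_polya (pmf (poisson_pmf \<nu>))"
  unfolding laguerre_polya_def
proof (intro allI impI)
  fix n :: nat assume n: "0 < n"
  have w: "jensen_weight n k = fact k * real (n choose k) / real n ^ k" for k
  proof -
    have "jensen_weight n k = (\<Prod>i<k. (real n - real i) / real n)"
      unfolding jensen_weight_def using n by (intro prod.cong) (auto simp: field_simps)
    also have "\<dots> = (\<Prod>i<k. real n - real i) / real n ^ k" by (simp add: prod_dividef)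
    also have "(\<Prod>i<k. real n - real i) = fact k * real (n choose k)"
      by (simp add: binomial_gbinomial gbinomial_prod_rev atLeast0LessThan)
    finally show ?thesis .
  qed
  have "jensen n (pmf (poisson_pmf \<nu>)) = [:exp (- \<nu>):] * [:1, \<nu> / real n:] ^ n"
  proof (rule poly_eqI)
    fix k
    show "coeff (jensen n (pmf (poisson_pmf \<nu>))) k = coeff ([:exp (- \<nu>):] * [:1, \<nu> / real n:] ^ n) k"
    proof (cases "k \<le> n")
      case True
      then show ?thesis
        using n assms by (simp add: coeff_jensen w coeff_linear_poly_power power_divide)
    next
      case False
      have "degree ([:1, \<nu> / real n:] ^ n) \<le> n"
        using degree_power_le[of "[:1, \<nu> / real n:]" n] by (simp split: if_splits)
      then show ?thesis using n False by (simp add: coeff_jensen w coeff_eq_0)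
    qed
  qed
  then show "nonneg_stable (jensen n (pmf (poisson_pmf \<nu>)))"
    using assms by (simp only:) (intro nonneg_stable_mult nonneg_stable_power nonneg_stable_linear, auto)
qed

text \<open>4^k dominates 1, k and k^2, and has a finite Poisson mean.\<close>

lemma integrable_poisson_quadratic:
  fixes a b c :: real
  assumes "0 < \<nu>"
  shows "integrable (measure_pmf (poisson_pmf \<nu>)) (\<lambda>k. a + b * real k + c * (real k)\<^sup>2)"
proof (rule Bochner_Integration.integrable_bound)
  have "summable (\<lambda>k. exp (- \<nu>) * ((4 * \<nu>) ^ k / fact k))"
    using summable_exp[of "4 * \<nu>"] by (intro summable_mult) (simp add: field_simps)
  then have "integrable (count_space UNIV) (\<lambda>k. pmf (poisson_pmf \<nu>) k *\<^sub>R (4::real) ^ k)"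
    using assms by (simp add: integrable_count_space_nat_iff abs_mult power_mult_distrib mult_ac)
  then have "integrable (measure_pmf (poisson_pmf \<nu>)) (\<lambda>k. (4::real) ^ k)"
    unfolding measure_pmf_eq_density by (subst integrable_density) auto
  then show "integrable (measure_pmf (poisson_pmf \<nu>)) (\<lambda>k. (\<bar>a\<bar> + \<bar>b\<bar> + \<bar>c\<bar>) * (4::real) ^ k)"
    by (rule integrable_mult_right)
  show "AE k in measure_pmf (poisson_pmf \<nu>). norm (a + b * real k + c * (real k)\<^sup>2) \<le> norm ((\<bar>a\<bar> + \<bar>b\<bar> + \<bar>c\<bar>) * (4::real) ^ k)"
  proof (rule AE_I2)
    fix k
    have k: "real k \<le> 2 ^ k" using of_nat_less_two_power[of k, where 'a = real] by simp
    then have "(real k)\<^sup>2 \<le> (2 ^ k)\<^sup>2" by (intro power_mono) auto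
    also have "(2 ^ k)\<^sup>2 = (4::real) ^ k" by (simp add: power2_eq_square flip: power_mult_distrib)
    finally have k2: "(real k)\<^sup>2 \<le> 4 ^ k" .
    have "(2::real) ^ k \<le> 4 ^ k" by (rule power_mono) auto
    with k have k1: "real k \<le> 4 ^ k" by linarith
    have "\<bar>a + b * real k + c * (real k)\<^sup>2\<bar> \<le> \<bar>a\<bar> * 1 + \<bar>b\<bar> * real k + \<bar>c\<bar> * (real k)\<^sup>2"
    proof -
      have "\<bar>a + b * real k + c * (real k)\<^sup>2\<bar> \<le> \<bar>a\<bar> + \<bar>b * real k\<bar> + \<bar>c * (real k)\<^sup>2\<bar>"
        by linarith
      then show ?thesis by (simp add: abs_mult)
    qed
    also have "\<dots> \<le> \<bar>a\<bar> * 4 ^ k + \<bar>b\<bar> * 4 ^ k + \<bar>c\<bar> * 4 ^ k"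
      using k1 k2 by (intro add_mono mult_left_mono) auto
    finally show "norm (a + b * real k + c * (real k)\<^sup>2) \<le> norm ((\<bar>a\<bar> + \<bar>b\<bar> + \<bar>c\<bar>) * (4::real) ^ k)"
      by (simp add: distrib_right)
  qed
qed auto

context birth_death_chain
begin

text \<open>
  Poisson distributions give equality in Newton's inequality, so its derivative at time 0 is
  an inequality for the rates; for small intensity \<open>\<nu>\<close> the birth rates dominate.
\<close>

lemma newton_derivative_poisson:
  assumes pres: "preserves_t_stable P X" and \<nu>: "0 < \<nu>"
    and int: "integrable (measure_pmf (poisson_pmf \<nu>)) (\<lambda>k. \<beta> k + \<delta> k)"
    and h: "h = (\<lambda>j. real j * \<beta> (j - 1) / \<nu> + \<nu> * \<delta> (Suc j) / real (Suc j) - (\<beta> j + \<delta> j))"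
  shows "h (k + 2) + h k \<le> 2 * h (k + 1)"
proof -
  let ?\<mu> = "poisson_pmf \<nu>" and ?T = "\<lambda>n. 1 / real (Suc n)"
  let ?\<pi> = "pmf (poisson_pmf \<nu>)"
  define c where "c = (\<lambda>n j. \<integral>k. transition (?T n) k j \<partial>measure_pmf ?\<mu>)"
  define g where "g = (\<lambda>n j. (c n j - ?\<pi> j) / ?T n)"
  define G where "G = (\<lambda>j. \<integral>k. bd_rate \<beta> \<delta> k j \<partial>measure_pmf ?\<mu>)"
  have \<pi>_pos: "0 < ?\<pi> j" for j using \<nu> by simp
  have \<pi>_Suc: "?\<pi> (Suc j) = ?\<pi> j * \<nu> / real (Suc j)" for j
    using \<nu> by (simp add: field_simps del: of_nat_Suc)
  have g_lim: "(\<lambda>n. g n j) \<longlonglongrightarrow> G j" for j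
    unfolding g_def c_def G_def by (rule mixture_deriv[OF int])
  \<comment> \<open>\<open>h j\<close> is the logarithmic derivative at time 0 of the mass at
    \<open>j\<close>; its coefficients are the Poisson ratios j / \<nu> and \<nu> / (j + 1) of
    neighbouring masses.\<close>
  have G: "G j = ?\<pi> j * h j" for j
  proof -
    have "G j = (\<Sum>i\<le>Suc j. bd_rate \<beta> \<delta> i j * ?\<pi> i)"
      unfolding G_def
      by (rule integral_measure_pmf_real) (auto simp: bd_rate_def split: if_splits)
    also have "\<dots> = ?\<pi> j * h j"
    proof (cases j)
      case 0
      then show ?thesis using death_0 \<pi>_Suc[of 0] by (simp add: bd_rate_def h algebra_simps del: pmf_poisson)
    next
      case (Suc m)
      have "(\<Sum>i\<le>Suc j. bd_rate \<beta> \<delta> i j * ?\<pi> i) = (\<Sum>i\<in>{m, Suc m, Suc (Suc m)}. bd_rate \<beta> \<delta> i j * ?\<pi> i)"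
        by (rule sum.mono_neutral_right) (auto simp: bd_rate_def Suc)
      also have "\<dots> = \<beta> m * ?\<pi> m - (\<beta> j + \<delta> j) * ?\<pi> j + \<delta> (Suc j) * ?\<pi> (Suc j)"
        unfolding Suc by (simp add: bd_rate_def algebra_simps del: pmf_poisson)
      also have "?\<pi> m = ?\<pi> j * real j / \<nu>"
        unfolding Suc \<pi>_Suc[of m] using \<nu> by (simp del: pmf_poisson of_nat_Suc)
      also have "?\<pi> (Suc j) = ?\<pi> j * \<nu> / real (Suc j)" by (rule \<pi>_Suc)
      finally show ?thesis unfolding h using Suc by (simp add: algebra_simps del: pmf_poisson of_nat_Suc)
    qed
    finally show ?thesis .
  qed
  have lp: "laguerre_polya (c n)" for n
    unfolding c_def using mixture_laguerre_polya[OF pres laguerre_polya_poisson[OF \<nu>], of "?T n"] by simp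
  have eq: "real (k + 2) * (?\<pi> k * ?\<pi> (k + 2)) = real (k + 1) * (?\<pi> (k + 1))\<^sup>2"
  proof -
    have "real (k + 1) * ?\<pi> (k + 1) = \<nu> * ?\<pi> k" "real (k + 2) * ?\<pi> (k + 2) = \<nu> * ?\<pi> (k + 1)"
      using \<pi>_Suc[of k] \<pi>_Suc[of "Suc k"] by (simp_all del: pmf_poisson of_nat_Suc)
    then show ?thesis unfolding power2_eq_square by (metis mult.assoc mult.commute)
  qed
  \<comment> \<open>Subtracting the Poisson equality from Newton's inequality at time
    \<open>?T n\<close> leaves only terms with a factor \<open>?T n\<close>, which is divided
    out.\<close>
  have le: "real (k + 2) * (?\<pi> k * g n (k + 2) + ?\<pi> (k + 2) * g n k + ?T n * g n k * g n (k + 2))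
      \<le> real (k + 1) * (2 * ?\<pi> (k + 1) * g n (k + 1) + ?T n * (g n (k + 1))\<^sup>2)" (is "?l n \<le> ?r n") for n
  proof -
    have cj: "c n j = ?\<pi> j + ?T n * g n j" for j by (simp add: g_def)
    have "real (k + 2) * (c n k * c n (k + 2)) \<le> real (k + 1) * (c n (k + 1))\<^sup>2"
      by (rule laguerre_polya_newton[OF lp])
    moreover have "t * (a * (p0 * g2 + p2 * g0 + t * g0 * g2)) \<le> t * (b * (2 * p1 * g1 + t * g1\<^sup>2))"
      if "a * ((p0 + t * g0) * (p2 + t * g2)) \<le> b * (p1 + t * g1)\<^sup>2" "a * (p0 * p2) = b * p1\<^sup>2"
      for a b t p0 p1 p2 g0 g1 g2 :: real
    proof -
      have "t * (a * (p0 * g2 + p2 * g0 + t * g0 * g2)) = a * ((p0 + t * g0) * (p2 + t * g2)) - a * (p0 * p2)"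
        "t * (b * (2 * p1 * g1 + t * g1\<^sup>2)) = b * (p1 + t * g1)\<^sup>2 - b * p1\<^sup>2"
        by (simp_all add: algebra_simps power2_eq_square)
      with that show ?thesis by linarith
    qed
    ultimately have "?T n * (real (k + 2) * (?\<pi> k * g n (k + 2) + ?\<pi> (k + 2) * g n k + ?T n * g n k * g n (k + 2)))
        \<le> ?T n * (real (k + 1) * (2 * ?\<pi> (k + 1) * g n (k + 1) + ?T n * (g n (k + 1))\<^sup>2))"
      unfolding cj using eq by blast
    then show ?thesis by (rule mult_left_le_imp_le) simp
  qed
  have T: "?T \<longlonglongrightarrow> 0" by (rule LIMSEQ_Suc[OF lim_const_over_n])
  have "?l \<longlonglongrightarrow> real (k + 2) * (?\<pi> k * G (k + 2) + ?\<pi> (k + 2) * G k + 0 * G k * G (k + 2))"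
    by (intro tendsto_intros g_lim T)
  moreover have "?r \<longlonglongrightarrow> real (k + 1) * (2 * ?\<pi> (k + 1) * G (k + 1) + 0 * (G (k + 1))\<^sup>2)"
    by (intro tendsto_intros g_lim T)
  ultimately have "real (k + 2) * (?\<pi> k * G (k + 2) + ?\<pi> (k + 2) * G k + 0 * G k * G (k + 2))
      \<le> real (k + 1) * (2 * ?\<pi> (k + 1) * G (k + 1) + 0 * (G (k + 1))\<^sup>2)"
    by (rule LIMSEQ_le) (use le in blast)
  then have "real (k + 2) * (?\<pi> k * ?\<pi> (k + 2)) * (h (k + 2) + h k)
      \<le> real (k + 1) * (?\<pi> (k + 1))\<^sup>2 * (2 * h (k + 1))"
    unfolding G by (simp add: algebra_simps power2_eq_square del: pmf_poisson)
  then show ?thesis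
    unfolding eq by (rule mult_left_le_imp_le) (intro mult_pos_pos zero_less_power \<pi>_pos, simp)
qed

lemma preserves_imp_constant_birth:
  assumes pres: "preserves_t_stable P X"
  shows "\<beta> k = \<beta> 0"
proof -
  obtain a b c where \<beta>: "\<And>k. \<beta> k = a + b * real k + c * (real k)\<^sup>2"
    using preserves_imp_quadratic_rates(1)[OF pres] by blast
  obtain d1 d2 where \<delta>: "\<And>k. \<delta> k = d1 * real k + d2 * (real k)\<^sup>2"
    using preserves_imp_quadratic_rates(2)[OF pres] by blast
  have ineq: "real (k + 2) * \<beta> (k + 1) + real k * \<beta> (k - 1) \<le> 2 * real (k + 1) * \<beta> k" for k
  proof -
    define A where "A = 2 * real (k + 1) * \<beta> k - real (k + 2) * \<beta> (k + 1) - real k * \<beta> (k - 1)"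
    define B where "B = \<beta> (k + 2) + \<delta> (k + 2) + \<beta> k + \<delta> k - 2 * (\<beta> (k + 1) + \<delta> (k + 1))"
    define C where "C = 2 * \<delta> (Suc (k + 1)) / real (Suc (k + 1)) - \<delta> (Suc (k + 2)) / real (Suc (k + 2)) - \<delta> (Suc k) / real (Suc k)"
    \<comment> \<open>Multiplied by \<nu>, the inequality is polynomial in \<nu>, and its constant
      term A contains birth rates only. It survives as \<nu> decreases to 0.\<close>
    have pos: "0 \<le> A + B * \<nu> + C * \<nu>\<^sup>2" if \<nu>: "0 < \<nu>" for \<nu>
    proof -
      define h where "h = (\<lambda>j. real j * \<beta> (j - 1) / \<nu> + \<nu> * \<delta> (Suc j) / real (Suc j) - (\<beta> j + \<delta> j))"
      have "integrable (measure_pmf (poisson_pmf \<nu>)) (\<lambda>k. a + (b + d1) * real k + (c + d2) * (real k)\<^sup>2)"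
        by (rule integrable_poisson_quadratic[OF \<nu>])
      then have "integrable (measure_pmf (poisson_pmf \<nu>)) (\<lambda>k. \<beta> k + \<delta> k)"
        by (simp add: \<beta> \<delta> algebra_simps)
      from newton_derivative_poisson[OF pres \<nu> this h_def, of k]
      have "0 \<le> (2 * h (k + 1) - h (k + 2) - h k) * \<nu>" using \<nu> by simp
      also have "\<dots> = 2 * (h (k + 1) * \<nu>) - h (k + 2) * \<nu> - h k * \<nu>"
        by (simp add: algebra_simps)
      also have "\<dots> = A + B * \<nu> + C * \<nu>\<^sup>2"
      proof -
        have hj: "h j * \<nu> = real j * \<beta> (j - 1) + \<delta> (Suc j) / real (Suc j) * \<nu>\<^sup>2 - (\<beta> j + \<delta> j) * \<nu>" for j
          unfolding h_def using \<nu>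
          by (simp add: left_diff_distrib distrib_right power2_eq_square del: of_nat_Suc)
        show ?thesis
          unfolding hj A_def B_def C_def by (simp add: algebra_simps del: of_nat_Suc)
      qed
      finally show ?thesis .
    qed
    have "((\<lambda>\<nu>. A + B * \<nu> + C * \<nu>\<^sup>2) \<longlongrightarrow> A + B * 0 + C * 0\<^sup>2) (at_right 0)"
      by (intro tendsto_intros)
    moreover have "\<forall>\<^sub>F \<nu> in at_right 0. 0 \<le> A + B * \<nu> + C * \<nu>\<^sup>2"
      using eventually_at_right_less[of 0] by eventually_elim (rule pos)
    ultimately have "0 \<le> A + B * 0 + C * 0\<^sup>2"
      by (rule tendsto_lowerbound) simp
    then show ?thesis by (simp add: A_def)
  qed
  \<comment> \<open>For quadratic \<beta>, minus the second difference of j \<beta>(j - 1) is linear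
    in k. Large k forces c \<le> 0 against c \<ge> 0 from \<beta> \<ge> 0; then k = 0 forces b \<le>
    0 against b \<ge> 0.\<close>
  have diff: "0 \<le> (- 2 * b - 2 * c) + (- 6 * c) * real k" for k
  proof -
    have "0 \<le> 2 * real (k + 1) * \<beta> k - real (k + 2) * \<beta> (k + 1) - real k * \<beta> (k - 1)" using ineq[of k] by simp
    also have "\<dots> = (- 2 * b - 2 * c) + (- 6 * c) * real k"
    proof (cases k)
      case 0
      then show ?thesis unfolding \<beta> by simp
    next
      case (Suc m)
      have "k - 1 = m" using Suc by simp
      then show ?thesis unfolding \<beta> Suc by (simp add: algebra_simps power2_eq_square)
    qed
    finally show ?thesis .
  qed
  have "0 \<le> - 6 * c" using diff by (rule linear_nonneg)
  moreover have "0 \<le> c"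
    by (rule quadratic_nonneg[of a b]) (use birth_nonneg in \<open>simp only: flip: \<beta>\<close>)
  ultimately have c: "c = 0" by simp
  have "b \<le> 0" using diff[of 0] unfolding c by simp
  moreover have "0 \<le> a + b * real k" for k using birth_nonneg[of k] unfolding \<beta> c by simp
  then have "0 \<le> b" by (rule linear_nonneg)
  ultimately show ?thesis unfolding \<beta> c by simp
qed

end

theorem theorem1p1:
  fixes \<Omega> :: "'w measure"
    and P :: "nat \<Rightarrow> 'w measure"
    and X :: "real \<Rightarrow> 'w \<Rightarrow> nat"
    and \<beta> \<delta> :: "nat \<Rightarrow> real"
  assumes "birth_death_chain \<Omega> P X \<beta> \<delta>"
    and "infinite {k. \<beta> k \<noteq> 0 \<or> \<delta> k \<noteq> 0}"
  shows "preserves_t_stable P X \<longleftrightarrow>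
    (\<forall>k. \<beta> k = \<beta> 0) \<and>
    (\<exists>d1 d2 :: real. \<forall>k. \<delta> k = d1 * real k + d2 * (real k)\<^sup>2)"
proof -
  interpret birth_death_chain \<Omega> P X \<beta> \<delta> by (rule assms(1))
  show ?thesis
  proof
    assume "preserves_t_stable P X"
    then show "(\<forall>k. \<beta> k = \<beta> 0) \<and> (\<exists>d1 d2 :: real. \<forall>k. \<delta> k = d1 * real k + d2 * (real k)\<^sup>2)"
      using preserves_imp_constant_birth preserves_imp_quadratic_rates(2) by blast
  next
    assume "(\<forall>k. \<beta> k = \<beta> 0) \<and> (\<exists>d1 d2 :: real. \<forall>k. \<delta> k = d1 * real k + d2 * (real k)\<^sup>2)"
    then show "preserves_t_stable P X" using preserves_if_quadratic by blast
  qed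
qed

end
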